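(* \textsc{Token Sliding}, parameterized by $k$, admits a kernel with $\mathcal{O}(k^{12})$ vertices on bipartite $C_4$-free graphs.
   Context: \textsc{Token Sliding}: given a graph $G$ and two independent sets $S,T$ of $G$ with $|S|=|T|=k\ge1$, decide whether there is a sequence $S=S_0,\dots,S_\ell=T$ of independent sets of size $k$ such that each $S_{i+1}$ is obtained from $S_i$ by replacing one vertex $u\in S_i$ by a vertex $w\notin S_i$ with $uw\in E(G)$. A graph is $C_4$-free if it has no induced cycle on four vertices. A kernel with at most $f(k)$ vertices is a polynomial-time algorithm mapping each instance of the class to an equivalent instance whose graph has at most $f(k)$ vertices. *)

theory Defs
  imports
    "HOL-Library.Landau_Symbols"
    "HOL-Computational_Algebra.Polynomial"
    "Graph_Theory.Pair_Digraph"
begin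

section \<open>Token sliding\<close>

text \<open>Finite simple undirected graphs are \<^locale>\<open>pair_graph\<close>s: symmetric, loop-free finite
  digraphs in which an edge \<open>uv\<close> is represented by the two arcs \<open>(u, v)\<close> and \<open>(v, u)\<close>.\<close>

definition independent_set :: "'a pair_pre_digraph \<Rightarrow> 'a set \<Rightarrow> bool" where
  "independent_set G I \<longleftrightarrow> I \<subseteq> pverts G \<and> (\<forall>u\<in>I. \<forall>v\<in>I. (u, v) \<notin> parcs G)"

definition slide :: "'a pair_pre_digraph \<Rightarrow> 'a set \<Rightarrow> 'a set \<Rightarrow> bool" where
  "slide G I J \<longleftrightarrow> (\<exists>u w. u \<in> I \<and> w \<notin> I \<and> (u, w) \<in> parcs G \<and> J = (I - {u}) \<union> {w})"

definition slidable :: "'a pair_pre_digraph \<Rightarrow> nat \<Rightarrow> 'a set \<Rightarrow> 'a set \<Rightarrow> bool" where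
  "slidable G k S T \<longleftrightarrow>
     (\<exists>(l::nat) I. I 0 = S \<and> I l = T \<and>
        (\<forall>i\<le>l. independent_set G (I i) \<and> card (I i) = k) \<and>
        (\<forall>i<l. slide G (I i) (I (Suc i))))"

definition bipartite :: "'a pair_pre_digraph \<Rightarrow> bool" where
  "bipartite G \<longleftrightarrow>
     (\<exists>A B. A \<union> B = pverts G \<and> A \<inter> B = {} \<and> parcs G \<subseteq> (A \<times> B) \<union> (B \<times> A))"

definition C4_free :: "'a pair_pre_digraph \<Rightarrow> bool" where
  "C4_free G \<longleftrightarrow>
     \<not> (\<exists>a b c d. distinct [a, b, c, d] \<and> {a, b, c, d} \<subseteq> pverts G \<and>
          (a, b) \<in> parcs G \<and> (b, c) \<in> parcs G \<and> (c, d) \<in> parcs G \<and> (d, a) \<in> parcs G \<and>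
          (a, c) \<notin> parcs G \<and> (b, d) \<notin> parcs G)"

record ts_instance =
  ts_graph :: "nat pair_pre_digraph"
  ts_source :: "nat set"
  ts_target :: "nat set"

text \<open>The vertices of an instance of size \<open>n\<close> are \<open>0, \<dots>, n - 1\<close>, so that instances can be written
  down as input of an algorithm.\<close>

definition ts_valid :: "ts_instance \<Rightarrow> bool" where
  "ts_valid P \<longleftrightarrow>
     pair_graph (ts_graph P) \<and> pverts (ts_graph P) = {..<card (pverts (ts_graph P))} \<and>
     independent_set (ts_graph P) (ts_source P) \<and> independent_set (ts_graph P) (ts_target P) \<and>
     card (ts_source P) = card (ts_target P) \<and> card (ts_source P) \<ge> 1"

definition ts_param :: "ts_instance \<Rightarrow> nat" where
  "ts_param P = card (ts_source P)"

definition ts_yes :: "ts_instance \<Rightarrow> bool" where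
  "ts_yes P \<longleftrightarrow> slidable (ts_graph P) (ts_param P) (ts_source P) (ts_target P)"

text \<open>An instance is written as the number of vertices, the rows of the adjacency matrix, and the
  characteristic vectors of source and target.\<close>

definition ts_encode :: "ts_instance \<Rightarrow> nat list" where
  "ts_encode P = (let n = card (pverts (ts_graph P)) in
     n # concat (map (\<lambda>u. map (\<lambda>v. of_bool ((u, v) \<in> parcs (ts_graph P))) [0..<n]) [0..<n])
       @ map (\<lambda>v. of_bool (v \<in> ts_source P)) [0..<n]
       @ map (\<lambda>v. of_bool (v \<in> ts_target P)) [0..<n])"


section \<open>Polynomial time\<close>

text \<open>The machine model is a random access machine with structured control flow, unit cost,
  finitely many registers and finitely many arrays (both named by numbers; every program mentions
  only finitely many of them). The only arithmetic operations are addition and truncated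
  subtraction, so the bit length of stored numbers grows by at most a constant (depending on the program) per step. Hence
  polynomial time here agrees with polynomial time on Turing machines. This would fail if
  multiplication were available at unit cost.\<close>

datatype aexp =
    Const nat
  | Reg nat
  | Read nat aexp \<comment> \<open>array, index\<close>
  | Add aexp aexp
  | Sub aexp aexp

datatype bexp =
    Less aexp aexp
  | Neg bexp
  | Conj bexp bexp

datatype com =
    Skip
  | Assign nat aexp
  | Write nat aexp aexp \<comment> \<open>array, index, value\<close>
  | Seq com com
  | Cond bexp com com
  | While bexp com

record state =
  regs :: "nat \<Rightarrow> nat"
  arrs :: "nat \<Rightarrow> nat \<Rightarrow> nat"

primrec aval :: "aexp \<Rightarrow> state \<Rightarrow> nat" where
  "aval (Const n) s = n"
| "aval (Reg x) s = regs s x"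
| "aval (Read a e) s = arrs s a (aval e s)"
| "aval (Add e1 e2) s = aval e1 s + aval e2 s"
| "aval (Sub e1 e2) s = aval e1 s - aval e2 s"

primrec bval :: "bexp \<Rightarrow> state \<Rightarrow> bool" where
  "bval (Less e1 e2) s \<longleftrightarrow> aval e1 s < aval e2 s"
| "bval (Neg b) s \<longleftrightarrow> \<not> bval b s"
| "bval (Conj b1 b2) s \<longleftrightarrow> bval b1 s \<and> bval b2 s"

text \<open>\<open>exec c s t s'\<close>: started in \<open>s\<close>, the program \<open>c\<close> halts in \<open>s'\<close> after \<open>t\<close> steps. Evaluating the
  expressions in a step costs a constant that depends on the program only, so a step is
  charged 1.\<close>

inductive exec :: "com \<Rightarrow> state \<Rightarrow> nat \<Rightarrow> state \<Rightarrow> bool" where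
  Skip: "exec Skip s 1 s"
| Assign: "exec (Assign x e) s 1 (s\<lparr>regs := (regs s)(x := aval e s)\<rparr>)"
| Write: "exec (Write a i e) s 1
    (s\<lparr>arrs := (arrs s)(a := (arrs s a)(aval i s := aval e s))\<rparr>)"
| Seq: "exec c1 s t1 s' \<Longrightarrow> exec c2 s' t2 s'' \<Longrightarrow> exec (Seq c1 c2) s (t1 + t2) s''"
| CondTrue: "bval b s \<Longrightarrow> exec c1 s t s' \<Longrightarrow> exec (Cond b c1 c2) s (Suc t) s'"
| CondFalse: "\<not> bval b s \<Longrightarrow> exec c2 s t s' \<Longrightarrow> exec (Cond b c1 c2) s (Suc t) s'"
| WhileFalse: "\<not> bval b s \<Longrightarrow> exec (While b c) s 1 s"
| WhileTrue: "bval b s \<Longrightarrow> exec c s t1 s' \<Longrightarrow> exec (While b c) s' t2 s'' \<Longrightarrow>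
    exec (While b c) s (Suc (t1 + t2)) s''"

text \<open>The input is given in array 0 and its length in register 0, everything else being 0. The
  output is left in array 1 and its length in register 1.\<close>

definition input_state :: "nat list \<Rightarrow> state" where
  "input_state xs =
     \<lparr>regs = (\<lambda>_. 0)(0 := length xs),
      arrs = (\<lambda>_ _. 0)(0 := (\<lambda>i. if i < length xs then xs ! i else 0))\<rparr>"

definition output_of :: "state \<Rightarrow> nat list" where
  "output_of s = map (arrs s 1) [0..<regs s 1]"

definition polytime_on :: "'i set \<Rightarrow> ('i \<Rightarrow> nat list) \<Rightarrow> ('i \<Rightarrow> 'i) \<Rightarrow> bool" where
  "polytime_on D enc F \<longleftrightarrow>
     (\<exists>(c::com) (p::nat poly). \<forall>x\<in>D. \<exists>t s.
        exec c (input_state (enc x)) t s \<and> output_of s = enc (F x) \<and> t \<le> poly p (length (enc x)))"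


section \<open>Kernels\<close>

definition ts_instances_on :: "(nat pair_pre_digraph \<Rightarrow> bool) \<Rightarrow> ts_instance set" where
  "ts_instances_on C = {P. ts_valid P \<and> C (ts_graph P)}"

text \<open>The parameter of the reduced instance needs no separate bound: it is the size of a vertex
  set of the reduced graph.\<close>

definition ts_kernel_on :: "(nat pair_pre_digraph \<Rightarrow> bool) \<Rightarrow> (nat \<Rightarrow> nat) \<Rightarrow> bool" where
  "ts_kernel_on C f \<longleftrightarrow>
     (\<exists>K. polytime_on (ts_instances_on C) ts_encode K \<and>
        (\<forall>P\<in>ts_instances_on C.
           K P \<in> ts_instances_on C \<and>
           (ts_yes (K P) \<longleftrightarrow> ts_yes P) \<and>
           card (pverts (ts_graph (K P))) \<le> f (ts_param P)))"

end

theory Submission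
  imports Defs "HOL-Real_Asymp.Real_Asymp"
begin

text \<open>Call a set \<open>R\<close> of tokens rigid if every neighbour of a token of \<open>R\<close> is adjacent to another token
  of \<open>R\<close>. Rigid tokens never move, so the largest rigid set can be deleted together with its
  neighbours, after which no rigid set is left: the tokens are loose. In a bipartite graph, loose
  tokens can be pushed to the other side one after the other, and interrupting this process at the
  right moment brings some token along a given path to its first vertex. For \<open>k\<close> loose tokens in a
  connected graph this has two consequences.

  (1) If \<open>T\<close> lies on one side and its vertices have pairwise distance more than 4, then \<open>T\<close> can be
  reached: aim at the vertex of \<open>T - S\<close> closest to \<open>S - T\<close>; then \<open>T - S\<close> shrinks or the distance of
  these two sets drops.

  (2) If some vertex \<open>v\<close> has more than \<open>k\<^sup>2\<close> neighbours of degree at least 2 and there is no 4-cycle,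
  then all configurations are equivalent: as two tokens have at most one common neighbour, at most
  \<open>k\<^sup>2\<close> neighbours of \<open>v\<close> are obstructed, so that all tokens can be collected in the neighbourhood of
  \<open>v\<close>, and there they can be exchanged freely through \<open>v\<close>.

  Tokens never occupy two leaves with the same neighbour, so superfluous leaves can be deleted. A
  component to which neither (1) nor (2) applies then has bounded degree and is covered by few balls
  of radius 4, hence has \<open>O(k\<^sup>9)\<close> vertices. Larger components, and those without tokens, are dropped
  once the numbers of tokens of source and target agree in every component.\<close>


section \<open>Sliding steps and rigid tokens\<close>

text \<open>A set of tokens that is not rigid has a token with a private neighbour, one adjacent to
  no other token of the set; looseness passes to subsets, so such a push is available as long as
  tokens remain unpushed. The danger is that pushed tokens block each other. Keeping the active
  tokens on one side avoids this: pushed tokens all land on the other side, where no two vertices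
  are adjacent, and moves are reversible.

  The 4 in (1) arises because the token arriving at the aim \<open>t\<close> need not be the one at
  the end of the path, but some \<open>u\<close> two steps off the path. If \<open>u\<close> was
  already on a target vertex, distance more than 4 from \<open>t\<close> ensures that the hole left
  at \<open>u\<close> is closer to the misplaced token than \<open>t\<close> was.

  At most \<open>k\<close> components survive, each with at most \<open>2560 * k ^ 9\<close>
  vertices, and a trivial instance has at most 2. The bound is thus of order \<open>k ^ 10\<close>,
  well within \<open>k ^ 12\<close>.

  On the algorithmic side the obstacle is a machine without multiplication: row offsets of matrices
  come from a precomputed table of multiples, and the power in the size bound comes from nested
  sums.\<close>

definition indep :: "('a \<Rightarrow> 'a \<Rightarrow> bool) \<Rightarrow> 'a set \<Rightarrow> bool" where
  "indep E I \<longleftrightarrow> (\<forall>u\<in>I. \<forall>v\<in>I. \<not> E u v)"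

definition move :: "('a \<Rightarrow> 'a \<Rightarrow> bool) \<Rightarrow> 'a set \<Rightarrow> 'a set \<Rightarrow> 'a set \<Rightarrow> bool" where
  "move E V I J \<longleftrightarrow> I \<subseteq> V \<and> J \<subseteq> V \<and> indep E I \<and> indep E J \<and>
     (\<exists>u w. u \<in> I \<and> w \<notin> I \<and> E u w \<and> J = insert w (I - {u}))"

text \<open>The empty chain relates every set to itself, independent or not. Hence independence and
  inclusion in \<open>V\<close> appear as separate hypotheses below.\<close>

abbreviation reach :: "('a \<Rightarrow> 'a \<Rightarrow> bool) \<Rightarrow> 'a set \<Rightarrow> 'a set \<Rightarrow> 'a set \<Rightarrow> bool" where
  "reach E V \<equiv> (move E V)\<^sup>*\<^sup>*"

definition rigid :: "('a \<Rightarrow> 'a \<Rightarrow> bool) \<Rightarrow> 'a set \<Rightarrow> 'a set \<Rightarrow> bool" where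
  "rigid E V R \<longleftrightarrow> (\<forall>u\<in>R. \<forall>w\<in>V. E u w \<longrightarrow> (\<exists>u'\<in>R. u' \<noteq> u \<and> E w u'))"

definition loose :: "('a \<Rightarrow> 'a \<Rightarrow> bool) \<Rightarrow> 'a set \<Rightarrow> 'a set \<Rightarrow> bool" where
  "loose E V S \<longleftrightarrow> (\<forall>R\<subseteq>S. rigid E V R \<longrightarrow> R = {})"

definition edge_in :: "('a \<Rightarrow> 'a \<Rightarrow> bool) \<Rightarrow> 'a set \<Rightarrow> 'a \<Rightarrow> 'a \<Rightarrow> bool" where
  "edge_in E V x y \<longleftrightarrow> x \<in> V \<and> y \<in> V \<and> E x y"

definition connected_on :: "('a \<Rightarrow> 'a \<Rightarrow> bool) \<Rightarrow> 'a set \<Rightarrow> bool" where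
  "connected_on E V \<longleftrightarrow> (\<forall>x\<in>V. \<forall>y\<in>V. (edge_in E V)\<^sup>*\<^sup>* x y)"

lemma loose_subset: "loose E V S \<Longrightarrow> S' \<subseteq> S \<Longrightarrow> loose E V S'"
  by (auto simp: loose_def)

text \<open>\<open>S\<close> itself is not rigid, and the failure of \<open>rigid\<close> at
  \<open>u\<close> and \<open>w\<close> says exactly that \<open>w\<close> is a private neighbour of
  \<open>u\<close>.\<close>

lemma loose_private:
  assumes "loose E V S" "S \<noteq> {}"
  obtains u w where "u \<in> S" "w \<in> V" "E u w" "\<And>u'. u' \<in> S \<Longrightarrow> E w u' \<Longrightarrow> u' = u"
  using assms unfolding loose_def rigid_def by (metis order_refl)

lemma moveI:
  assumes "u \<in> I" "w \<notin> I" "E u w" "J = insert w (I - {u})" "I \<subseteq> V" "J \<subseteq> V" "indep E I" "indep E J"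
  shows "move E V I J"
  using assms unfolding move_def by blast

lemma move_mono: "move E V I J \<Longrightarrow> V \<subseteq> V' \<Longrightarrow> move E V' I J"
  unfolding move_def by blast

lemma reach_mono: "reach E V I J \<Longrightarrow> V \<subseteq> V' \<Longrightarrow> reach E V' I J"
  by (induction rule: rtranclp_induct) (auto intro: rtranclp.rtrancl_into_rtrancl move_mono)

lemma reach_indep: "reach E V I J \<Longrightarrow> indep E I \<Longrightarrow> I \<subseteq> V \<Longrightarrow> indep E J \<and> J \<subseteq> V"
  by (induction rule: rtranclp_induct) (auto simp: move_def)

lemma move_card: assumes "move E V I J" "finite I" shows "card J = card I \<and> finite J"
proof -
  from assms(1) obtain u w where "u \<in> I" "w \<notin> I" "J = insert w (I - {u})"
    unfolding move_def by blast
  then show ?thesis using assms(2) card_Suc_Diff1[of I u] by simp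
qed

lemma reach_card: "reach E V I J \<Longrightarrow> finite I \<Longrightarrow> card J = card I \<and> finite J"
  by (induction rule: rtranclp_induct) (auto dest: move_card)

lemma relpowp_path:
  assumes "(edge_in E V ^^ n) x y"
  obtains p where "p 0 = x" "p n = y" "\<And>i. i < n \<Longrightarrow> edge_in E V (p i) (p (Suc i))"
  using assms unfolding relpowp_fun_conv by blast

lemma relpowp_sub:
  assumes "\<And>i. i < n \<Longrightarrow> Q (p i) (p (Suc i))" "i \<le> j" "j \<le> n"
  shows "(Q ^^ (j - i)) (p i) (p j)"
  unfolding relpowp_fun_conv
  by (rule exI[of _ "\<lambda>l. p (i + l)"]) (use assms in auto)

lemma relpowp_add': "(Q ^^ m) x y \<Longrightarrow> (Q ^^ n) y z \<Longrightarrow> (Q ^^ (m + n)) x z"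
  unfolding relpowp_add by blast

text \<open>The vertex set is kept out of the locale because the same adjacency is studied inside
  varying sets: the unblocked part, the trimmed part, single components.\<close>

locale bip_graph =
  fixes E :: "'a \<Rightarrow> 'a \<Rightarrow> bool" and side :: "'a \<Rightarrow> bool"
  assumes sym: "E u v \<Longrightarrow> E v u"
    and opp: "E u v \<Longrightarrow> side u \<noteq> side v"
begin

lemma irrefl: "\<not> E u u" using opp by blast

lemma same_side: "side u = side v \<Longrightarrow> \<not> E u v" using opp by blast

lemma edge_in_sym: "edge_in E V x y \<Longrightarrow> edge_in E V y x"
  using sym by (auto simp: edge_in_def)

lemma edge_pow_sym: "(edge_in E V ^^ n) x y \<Longrightarrow> (edge_in E V ^^ n) y x"
proof (induction n arbitrary: y)
  case (Suc n)
  then obtain z where "(edge_in E V ^^ n) x z" "edge_in E V z y" by auto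
  with Suc.IH have "(edge_in E V ^^ n) z x" "edge_in E V y z" using edge_in_sym by auto
  then show ?case by (metis relpowp_Suc_I2)
qed auto

lemma edge_rtrancl_sym: "(edge_in E V)\<^sup>*\<^sup>* x y \<Longrightarrow> (edge_in E V)\<^sup>*\<^sup>* y x"
  unfolding rtranclp_power using edge_pow_sym by blast

lemma move_sym: assumes "move E V I J" shows "move E V J I"
proof -
  from assms obtain u w where *: "u \<in> I" "w \<notin> I" "E u w" "J = insert w (I - {u})"
    "I \<subseteq> V" "J \<subseteq> V" "indep E I" "indep E J"
    unfolding move_def by blast
  then have "w \<in> J" "u \<notin> J" "E w u" "I = insert u (J - {w})"
    using sym irrefl by auto
  then show ?thesis using * unfolding move_def by blast
qed

lemma reach_sym: "reach E V I J \<Longrightarrow> reach E V J I"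
  by (induction rule: rtranclp_induct) (auto intro: converse_rtranclp_into_rtranclp move_sym)

lemma move_insert:
  assumes "insert u C \<subseteq> V" "insert w C \<subseteq> V" "E u w" "u \<notin> C" "w \<notin> C"
    "indep E (insert u C)" "indep E (insert w C)"
  shows "move E V (insert u C) (insert w C)"
proof -
  have "w \<noteq> u" using assms irrefl by blast
  then show ?thesis using assms
    by (intro moveI[of u _ w]) auto
qed

lemma indep_insert:
  "indep E (insert u C) \<longleftrightarrow> indep E C \<and> (\<forall>c\<in>C. \<not> E u c)"
  unfolding indep_def using sym irrefl by blast

text \<open>If a token of \<open>R\<close> moved to \<open>w\<close>, rigidity would supply a second
  token adjacent to \<open>w\<close>, and the new set would not be independent.\<close>

lemma rigid_move:
  assumes "rigid E V R" "R \<subseteq> I" "move E V I J" shows "R \<subseteq> J"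
proof -
  from assms obtain u w where *: "u \<in> I" "w \<notin> I" "E u w" "J = insert w (I - {u})"
    "J \<subseteq> V" "indep E J"
    unfolding move_def by blast
  have "u \<notin> R"
  proof
    assume "u \<in> R"
    with * assms(1) obtain u' where "u' \<in> R" "u' \<noteq> u" "E w u'" unfolding rigid_def by blast
    then show False using * assms(2) unfolding indep_def by blast
  qed
  then show ?thesis using * assms(2) by auto
qed

lemma rigid_reach:
  assumes "reach E V I J" "rigid E V R" "R \<subseteq> I" shows "R \<subseteq> J"
  using assms by (induction rule: rtranclp_induct) (auto dest: rigid_move)

text \<open>Moves are reversible, so a rigid subset of \<open>J\<close> would stay in place on the
  way back and already lie in \<open>I\<close>.\<close>

lemma loose_reach: assumes "reach E V I J" "loose E V I" shows "loose E V J"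
  unfolding loose_def
proof (intro allI impI)
  fix R assume "R \<subseteq> J" "rigid E V R"
  then have "R \<subseteq> I" using rigid_reach[OF reach_sym[OF assms(1)]] by blast
  then show "R = {}" using assms(2) \<open>rigid E V R\<close> unfolding loose_def by blast
qed

lemma move_lift:
  assumes "move E C I J" "C \<subseteq> V" "D \<subseteq> V" "indep E D" "C \<inter> D = {}"
    "\<And>c d. c \<in> C \<Longrightarrow> d \<in> D \<Longrightarrow> \<not> E c d"
  shows "move E V (I \<union> D) (J \<union> D)"
proof -
  from assms(1) obtain u w where *: "u \<in> I" "w \<notin> I" "E u w" "J = insert w (I - {u})"
    "I \<subseteq> C" "J \<subseteq> C" "indep E I" "indep E J"
    unfolding move_def by blast
  have ind: "indep E (K \<union> D)" if "K \<subseteq> C" "indep E K" for K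
    using that assms(4,6) sym unfolding indep_def by blast
  show ?thesis
  proof (rule moveI[of u _ w])
    show "indep E (I \<union> D)" "indep E (J \<union> D)" using ind * by blast+
  qed (use * assms(2,3,5) in auto)
qed

lemma reach_lift:
  assumes "reach E C I J" "C \<subseteq> V" "D \<subseteq> V" "indep E D" "C \<inter> D = {}"
    "\<And>c d. c \<in> C \<Longrightarrow> d \<in> D \<Longrightarrow> \<not> E c d"
  shows "reach E V (I \<union> D) (J \<union> D)"
  using assms(1)
  by (induction rule: rtranclp_induct)
     (auto intro: rtranclp.rtrancl_into_rtrancl move_lift[OF _ assms(2-6)])

text \<open>The second hypothesis excludes moves across the border of \<open>C\<close>. A move
  outside \<open>C\<close> projects to no move at all, hence \<open>reach\<close> in the
  conclusion.\<close>

lemma move_project: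
  assumes "move E V I J" "\<And>u w. u \<in> I \<Longrightarrow> w \<in> J \<Longrightarrow> E u w \<Longrightarrow> u \<in> C \<longleftrightarrow> w \<in> C"
  shows "reach E C (I \<inter> C) (J \<inter> C)"
proof -
  from assms obtain u w where *: "u \<in> I" "w \<notin> I" "E u w" "J = insert w (I - {u})"
    "indep E I" "indep E J"
    unfolding move_def by blast
  have iff: "u \<in> C \<longleftrightarrow> w \<in> C" using assms(2)[of u w] * by auto
  show ?thesis
  proof (cases "u \<in> C")
    case True
    have "move E C (I \<inter> C) (J \<inter> C)"
      by (rule moveI[of u _ w]) (use * True iff in \<open>auto simp: indep_def\<close>)
    then show ?thesis by blast
  next
    case False
    then have "I \<inter> C = J \<inter> C" using * iff by auto
    then show ?thesis by simp
  qed
qed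

section \<open>Bringing one of several loose tokens to a prescribed vertex\<close>

lemma lone_walk:
  assumes "C \<subseteq> V" "X \<subseteq> V" "X \<inter> C = {}" "indep E C" "\<And>x c. x \<in> X \<Longrightarrow> c \<in> C \<Longrightarrow> \<not> E x c"
    "(edge_in E X)\<^sup>*\<^sup>* x y"
  shows "reach E V (insert x C) (insert y C)"
  using assms(6)
proof (induction rule: rtranclp_induct)
  case (step y z)
  then have yz: "y \<in> X" "z \<in> X" "E y z" by (auto simp: edge_in_def)
  have "move E V (insert y C) (insert z C)"
    by (rule move_insert) (use yz assms in \<open>auto simp: indep_insert\<close>)
  with step.IH show ?case by simp
qed simp

text \<open>\<open>S\<close> are the tokens not yet pushed, \<open>D\<close> are parked tokens, and \<open>X\<close> is a region in which a lone token
  can walk to \<open>t\<close>. The induction pushes loose tokens to the other side until one of them arrives next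
  to \<open>X\<close>, and takes the pushes back after that token has walked to \<open>t\<close>.\<close>

lemma core:
  assumes "finite S" "loose E V S" "S \<subseteq> V" "D \<subseteq> V" "S \<inter> D = {}" "indep E (S \<union> D)"
    and "\<And>u. u \<in> S \<Longrightarrow> side u = z"
    and "\<And>u w x. u \<in> S \<Longrightarrow> w \<in> V \<Longrightarrow> E u w \<Longrightarrow> x \<in> D \<Longrightarrow> \<not> E w x"
    and "X \<subseteq> V" "X \<inter> (S \<union> D) = {}" "\<And>x y. x \<in> X \<Longrightarrow> y \<in> S \<union> D \<Longrightarrow> \<not> E x y"
    and "\<And>x. x \<in> X \<Longrightarrow> (edge_in E X)\<^sup>*\<^sup>* x t" "t \<in> X"
    and "wb \<in> V" "ub \<in> S" "E ub wb" "hb \<in> X" "E wb hb"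
  shows "\<exists>u\<in>S. \<exists>w\<in>V. \<exists>h\<in>X. E u w \<and> E w h \<and> reach E V (S \<union> D) (insert t ((S - {u}) \<union> D))"
  using assms(1-8,10,11,15,16)
proof (induction "card S" arbitrary: S D ub)
  case 0
  then show ?case by auto
next
  case (Suc m)
  note fin = Suc.prems(1) and loose = Suc.prems(2) and SV = Suc.prems(3) and DV = Suc.prems(4)
    and disj = Suc.prems(5) and ind = Suc.prems(6) and side = Suc.prems(7) and DD = Suc.prems(8)
    and Xdisj = Suc.prems(9) and Xadj = Suc.prems(10) and ub = Suc.prems(11) and ubw = Suc.prems(12)
  have direct: ?case if u: "u \<in> S" "w \<in> V" "E u w" "h \<in> X" "E w h"
    and priv: "\<And>u'. u' \<in> S \<Longrightarrow> E w u' \<Longrightarrow> u' = u" for u w h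
  proof -
    let ?C = "(S - {u}) \<union> D"
    have indC: "indep E ?C" using ind unfolding indep_def by blast
    have wC: "\<forall>c\<in>?C. \<not> E w c"
      using priv DD[OF u(1,2,3)] by auto
    have w: "w \<notin> S \<union> D" using ind u unfolding indep_def by blast
    have hC: "h \<notin> ?C" "\<forall>c\<in>?C. \<not> E h c" using u(4) Xdisj Xadj by auto
    have uC: "\<forall>c\<in>?C. \<not> E u c" using ind u unfolding indep_def by blast
    have ind3: "indep E (insert u ?C)" "indep E (insert w ?C)" "indep E (insert h ?C)"
      using indC uC wC hC unfolding indep_insert[of _ ?C] by blast+
    have hV: "h \<in> V" using u(4) assms(9) by blast
    have "move E V (insert u ?C) (insert w ?C)"
      by (rule move_insert) (use u w disj ind3 SV DV in auto)
    moreover have "move E V (insert w ?C) (insert h ?C)"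
      by (rule move_insert) (use u w hV hC ind3 SV DV in auto)
    moreover have "reach E V (insert h ?C) (insert t ?C)"
    proof (rule lone_walk[of _ _ X])
      show "(edge_in E X)\<^sup>*\<^sup>* h t" using assms(12)[OF u(4)] .
      show "\<And>x c. x \<in> X \<Longrightarrow> c \<in> ?C \<Longrightarrow> \<not> E x c" using Xadj by blast
    qed (use SV DV assms(9) Xdisj indC in blast)+
    moreover have "insert u ?C = S \<union> D" using u by auto
    ultimately have "reach E V (S \<union> D) (insert t ?C)"
      using converse_rtranclp_into_rtranclp[of "move E V"] by metis
    then show ?thesis using u by blast
  qed
  have uall: "\<not> E x y" if "x \<in> S \<union> D" "y \<in> S \<union> D" for x y
    using ind that unfolding indep_def by blast
  show ?case
  proof (cases "\<exists>u w h. u \<in> S \<and> w \<in> V \<and> E u w \<and> h \<in> X \<and> E w h \<and> (\<forall>u'\<in>S. E w u' \<longrightarrow> u' = u)")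
    case True
    then show ?thesis using direct by blast
  next
    case False
    obtain u w where uw: "u \<in> S" "w \<in> V" "E u w" and priv: "\<And>u'. u' \<in> S \<Longrightarrow> E w u' \<Longrightarrow> u' = u"
      using loose_private[OF loose] ub by blast
    have wX: "\<not> E w h" if "h \<in> X" for h using False uw priv that by blast
    \<comment> \<open>\<open>wb\<close> touches \<open>X\<close>, so with \<open>ub\<close> as its
      only neighbour in \<open>S\<close> the first case would apply. It therefore has two neighbours
      in \<open>S\<close>, one of them different from \<open>u\<close>, and stays a valid entry to
      \<open>X\<close> after \<open>u\<close> has been parked.\<close>
    obtain u1 where u1: "u1 \<in> S" "u1 \<noteq> u" "E u1 wb"
    proof (cases "\<forall>u'\<in>S. E wb u' \<longrightarrow> u' = ub")
      case True
      then show ?thesis using False ub ubw assms(14,17,18) by blast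
    next
      case False
      then obtain u' where "u' \<in> S" "E wb u'" "u' \<noteq> ub" by blast
      then show ?thesis using that ub ubw sym by blast
    qed
    let ?S = "S - {u}" and ?D = "insert w D"
    have w: "w \<notin> S \<union> D" using ind uw by (auto simp: indep_def)
    have sw: "side w \<noteq> z" using opp uw side by blast
    have DDw: "\<not> E w x" if "x \<in> D" for x using DD[OF uw that] .
    have ind': "indep E (?S \<union> ?D)"
    proof -
      have "?S \<union> ?D = insert w (?S \<union> D)" by auto
      moreover have "indep E (?S \<union> D)" using ind by (auto simp: indep_def)
      ultimately show ?thesis using priv DDw by (auto simp: indep_insert)
    qed
    have "\<exists>u'\<in>?S. \<exists>w'\<in>V. \<exists>h\<in>X. E u' w' \<and> E w' h \<and>
        reach E V (?S \<union> ?D) (insert t ((?S - {u'}) \<union> ?D))"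
    proof (rule Suc.hyps(1))
      show "m = card ?S" using Suc.hyps(2) uw fin by simp
      show "loose E V ?S" using loose loose_subset by blast
      show "\<And>ua wa x. ua \<in> ?S \<Longrightarrow> wa \<in> V \<Longrightarrow> E ua wa \<Longrightarrow> x \<in> ?D \<Longrightarrow> \<not> E wa x"
      proof -
        \<comment> \<open>Every neighbour of an unpushed token lies on the same side as the freshly
          parked \<open>w\<close>, so \<open>w\<close> obstructs none of them.\<close>
        fix ua wa x assume a: "ua \<in> ?S" "wa \<in> V" "E ua wa" "x \<in> ?D"
        have "side wa \<noteq> z" using opp a side by blast
        then have "\<not> E wa w" using same_side sw by blast
        then show "\<not> E wa x" using a DD by blast
      qed
      show "X \<inter> (?S \<union> ?D) = {}"
      proof -
        have "w \<notin> X" using Xadj uw sym by blast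
        then show ?thesis using Xdisj by auto
      qed
      show "\<And>x y. x \<in> X \<Longrightarrow> y \<in> ?S \<union> ?D \<Longrightarrow> \<not> E x y"
        using Xadj wX sym by blast
    qed (use fin SV DV uw disj w side u1 ind' in auto)
    then obtain u' w' h where u': "u' \<in> ?S" "w' \<in> V" "h \<in> X" "E u' w'" "E w' h"
      and r: "reach E V (?S \<union> ?D) (insert t ((?S - {u'}) \<union> ?D))" by blast
    have "move E V (insert u (?S \<union> D)) (insert w (?S \<union> D))"
    proof (rule move_insert)
      show "indep E (insert u (?S \<union> D))" using uall uw unfolding indep_def by blast
      show "indep E (insert w (?S \<union> D))" using ind' by simp
    qed (use uw w disj SV DV in auto)
    moreover have "insert u (?S \<union> D) = S \<union> D" using uw by auto
    moreover have "insert w (?S \<union> D) = ?S \<union> ?D" by auto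
    ultimately have r1: "reach E V (S \<union> D) (?S \<union> ?D)" by (metis r_into_rtranclp)
    let ?C = "insert t ((?S - {u'}) \<union> D)"
    have tu: "t \<noteq> u" "t \<noteq> w" "t \<in> V" using assms(9,13) Xdisj Xadj uw sym by blast+
    have adjt: "\<not> E t y" if "y \<in> S \<union> D" for y using Xadj assms(13) that by blast
    have indC: "indep E ?C" unfolding indep_insert
      using uall adjt unfolding indep_def by blast
    have "\<not> E t w" using wX[OF assms(13)] sym by blast
    then have "\<forall>c\<in>?C. \<not> E w c" using priv DDw sym by auto
    moreover have "\<forall>c\<in>?C. \<not> E u c" using uall uw(1) adjt[of u] sym by blast
    ultimately have ind2: "indep E (insert w ?C)" "indep E (insert u ?C)"
      using indC unfolding indep_insert[of _ ?C] by blast+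
    have "move E V (insert w ?C) (insert u ?C)"
    proof (rule move_insert)
      show "E w u" using uw(3) sym by blast
      show "w \<notin> ?C" "u \<notin> ?C" using w tu uw(1) disj by auto
    qed (use uw SV DV tu ind2 in auto)
    moreover have "insert w ?C = insert t ((?S - {u'}) \<union> ?D)" by auto
    moreover have "insert u ?C = insert t ((S - {u'}) \<union> D)" using uw u' by auto
    ultimately have "reach E V (S \<union> D) (insert t ((S - {u'}) \<union> D))"
      using rtranclp.rtrancl_into_rtrancl[OF rtranclp_trans[OF r1 r]] by metis
    then show ?thesis using u' by blast
  qed
qed

text \<open>The path is read from the aim \<open>p 0\<close> to a token. \<open>core\<close> applies
  with \<open>X\<close> the segment before the first vertex \<open>p j\<close> that has a neighbour
  in \<open>S\<close>; then \<open>p j\<close> is the entry to \<open>X\<close>. The conclusion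
  records through which \<open>w\<close> and \<open>p l\<close> the arriving token \<open>u\<close>
  is linked to the path, since it can differ from \<open>p d\<close> and its distance matters
  later.\<close>

lemma core_path:
  assumes "finite S" "loose E V S" "S \<subseteq> V" "D \<subseteq> V" "S \<inter> D = {}" "indep E (S \<union> D)"
    and "\<And>u. u \<in> S \<Longrightarrow> side u = z"
    and "\<And>u w x. u \<in> S \<Longrightarrow> w \<in> V \<Longrightarrow> E u w \<Longrightarrow> x \<in> D \<Longrightarrow> \<not> E w x"
    and p: "\<And>i. i < d \<Longrightarrow> edge_in E V (p i) (p (Suc i))" "p d \<in> S" "p 0 \<notin> S" "side (p 0) = z"
    and pD: "\<And>i x. i < d \<Longrightarrow> x \<in> D \<Longrightarrow> p i \<noteq> x \<and> \<not> E (p i) x"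
  shows "\<exists>u\<in>S. \<exists>w\<in>V. \<exists>l<d. E u w \<and> E w (p l) \<and>
    reach E V (S \<union> D) (insert (p 0) ((S - {u}) \<union> D))"
proof -
  define j where "j = (LEAST j. \<exists>s\<in>S. E (p j) s)"
  have d: "d > 0" using p by (cases d) auto
  have ex: "\<exists>s\<in>S. E (p (d - 1)) s" using p(1)[of "d - 1"] p(2) d by (auto simp: edge_in_def)
  then have jd: "j < d" and j: "\<exists>s\<in>S. E (p j) s"
    using d Least_le[of "\<lambda>j. \<exists>s\<in>S. E (p j) s" "d - 1"] LeastI[of "\<lambda>j. \<exists>s\<in>S. E (p j) s" "d - 1"]
    unfolding j_def by auto
  have less: "\<not> E (p i) s" if "i < j" "s \<in> S" for i s
    using not_less_Least that unfolding j_def by blast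
  \<comment> \<open>\<open>p 0\<close> is on the side of the tokens and hence adjacent to none of
    them, so the segment before \<open>p j\<close> is nonempty.\<close>
  have j0: "j > 0" using j assms(7) p(4) same_side by (metis gr0I)
  have pS: "p i \<notin> S" if "i < j" for i
  proof (cases i)
    case 0 then show ?thesis using p by simp
  next
    case (Suc i')
    then show ?thesis using less[of i' "p i"] p(1)[of i'] that jd by (auto simp: edge_in_def)
  qed
  let ?X = "p ` {..<j}"
  have eX: "edge_in E ?X (p i) (p (Suc i))" if "Suc i < j" for i
    using p(1)[of i] that jd by (auto simp: edge_in_def)
  have cX: "(edge_in E ?X)\<^sup>*\<^sup>* (p i) (p 0)" if "i < j" for i
    using that
  proof (induction i)
    case (Suc i)
    then have "edge_in E ?X (p (Suc i)) (p i)" using eX edge_in_sym by blast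
    then show ?case using Suc by (simp add: converse_rtranclp_into_rtranclp)
  qed simp
  obtain s where s: "s \<in> S" "E (p j) s" using j by blast
  have "\<exists>u\<in>S. \<exists>w\<in>V. \<exists>h\<in>?X. E u w \<and> E w h \<and> reach E V (S \<union> D) (insert (p 0) ((S - {u}) \<union> D))"
  proof (rule core[where wb = "p j" and ub = s and hb = "p (j - 1)" and z = z])
    show "?X \<subseteq> V" using p(1) jd by (auto simp: edge_in_def)
    have "p i \<notin> S \<union> D" if "i < j" for i
      using pS[OF that] pD[of i "p i"] that jd by auto
    then show "?X \<inter> (S \<union> D) = {}" by blast
    have "\<not> E (p i) y" if "i < j" "y \<in> S \<union> D" for i y
      using less[OF that(1)] pD[of i y] that jd by auto
    then show "\<And>x y. x \<in> ?X \<Longrightarrow> y \<in> S \<union> D \<Longrightarrow> \<not> E x y" by blast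
    show "\<And>x. x \<in> ?X \<Longrightarrow> (edge_in E ?X)\<^sup>*\<^sup>* x (p 0)" using cX by blast
    show "p 0 \<in> ?X" "p (j - 1) \<in> ?X" using j0 by auto
    show "E s (p j)" using sym[OF s(2)] .
    show "p j \<in> V" using p(1)[OF jd] by (auto simp: edge_in_def)
    show "E (p j) (p (j - 1))" using p(1)[of "j - 1"] jd j0 sym by (auto simp: edge_in_def)
  qed (use assms(1-8) s(1) in blast)+
  then obtain u w l where "u \<in> S" "w \<in> V" "l < j" "E u w" "E w (p l)"
    "reach E V (S \<union> D) (insert (p 0) ((S - {u}) \<union> D))" by blast
  then show ?thesis using jd less_trans by blast
qed

text \<open>A pushed token lands on side \<open>z\<close>, where all of \<open>D\<close> already is
  and where there are no edges. So it suffices that the new place is private with respect to the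
  unpushed tokens \<open>S\<close>.\<close>

lemma push_side:
  assumes "finite S" "loose E V S" "S \<subseteq> V" "D \<subseteq> V" "indep E (S \<union> D)"
    and "\<And>u. u \<in> S \<Longrightarrow> side u \<noteq> z" and "\<And>u. u \<in> D \<Longrightarrow> side u = z"
  shows "\<exists>S'. reach E V (S \<union> D) S' \<and> (\<forall>s\<in>S'. side s = z)"
  using assms
proof (induction "card S" arbitrary: S D)
  case 0
  then show ?case by auto
next
  case (Suc m)
  then have "S \<noteq> {}" by auto
  then obtain u w where uw: "u \<in> S" "w \<in> V" "E u w" and priv: "\<And>u'. u' \<in> S \<Longrightarrow> E w u' \<Longrightarrow> u' = u"
    using loose_private[OF Suc.prems(2)] by blast
  have sw: "side w = z" using opp uw Suc.prems(6) by blast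
  have w: "w \<notin> S \<union> D" using uw Suc.prems(5) by (auto simp: indep_def)
  let ?C = "(S - {u}) \<union> D"
  have indC: "indep E ?C" using Suc.prems(5) by (auto simp: indep_def)
  have wC: "\<forall>c\<in>?C. \<not> E w c" using priv same_side sw Suc.prems(7) by auto
  have u: "u \<notin> D" using uw Suc.prems(6,7) by blast
  have uC: "\<forall>c\<in>?C. \<not> E u c" using Suc.prems(5) uw unfolding indep_def by blast
  have "move E V (insert u ?C) (insert w ?C)"
    by (rule move_insert) (use uw w wC u uC indC Suc.prems(3,4) in \<open>auto simp: indep_insert\<close>)
  moreover have "insert u ?C = S \<union> D" using uw by auto
  moreover have "insert w ?C = (S - {u}) \<union> insert w D" by auto
  moreover have "\<exists>S'. reach E V ((S - {u}) \<union> insert w D) S' \<and> (\<forall>s\<in>S'. side s = z)"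
  proof (rule Suc.hyps(1))
    show "indep E (S - {u} \<union> insert w D)" using indC wC by (auto simp: indep_insert)
    show "m = card (S - {u})" using Suc uw by simp
  qed (use Suc.prems uw sw loose_subset[OF Suc.prems(2)] in auto)
  ultimately show ?case by (metis converse_rtranclp_into_rtranclp)
qed

lemma to_side:
  assumes "finite S" "loose E V S" "S \<subseteq> V" "indep E S"
  shows "\<exists>S'. reach E V S S' \<and> (\<forall>s\<in>S'. side s = z)"
proof -
  let ?A = "{s\<in>S. side s \<noteq> z}" and ?B = "{s\<in>S. side s = z}"
  have S: "?A \<union> ?B = S" by auto
  have "\<exists>S'. reach E V (?A \<union> ?B) S' \<and> (\<forall>s\<in>S'. side s = z)"
    by (rule push_side) (use assms in \<open>auto intro: loose_subset simp: indep_def\<close>)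
  then show ?thesis unfolding S .
qed

lemma indep_side: "(\<And>s. s \<in> S \<Longrightarrow> side s = z) \<Longrightarrow> indep E S"
  using same_side unfolding indep_def by metis

lemma conn_path:
  assumes "connected_on E V" "x \<in> V" "y \<in> V" obtains n where "(edge_in E V ^^ n) x y"
  using assms unfolding connected_on_def by (metis rtranclp_imp_relpowp)

section \<open>Reaching a scattered target set\<close>

definition scattered :: "'a set \<Rightarrow> 'a set \<Rightarrow> bool" where
  "scattered V T \<longleftrightarrow> (\<forall>x\<in>T. \<forall>y\<in>T. x \<noteq> y \<longrightarrow> (\<forall>n\<le>4. \<not> (edge_in E V ^^ n) x y))"

lemma scatter:
  assumes "finite V" "connected_on E V" "S \<subseteq> V" "T \<subseteq> V" "loose E V S" "card S = card T" "scattered V T"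
    "\<And>s. s \<in> S \<Longrightarrow> side s = z" "\<And>s. s \<in> T \<Longrightarrow> side s = z"
  shows "reach E V S T"
proof -
  define P where "P S n \<longleftrightarrow> (\<exists>t s. t \<in> T - S \<and> s \<in> S - T \<and> (edge_in E V ^^ n) t s)" for S n
  define dist where "dist S = (LEAST n. P S n)" for S
  show ?thesis using assms(3,5,6,8)
  proof (induction "(card (T - S), dist S)" arbitrary: S rule: wf_induct[OF wf_lex_prod[OF wf_less_than wf_less_than]])
    case (1 S)
    have fin: "finite S" "finite T" using 1(2) assms(1,4) finite_subset by auto
    show ?case
    proof (cases "S = T")
      case True then show ?thesis by simp
    next
      case False
      have "T - S \<noteq> {}" using False fin 1(4) by (metis Diff_eq_empty_iff card_subset_eq)
      moreover have "S - T \<noteq> {}" using False fin 1(4) by (metis Diff_eq_empty_iff card_subset_eq)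
      ultimately obtain t' s' where "t' \<in> T - S" "s' \<in> S - T" by blast
      moreover obtain n' where "(edge_in E V ^^ n') t' s'"
        using conn_path[OF assms(2)] calculation assms(4) 1(2) by (metis DiffE subsetD)
      ultimately have "P S n'" unfolding P_def by blast
      then have "P S (dist S)" unfolding dist_def by (rule LeastI)
      then obtain t s where ts: "t \<in> T - S" "s \<in> S - T" "(edge_in E V ^^ (dist S)) t s"
        unfolding P_def by blast
      let ?d = "dist S"
      obtain p where p: "p 0 = t" "p ?d = s" "\<And>i. i < ?d \<Longrightarrow> edge_in E V (p i) (p (Suc i))"
        using relpowp_path[OF ts(3)] by blast
      have "\<exists>u\<in>S. \<exists>w\<in>V. \<exists>l<?d. E u w \<and> E w (p l) \<and> reach E V (S \<union> {}) (insert (p 0) ((S - {u}) \<union> {}))"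
      proof (rule core_path[where z = z])
        show "indep E (S \<union> {})" using indep_side[of S z] 1(5) by simp
        show "p ?d \<in> S" "p 0 \<notin> S" "side (p 0) = z" using p ts assms(9) by auto
      qed (use fin 1(2,3,5) p(3) in auto)
      then obtain u w l where u: "u \<in> S" "w \<in> V" "l < ?d" "E u w" "E w (p l)"
        and r: "reach E V S (insert t (S - {u}))" using p by auto
      let ?S = "insert t (S - {u})"
      have IH: "reach E V ?S T" if "card (T - ?S) < card (T - S) \<or>
          card (T - ?S) = card (T - S) \<and> dist ?S < dist S"
      proof (rule "1"(1)[rule_format, OF _ refl])
        show "((card (T - ?S), dist ?S), card (T - S), dist S) \<in> less_than <*lex*> less_than"
          using that by auto
        show "?S \<subseteq> V" using ts assms(4) 1(2) by auto
        show "loose E V ?S" using loose_reach[OF r 1(3)] .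
        show "card ?S = card T" using reach_card[OF r fin(1)] 1(4) by simp
        show "\<And>s. s \<in> ?S \<Longrightarrow> side s = z" using 1(5) ts assms(9) by auto
      qed
      have "card (T - ?S) < card (T - S) \<or>
          card (T - ?S) = card (T - S) \<and> dist ?S < dist S"
      proof (cases "u \<in> T")
        case False
        then have "T - ?S = (T - S) - {t}" by auto
        moreover have "card (T - S - {t}) < card (T - S)"
          by (rule card_Diff1_less) (use ts fin in auto)
        ultimately show ?thesis by simp
      next
        case True
        have ut: "u \<noteq> t" using ts u by auto
        have pV: "p l \<in> V" "u \<in> V" using p(3)[OF u(3)] u 1(2) by (auto simp: edge_in_def)
        have 2: "(edge_in E V ^^ 2) u (p l)"
          using u pV by (auto simp: numeral_2_eq_2 edge_in_def relcompp.simps)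
        have a: "(edge_in E V ^^ l) t (p l)" using relpowp_sub[of ?d _ p 0 l] p u by auto
        have "(edge_in E V ^^ (2 + l)) u t" using relpowp_add'[OF 2 edge_pow_sym[OF a]] .
        \<comment> \<open>Both \<open>u\<close> and \<open>t\<close> lie in the scattered set
          \<open>T\<close>, and the walk over \<open>w\<close> and \<open>p l\<close> joins them in
          \<open>2 + l\<close> steps, so \<open>2 + l\<close> exceeds 4.\<close>
        then have l: "l > 2" using assms(7) ut True ts unfolding scattered_def
          using u(1) by (metis DiffE nat_add_left_cancel_le not_less numeral_Bit0)
        have b: "(edge_in E V ^^ (?d - l)) (p l) s" using relpowp_sub[of ?d _ p l ?d] p u by auto
        have "(edge_in E V ^^ (2 + (?d - l))) u s" using relpowp_add'[OF 2 b] .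
        \<comment> \<open>The vacated \<open>u\<close> is now a missing target vertex. Its walk to
          \<open>s\<close> over \<open>w\<close> and the rest of the path is shorter than
          \<open>?d\<close> because \<open>l > 2\<close>.\<close>
        then have "P ?S (2 + (?d - l))" unfolding P_def using True u ut ts by blast
        then have "dist ?S \<le> 2 + (?d - l)" unfolding dist_def by (rule Least_le)
        then have "dist ?S < ?d" using l u by simp
        moreover have "card (T - ?S) = card (T - S)"
        proof -
          have "T - ?S = insert u (T - S - {t})" using True u ut by auto
          then show ?thesis using ts u fin card_Suc_Diff1[of "T - S" t] by simp
        qed
        ultimately show ?thesis by blast
      qed
      then show ?thesis using IH r by (meson rtranclp_trans)
    qed
  qed
qed

end


section \<open>Vertices with many inner neighbours\<close>

text \<open>The second neighbour \<open>x\<close> is the escape to which a token on \<open>t\<close>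
  can be pushed when another token has to pass through \<open>v\<close>.\<close>

definition inner_nb :: "('a \<Rightarrow> 'a \<Rightarrow> bool) \<Rightarrow> 'a set \<Rightarrow> 'a \<Rightarrow> 'a \<Rightarrow> bool" where
  "inner_nb E V v t \<longleftrightarrow> t \<in> V \<and> E v t \<and> (\<exists>x\<in>V. E t x \<and> x \<noteq> v)"

text \<open>A clean token on a neighbour \<open>t\<close> of \<open>v\<close> can be pushed away from \<open>v\<close> at any time, whatever the other
  tokens do; a clean free vertex \<open>t\<close> can take up a further token.\<close>

definition clean :: "('a \<Rightarrow> 'a \<Rightarrow> bool) \<Rightarrow> 'a set \<Rightarrow> 'a \<Rightarrow> 'a set \<Rightarrow> 'a \<Rightarrow> bool" where
  "clean E V v S t \<longleftrightarrow> inner_nb E V v t \<and> (\<forall>x\<in>V. E t x \<and> x \<noteq> v \<longrightarrow> (\<forall>s\<in>S. E x s \<longrightarrow> s = t))"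

locale bip_c4_graph = bip_graph +
  assumes c4: "E a b \<Longrightarrow> E b c \<Longrightarrow> E c d \<Longrightarrow> E d a \<Longrightarrow> a = c \<or> b = d"
begin

lemma common: "E x a \<Longrightarrow> E x b \<Longrightarrow> E y a \<Longrightarrow> E y b \<Longrightarrow> a \<noteq> b \<Longrightarrow> x = y"
  using c4[of x a y b] sym by blast

text \<open>The places \<open>x q\<close> are all on the side opposite to \<open>S\<close>, hence
  pairwise nonadjacent, and each is adjacent to no token but its own \<open>q\<close>. So the pushes
  can be made one at a time without disturbing each other.\<close>

lemma shift:
  assumes "finite Q" "Q \<subseteq> S" "S \<subseteq> V" "\<And>s. s \<in> S \<Longrightarrow> side s = z"
    "\<And>q. q \<in> Q \<Longrightarrow> x q \<in> V" "\<And>q. q \<in> Q \<Longrightarrow> E q (x q)" "\<And>q s. q \<in> Q \<Longrightarrow> s \<in> S \<Longrightarrow> E (x q) s \<Longrightarrow> s = q"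
  shows "reach E V S ((S - Q) \<union> x ` Q)"
  using assms(1,2,5-7)
proof (induction Q)
  case (insert q Q)
  let ?C = "(S - insert q Q) \<union> x ` Q"
  have IH: "reach E V S ((S - Q) \<union> x ` Q)" using insert by auto
  have eq: "(S - Q) \<union> x ` Q = insert q ?C" using insert by auto
  have sx: "side (x q') \<noteq> z" if "q' \<in> insert q Q" for q'
    using opp[OF insert.prems(3)[OF that]] assms(4) insert.prems(1) that by blast
  have ex: "\<not> E (x q') s" if "q' \<in> insert q Q" "s \<in> S" "s \<noteq> q'" for q' s
    using insert.prems(4) that by blast
  have xx: "\<not> E (x q') (x q'')" if "q' \<in> insert q Q" "q'' \<in> insert q Q" for q' q''
    using sx that same_side by blast
  have indC: "indep E ?C" unfolding indep_def
  proof (intro ballI)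
    fix a b assume "a \<in> ?C" "b \<in> ?C"
    then consider "a \<in> S" "b \<in> S" | q' where "a \<in> S - insert q Q" "b = x q'" "q' \<in> Q"
      | q' where "b \<in> S - insert q Q" "a = x q'" "q' \<in> Q" | q' q'' where "a = x q'" "b = x q''" "q' \<in> Q" "q'' \<in> Q"
      by blast
    then show "\<not> E a b"
    proof cases
      case 1 then show ?thesis using assms(4) same_side by metis
    next
      case 2 then show ?thesis using ex[of q' a] sym by blast
    next
      case 3 then show ?thesis using ex[of q' b] by blast
    next
      case 4 then show ?thesis using xx by blast
    qed
  qed
  have qC: "\<not> E q c" if "c \<in> ?C" for c
  proof -
    from that consider "c \<in> S" | q' where "c = x q'" "q' \<in> Q" by blast
    then show ?thesis
    proof cases
      case 1 then show ?thesis using assms(4) insert.prems(1) same_side by (metis insert_subset)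
    next
      case 2 then show ?thesis using ex[of q' q] insert.prems(1) insert.hyps(2) sym by blast
    qed
  qed
  have xC: "\<not> E (x q) c" if "c \<in> ?C" for c
    using that ex[of q c] xx by blast
  have xnC: "x q \<notin> ?C"
  proof
    assume "x q \<in> ?C"
    then consider "x q \<in> S" | q' where "x q = x q'" "q' \<in> Q" by blast
    then show False
    proof cases
      case 1 then show ?thesis using assms(4) sx by blast
    next
      case 2 then show ?thesis
        using ex[of q' q] insert.prems(1) insert.hyps(2) insert.prems(3)[of q] sym by (metis insertCI subsetD)
    qed
  qed
  have qnC: "q \<notin> ?C" using insert.prems(1) assms(4) sx by blast
  have ins: "indep E (insert q ?C)" "indep E (insert (x q) ?C)"
    using indC qC xC unfolding indep_insert[of _ ?C] by blast+
  have "insert q ?C \<subseteq> V" "insert (x q) ?C \<subseteq> V" using insert.prems(1,2) assms(3) by auto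
  then have "move E V (insert q ?C) (insert (x q) ?C)"
    using move_insert insert.prems(3)[of q] qnC xnC ins by blast
  moreover have "insert (x q) ?C = (S - insert q Q) \<union> x ` insert q Q" by auto
  ultimately show ?case using IH eq by (metis rtranclp.rtrancl_into_rtrancl)
qed simp

lemma via_shift:
  assumes fin: "finite S" and SV: "S \<subseteq> V" and loose: "loose E V S"
    and side: "\<And>s. s \<in> S \<Longrightarrow> side s = z" and QS: "Q \<subseteq> S"
    and x: "\<And>q. q \<in> Q \<Longrightarrow> x q \<in> V" "\<And>q. q \<in> Q \<Longrightarrow> E q (x q)" "\<And>q s. q \<in> Q \<Longrightarrow> s \<in> S \<Longrightarrow> E (x q) s \<Longrightarrow> s = q"
    and p: "\<And>i. i < d \<Longrightarrow> edge_in E V (p i) (p (Suc i))" "p d \<in> S - Q" "p 0 \<notin> S" "side (p 0) = z"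
    and px: "\<And>i q. i < d \<Longrightarrow> q \<in> Q \<Longrightarrow> p i \<noteq> x q \<and> \<not> E (p i) (x q)"
  shows "\<exists>u\<in>S - Q. \<exists>w\<in>V. \<exists>l<d. E u w \<and> E w (p l) \<and> reach E V S (insert (p 0) (S - {u}))"
proof -
  have d: "d > 0" using p by (cases d) auto
  have finQ: "finite Q" using fin QS finite_subset by blast
  have r1: "reach E V S ((S - Q) \<union> x ` Q)"
    by (rule shift[OF finQ QS SV side]) (use x in auto)
  have sx: "side (x q) \<noteq> z" if "q \<in> Q" for q using opp x(2) side QS that by blast
  have "indep E S" using side by (rule indep_side)
  then have ind: "indep E ((S - Q) \<union> x ` Q)" using reach_indep[OF r1] SV by blast
  have "\<exists>u\<in>S - Q. \<exists>w\<in>V. \<exists>l<d. E u w \<and> E w (p l) \<and>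
    reach E V ((S - Q) \<union> x ` Q) (insert (p 0) ((S - Q - {u}) \<union> x ` Q))"
  proof (rule core_path[where z = z])
    show "finite (S - Q)" using fin by simp
    show "loose E V (S - Q)" using loose loose_subset by blast
    show "(S - Q) \<inter> x ` Q = {}" using side sx by blast
    fix u w y assume a: "u \<in> S - Q" "w \<in> V" "E u w" "y \<in> x ` Q"
    have "side w \<noteq> z" using opp a side by blast
    then have "side w = side y" using sx a(4) by auto
    then show "\<not> E w y" by (rule same_side)
  qed (use SV x ind side p px in blast)+
  then obtain u w l where u: "u \<in> S - Q" "w \<in> V" "l < d" "E u w" "E w (p l)"
    and r2: "reach E V ((S - Q) \<union> x ` Q) (insert (p 0) ((S - Q - {u}) \<union> x ` Q))" by blast
  let ?S = "insert (p 0) (S - {u})"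
  have r3: "reach E V ?S ((?S - Q) \<union> x ` Q)"
  proof (rule shift[where z = z])
    show "?S \<subseteq> V" using SV p(1)[OF d] by (auto simp: edge_in_def)
    show "Q \<subseteq> ?S" using QS u by blast
    show "\<And>s. s \<in> ?S \<Longrightarrow> side s = z" using side p(4) by blast
    show "\<And>q s. q \<in> Q \<Longrightarrow> s \<in> ?S \<Longrightarrow> E (x q) s \<Longrightarrow> s = q"
      using x(3) px[OF d] sym by blast
  qed (use finQ x in auto)
  have "(?S - Q) \<union> x ` Q = insert (p 0) ((S - Q - {u}) \<union> x ` Q)" using p(3) QS by blast
  then have "reach E V S ?S" using rtranclp_trans[OF r1 rtranclp_trans[OF r2]] reach_sym[OF r3] by metis
  then show ?thesis using u by blast
qed

text \<open>Here a token enters the neighbourhood of \<open>v\<close> without passing through \<open>v\<close>, by leaving a shortest path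
  \<open>q\<close> from \<open>v\<close> to the tokens at its third vertex; the clean tokens \<open>Q\<close> need not move.\<close>

lemma near_step:
  assumes fin: "finite S" and SV: "S \<subseteq> V" and loose: "loose E V S"
    and side: "\<And>s. s \<in> S \<Longrightarrow> side s = z" and v: "v \<in> V" "side v \<noteq> z"
    and QS: "Q \<subseteq> S" and Q: "\<And>q. q \<in> Q \<Longrightarrow> clean E V v S q"
    and Rv: "\<And>u. u \<in> S - Q \<Longrightarrow> \<not> E v u"
    and q: "\<And>i. i < r \<Longrightarrow> edge_in E V (q i) (q (Suc i))" "q r \<in> S - Q" "r \<ge> 3"
    and min: "\<And>i m. i \<le> r \<Longrightarrow> m < i \<Longrightarrow> \<not> (edge_in E V ^^ m) v (q i)"
    and t: "t \<notin> S" "clean E V v S t" and x: "x \<in> V" "E t x" "x \<noteq> v" "E x (q 3)"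
  shows "\<exists>u\<in>S - Q. reach E V S (insert t (S - {u}))"
proof -
  \<comment> \<open>The path runs \<open>t\<close>, \<open>x\<close>, \<open>q 3\<close>, ...,
    \<open>q r\<close>, bypassing \<open>q 0 = v\<close>, \<open>q 1\<close> and \<open>q 2\<close>;
    this makes its length \<open>r - 1\<close>.\<close>
  define p where "p i = (if i = 0 then t else if i = 1 then x else q (i + 1))" for i :: nat
  define d where "d = r - 1"
  have Qv: "E v f" "f \<in> V" if "f \<in> Q" for f using Q[OF that] by (auto simp: clean_def inner_nb_def)
  have tv: "E v t" "t \<in> V" using t by (auto simp: clean_def inner_nb_def)
  have qV: "q i \<in> V" if "i \<le> r" for i
    using q(1)[of i] q(2) SV that by (cases "i = r") (auto simp: edge_in_def)
  have far1: "\<not> E v (q i)" if "i \<le> r" "1 < i" for i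
    using min[of i 1] that v qV by (auto simp: edge_in_def)
  have far2: "\<not> E f (q i)" if "i \<le> r" "2 < i" "f \<in> Q" for i f
  proof
    assume "E f (q i)"
    then have "(edge_in E V ^^ 2) v (q i)"
      using v qV[OF that(1)] Qv[OF that(3)] by (auto simp: numeral_2_eq_2 edge_in_def relcompp.simps)
    then show False using min[of i 2] that by blast
  qed
  \<comment> \<open>An edge from \<open>x\<close> to \<open>f\<close> would close the 4-cycle
    \<open>x\<close>, \<open>t\<close>, \<open>v\<close>, \<open>f\<close>.\<close>
  have xQ: "\<not> E x f" if "f \<in> Q" for f
    using common[of x t f v] x tv Qv[OF that] sym t(1) QS that by blast
  have tz: "side t = z" using opp[OF tv(1)] v by blast
  have xz: "side x \<noteq> z" using opp[OF x(2)] tz by blast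
  have ind: "indep E S" using side by (rule indep_side)
  have "\<exists>u\<in>S - Q. \<exists>w\<in>V. \<exists>l<d. E u w \<and> E w (p l) \<and>
      reach E V ((S - Q) \<union> Q) (insert (p 0) ((S - Q - {u}) \<union> Q))"
  proof (rule core_path[where z = z])
    show "finite (S - Q)" using fin by simp
    show "loose E V (S - Q)" using loose loose_subset by blast
    show "indep E ((S - Q) \<union> Q)" using ind QS unfolding indep_def by blast
    show "edge_in E V (p i) (p (Suc i))" if "i < d" for i
    proof -
      consider "i = 0" | "i = 1" | "i > 1" by linarith
      then show ?thesis
      proof cases
        case 3 then show ?thesis using q(1)[of "i + 1"] that by (auto simp: p_def d_def)
      qed (use x tv qV[of 3] q(3) in \<open>auto simp: p_def edge_in_def numeral_3_eq_3\<close>)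
    qed
    show "p d \<in> S - Q" using q(2,3) by (auto simp: p_def d_def)
    show "p 0 \<notin> S - Q" "side (p 0) = z" using t tz by (auto simp: p_def)
    show "p i \<noteq> f \<and> \<not> E (p i) f" if "i < d" "f \<in> Q" for i f
    proof -
      consider "i = 0" | "i = 1" | "i > 1" by linarith
      then show ?thesis
      proof cases
        case 1 then show ?thesis using t(1) QS that(2) tz side same_side by (auto simp: p_def)
      next
        case 2
        have "side f = z" using side QS that(2) by blast
        then show ?thesis using 2 xQ[OF that(2)] xz by (auto simp: p_def)
      next
        case 3
        then have "i + 1 \<le> r" "2 < i + 1" using that(1) by (auto simp: d_def)
        then show ?thesis using 3 far1[of "i + 1"] far2[of "i + 1" f] that(2) Qv sym by (auto simp: p_def)
      qed
    qed
    fix u w f assume a: "u \<in> S - Q" "w \<in> V" "E u w" "f \<in> Q"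
    show "\<not> E w f"
    proof
      assume f: "E w f"
      \<comment> \<open>Cleanness of \<open>f\<close> controls all its neighbours except
        \<open>v\<close>, and \<open>v\<close> is excluded because no token outside \<open>Q\<close>
        is adjacent to it. This is what lets \<open>Q\<close> serve as the parked set without
        moving.\<close>
      have "w \<noteq> v" using Rv[OF a(1)] a(3) sym by blast
      then have "u = f" using Q[OF a(4)] a f sym unfolding clean_def by blast
      then show False using a by blast
    qed
  qed (use SV QS side in blast)+
  then obtain u where u: "u \<in> S - Q" "reach E V ((S - Q) \<union> Q) (insert (p 0) ((S - Q - {u}) \<union> Q))"
    by blast
  moreover have "(S - Q) \<union> Q = S" using QS by blast
  moreover have "(S - Q - {u}) \<union> Q = S - {u}" using QS u(1) by blast
  moreover have "p 0 = t" by (simp add: p_def)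
  ultimately show ?thesis by metis
qed

text \<open>\<open>q\<close> and \<open>t\<close> already share the neighbour \<open>v\<close>;
  without 4-cycles they share no other one, so a token on \<open>t\<close> cannot spoil the
  cleanness of another vertex \<open>q\<close>.\<close>

lemma clean_insert:
  assumes "clean E V v S q" "E v t" "S' \<subseteq> insert t S" shows "clean E V v S' q"
proof -
  have "s = q" if "x \<in> V" "E q x" "x \<noteq> v" "s \<in> S'" "E x s" for x s
  proof (cases "s = t")
    case True
    then show ?thesis using common[of x t q v] assms that sym unfolding clean_def inner_nb_def by blast
  next
    case False
    then show ?thesis using assms(1,3) that unfolding clean_def by blast
  qed
  then show ?thesis using assms(1) unfolding clean_def by blast
qed

text \<open>Two counts are added because there are two kinds of progress: a jump to a free but
  possibly unclean neighbour of \<open>v\<close> lowers the first without raising the second, and a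
  jump of an unclean token to a clean vertex lowers the second without raising the first.\<close>

definition weight :: "'a set \<Rightarrow> 'a \<Rightarrow> 'a set \<Rightarrow> nat" where
  "weight V v S = card {s\<in>S. \<not> E v s} + card {s\<in>S. \<not> clean E V v S s}"

lemma weight_less:
  assumes "finite S" "u \<in> S" "\<not> clean E V v S u" "t \<notin> S" "clean E V v S t"
  shows "weight V v (insert t (S - {u})) < weight V v S"
proof -
  let ?S = "insert t (S - {u})"
  have t: "E v t" using assms by (auto simp: clean_def inner_nb_def)
  have cl: "clean E V v ?S q" if "clean E V v S q" for q
    using clean_insert[OF that t, of ?S] by blast
  have "card {s\<in>?S. \<not> E v s} \<le> card {s\<in>S. \<not> E v s}"
    by (rule card_mono) (use assms t in auto)
  moreover have "card {s\<in>?S. \<not> clean E V v ?S s} \<le> card ({s\<in>S. \<not> clean E V v S s} - {u})"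
    by (rule card_mono) (use assms cl in auto)
  moreover have "card ({s\<in>S. \<not> clean E V v S s} - {u}) < card {s\<in>S. \<not> clean E V v S s}"
    by (rule card_Diff1_less) (use assms in auto)
  ultimately show ?thesis unfolding weight_def by linarith
qed

text \<open>Either some token jumps to a free neighbour of \<open>v\<close> at distance 2, or there is a free clean
  neighbour \<open>t\<close>. In the latter case let \<open>y\<close> be the third vertex of a shortest path from \<open>v\<close> to the tokens
  that are not clean. If no clean vertex is at distance 2 from \<open>y\<close>, all clean tokens are pushed
  away from \<open>v\<close> and a token comes to \<open>t\<close> through \<open>v\<close>; otherwise \<open>near_step\<close> applies, if necessary after
  vacating such a clean vertex.\<close>

lemma star_step:
  assumes V: "finite V" "connected_on E V" and SV: "S \<subseteq> V" and loose: "loose E V S"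
    and side: "\<And>s. s \<in> S \<Longrightarrow> side s = z" and v: "v \<in> V" "side v \<noteq> z"
    and deg: "card {t. inner_nb E V v t} > (card S)\<^sup>2"
    and ne: "\<exists>s\<in>S. \<not> clean E V v S s"
  shows "\<exists>S'. reach E V S S' \<and> (\<forall>s\<in>S'. side s = z) \<and> weight V v S' < weight V v S"
proof -
  have fin: "finite S" using V(1) SV finite_subset by blast
  let ?G = "{t. inner_nb E V v t}"
  have ind: "indep E S" using side by (rule indep_side)
  have finG: "finite ?G" by (rule finite_subset[OF _ V(1)]) (auto simp: inner_nb_def)
  have vside: "side t = z" if "E v t" for t using opp[OF that] v(2) by blast
  show ?thesis
  proof (cases "\<exists>t x s. inner_nb E V v t \<and> t \<notin> S \<and> x \<in> V \<and> E t x \<and> x \<noteq> v \<and> s \<in> S \<and> E x s \<and> (\<forall>s'\<in>S. E x s' \<longrightarrow> s' = s)")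
    case True
    then obtain t x s where t: "inner_nb E V v t" "t \<notin> S" and x: "x \<in> V" "E t x" "x \<noteq> v"
      and s: "s \<in> S" "E x s" and priv: "\<forall>s'\<in>S. E x s' \<longrightarrow> s' = s" by blast
    have tv: "t \<in> V" "E v t" using t by (auto simp: inner_nb_def)
    let ?C = "S - {s}"
    have tz: "side t = z" using vside tv by blast
    have xz: "side x \<noteq> z" using opp[OF x(2)] tz by blast
    have i: "indep E ?C" "indep E (insert s ?C)" "indep E (insert t ?C)"
      using side s tz by (auto intro!: indep_side[of _ z])
    have i2: "indep E (insert x ?C)" using i(1) priv unfolding indep_insert[of _ ?C] by blast
    have xS: "x \<notin> S" using xz side by blast
    have m1: "move E V (insert s ?C) (insert x ?C)"
      by (rule move_insert) (use s x SV i i2 xS sym[OF s(2)] in auto)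
    have m2: "move E V (insert x ?C) (insert t ?C)"
      by (rule move_insert) (use s x SV i i2 xS tv t sym[OF x(2)] in auto)
    have "insert s ?C = S" using s by blast
    then have r: "reach E V S (insert t ?C)" using m1 m2
      by (metis r_into_rtranclp rtranclp.rtrancl_into_rtrancl)
    have sv: "\<not> E v s" using common[of x t s v] x s tv t(2) sym by blast
    have scl: "\<not> clean E V v S s" using sv by (auto simp: clean_def inner_nb_def)
    have cl: "clean E V v (insert t ?C) q" if "clean E V v S q" for q
      by (rule clean_insert[OF that tv(2)]) blast
    have "card {a\<in>insert t ?C. \<not> E v a} \<le> card ({a\<in>S. \<not> E v a} - {s})"
      by (rule card_mono) (use fin tv s sv in auto)
    moreover have "card ({a\<in>S. \<not> E v a} - {s}) < card {a\<in>S. \<not> E v a}"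
      by (rule card_Diff1_less) (use fin s sv in auto)
    moreover have "card {a\<in>insert t ?C. \<not> clean E V v (insert t ?C) a} \<le> card (insert t ({a\<in>S. \<not> clean E V v S a} - {s}))"
      by (rule card_mono) (use fin cl in auto)
    moreover have "\<dots> = card {a\<in>S. \<not> clean E V v S a}"
      using fin t(2) s(1) scl card_Suc_Diff1[of "{a\<in>S. \<not> clean E V v S a}" s] by simp
    ultimately have "weight V v (insert t ?C) < weight V v S" unfolding weight_def by linarith
    moreover have "\<forall>s\<in>insert t ?C. side s = z" using tz side by blast
    ultimately show ?thesis using r by blast
  next
    case no: False
    \<comment> \<open>Otherwise every free inner neighbour \<open>t\<close> has an escape
      \<open>x t\<close> with two token neighbours, as one alone would fall under the first case.
      The ordered pair of these tokens determines \<open>x t\<close>, which together with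
      \<open>v\<close> determines \<open>t\<close>. The \<open>k * k - k\<close> pairs and at most
      \<open>k\<close> occupied neighbours, where \<open>k\<close> is \<open>card S\<close>, account
      for at most \<open>k * k\<close> inner neighbours, against \<open>deg\<close>.\<close>
    have "\<exists>t. t \<notin> S \<and> clean E V v S t"
    proof (rule ccontr)
      assume none: "\<not> ?thesis"
      have "\<exists>x s s'. x \<in> V \<and> E t x \<and> x \<noteq> v \<and> s \<in> S \<and> s' \<in> S \<and> E x s \<and> E x s' \<and> s \<noteq> s'" if t: "t \<in> ?G - S" for t
      proof -
        have "\<not> clean E V v S t" "inner_nb E V v t" using none t by auto
        then obtain x s where x: "x \<in> V" "E t x" "x \<noteq> v" "s \<in> S" "E x s" unfolding clean_def by blast
        then obtain s' where "s' \<in> S" "E x s'" "s' \<noteq> s" using no t by blast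
        then show ?thesis using x by blast
      qed
      then obtain x s s' where c: "\<And>t. t \<in> ?G - S \<Longrightarrow> x t \<in> V \<and> E t (x t) \<and> x t \<noteq> v \<and> s t \<in> S \<and> s' t \<in> S \<and> E (x t) (s t) \<and> E (x t) (s' t) \<and> s t \<noteq> s' t"
        by metis
      have "inj_on (\<lambda>t. (s t, s' t)) (?G - S)"
      proof (rule inj_onI)
        fix t t' assume a: "t \<in> ?G - S" "t' \<in> ?G - S" "(s t, s' t) = (s t', s' t')"
        have "x t = x t'" using common[of "x t" "s t" "s' t" "x t'"] c[OF a(1)] c[OF a(2)] a(3) by auto
        then show "t = t'" using common[of "x t" t t' v] c[OF a(1)] c[OF a(2)] a sym by (auto simp: inner_nb_def)
      qed
      moreover have "(\<lambda>t. (s t, s' t)) ` (?G - S) \<subseteq> S \<times> S - (\<lambda>a. (a, a)) ` S"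
        using c by force
      ultimately have "card (?G - S) \<le> card (S \<times> S - (\<lambda>a. (a, a)) ` S)"
        by (rule card_inj_on_le) (use fin in auto)
      also have "\<dots> = card S * card S - card S"
        using fin by (subst card_Diff_subset) (auto simp: card_image inj_on_def card_cartesian_product)
      finally have "card (?G - S) \<le> card S * card S - card S" .
      moreover have "card ?G \<le> card (?G - S) + card S"
        using diff_card_le_card_Diff[OF fin, of ?G] by linarith
      moreover have "card S * card S - card S + card S = card S * card S" by (cases "card S") auto
      ultimately have "card ?G \<le> (card S)\<^sup>2" unfolding power2_eq_square by linarith
      then show False using deg by linarith
    qed
    then obtain t where t: "t \<notin> S" "clean E V v S t" by blast
    define Q where "Q = {s\<in>S. clean E V v S s}"
    have QS: "Q \<subseteq> S" and Qc: "\<And>f. f \<in> Q \<Longrightarrow> clean E V v S f" by (auto simp: Q_def)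
    have R: "u \<in> S - Q \<Longrightarrow> u \<in> S \<and> \<not> clean E V v S u" for u by (auto simp: Q_def)
    obtain s0 where s0: "s0 \<in> S - Q" using ne Q_def by blast
    obtain n0 where n0: "(edge_in E V ^^ n0) v s0" using conn_path[OF V(2) v(1)] s0 SV by blast
    define r where "r = (LEAST n. \<exists>u\<in>S - Q. (edge_in E V ^^ n) v u)"
    have "\<exists>u\<in>S - Q. (edge_in E V ^^ r) v u" unfolding r_def
      by (rule LeastI_ex) (use n0 s0 in blast)
    then obtain s where s: "s \<in> S - Q" "(edge_in E V ^^ r) v s" by blast
    have rmin: "\<not> (edge_in E V ^^ n) v u" if "n < r" "u \<in> S - Q" for n u
      using not_less_Least that unfolding r_def by blast
    obtain q where q0: "q 0 = v" and qr: "q r = s"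
      and qe: "\<And>i. i < r \<Longrightarrow> edge_in E V (q i) (q (Suc i))"
      using relpowp_path[OF s(2)] by blast
    have qV: "q i \<in> V" if "i \<le> r" for i
      using qe[of i] qr s SV that by (cases "i = r") (auto simp: edge_in_def)
    have min: "\<not> (edge_in E V ^^ m) v (q i)" if "i \<le> r" "m < i" for i m
    proof
      assume "(edge_in E V ^^ m) v (q i)"
      moreover have "(edge_in E V ^^ (r - i)) (q i) (q r)"
        using relpowp_sub[of r "edge_in E V" q i r] qe that by blast
      ultimately have "(edge_in E V ^^ (m + (r - i))) v s" using relpowp_add' qr by metis
      moreover have "m + (r - i) < r" using that by linarith
      ultimately show False using rmin s by blast
    qed
    have par: "side (q i) = z \<longleftrightarrow> odd i" if "i \<le> r" for i
      using that
    proof (induction i)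
      case (Suc i)
      have "E (q i) (q (Suc i))" using qe[of i] Suc.prems by (auto simp: edge_in_def)
      then have "side (q i) \<noteq> side (q (Suc i))" by (rule opp)
      then show ?case using Suc by auto
    qed (use q0 v in auto)
    have r_odd: "odd r" using par[of r] qr s side by blast
    \<comment> \<open>The path length \<open>r\<close> is odd, and \<open>r = 1\<close> means that
      an unclean token is itself adjacent to \<open>v\<close>; hence the restriction to
      \<open>r \<ge> 3\<close>.\<close>
    have Rv: "\<not> E v u" if "r \<ge> 3" "u \<in> S - Q" for u
    proof
      assume "E v u"
      then have "(edge_in E V ^^ 1) v u" using v(1) that(2) SV by (auto simp: edge_in_def eq_OO)
      then show False using rmin[of 1 u] that by simp
    qed
    have concl: ?thesis if "u \<in> S - Q" "t' \<notin> S" "clean E V v S t'" "reach E V S (insert t' (S - {u}))" for u t'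
    proof -
      have "weight V v (insert t' (S - {u})) < weight V v S"
        by (rule weight_less) (use fin R that in auto)
      moreover have "\<forall>s\<in>insert t' (S - {u}). side s = z"
        using side vside that(3) by (auto simp: clean_def inner_nb_def)
      ultimately show ?thesis using that(4) by blast
    qed
    \<comment> \<open>This is the only way in which pushing \<open>f\<close> away from
      \<open>v\<close> can collide with the path \<open>q\<close>. For \<open>r = 1\<close> there is
      no vertex \<open>q 3\<close> to speak of, hence the guard.\<close>
    define near where "near f \<longleftrightarrow> r \<ge> 3 \<and> (\<exists>x\<in>V. E f x \<and> x \<noteq> v \<and> E x (q 3))" for f
    have tv: "E v t" "t \<in> V" using t by (auto simp: clean_def inner_nb_def)
    have tz: "side t = z" using vside tv by blast
    have Qv: "E v f" "f \<in> V" if "f \<in> Q" for f using Qc[OF that] by (auto simp: clean_def inner_nb_def)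
    show ?thesis
    proof (cases "\<exists>t'. t' \<notin> S \<and> clean E V v S t' \<and> near t'")
      case True
      then obtain t' x where t': "t' \<notin> S" "clean E V v S t'" "r \<ge> 3"
        and x: "x \<in> V" "E t' x" "x \<noteq> v" "E x (q 3)" unfolding near_def by blast
      have "\<exists>u\<in>S - Q. reach E V S (insert t' (S - {u}))"
      proof (rule near_step[where v = v and q = q and r = r and z = z and x = x])
        show "q r \<in> S - Q" using qr s by simp
        show "\<And>u. u \<in> S - Q \<Longrightarrow> \<not> E v u" using Rv[OF t'(3)] .
      qed (use fin SV loose side v QS Qc qe min t' x in auto)
      then show ?thesis using concl t' by blast
    next
      case nn: False
      show ?thesis
      proof (cases "\<exists>f\<in>Q. near f")
        case True
        then obtain f y where f: "f \<in> Q" "r \<ge> 3" and y: "y \<in> V" "E f y" "y \<noteq> v" "E y (q 3)"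
          unfolding near_def by blast
        define S1 where "S1 = insert t (S - {f})"
        define Q1 where "Q1 = insert t (Q - {f})"
        obtain x where x: "\<And>f. f \<in> Q \<Longrightarrow> x f \<in> V \<and> E f (x f) \<and> x f \<noteq> v"
          using Qc unfolding clean_def inner_nb_def by metis
        define p where "p i = (if i = 0 then t else if i = 1 then v else f)" for i :: nat
        have "\<exists>u\<in>S - (Q - {f}). \<exists>w\<in>V. \<exists>l<2. E u w \<and> E w (p l) \<and> reach E V S (insert (p 0) (S - {u}))"
        proof (rule via_shift[where z = z and x = x])
          show "edge_in E V (p i) (p (Suc i))" if "i < 2" for i
            using that tv v(1) sym[OF tv(1)] Qv[OF f(1)] by (auto simp: p_def edge_in_def less_2_cases_iff)
          show "p 2 \<in> S - (Q - {f})" using f QS by (auto simp: p_def)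
          show "p 0 \<notin> S" "side (p 0) = z" using t tz by (auto simp: p_def)
          show "\<And>g s. g \<in> Q - {f} \<Longrightarrow> s \<in> S \<Longrightarrow> E (x g) s \<Longrightarrow> s = g"
            using Qc x unfolding clean_def by blast
          show "p i \<noteq> x g \<and> \<not> E (p i) (x g)" if "i < 2" "g \<in> Q - {f}" for i g
          proof -
            have g: "g \<in> Q" "side g = z" using that side QS by auto
            have xz: "side (x g) \<noteq> z" using opp[of g "x g"] x[OF g(1)] g(2) by blast
            have "\<not> E t (x g)" using common[of "x g" t g v] x[OF g(1)] tv Qv[OF g(1)] t(1) QS g(1) sym by blast
            moreover have "\<not> E v (x g)" using xz v(2) same_side by blast
            ultimately show ?thesis using xz tz x[OF g(1)] that(1) by (auto simp: p_def)
          qed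
        qed (use fin SV loose side QS x in auto)
        then obtain u w l where u: "u \<in> S - (Q - {f})" "w \<in> V" "l < 2" "E u w" "E w (p l)"
          and r: "reach E V S (insert t (S - {u}))" by (auto simp: p_def)
        \<comment> \<open>An unclean \<open>u\<close> would need a neighbour \<open>w\<close>
          adjacent to \<open>v\<close> or \<open>t\<close>. The first is impossible by sides; in the
          second case \<open>w\<close> is not \<open>v\<close>, so cleanness of the free vertex
          \<open>t\<close> gives \<open>u = t\<close>, a contradiction.\<close>
        have "u = f"
        proof (rule ccontr)
          assume "u \<noteq> f"
          then have uR: "u \<in> S - Q" using u by blast
          have wz: "side w \<noteq> z" using opp[OF u(4)] side uR by blast
          have "l = 0" using u(3,5) same_side[of w v] wz v(2) by (auto simp: p_def less_2_cases_iff)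
          then have "E t w" using u(5) sym by (auto simp: p_def)
          moreover have "w \<noteq> v" using Rv[OF f(2) uR] u(4) sym by blast
          ultimately have "u = t" using t(2) u uR sym unfolding clean_def by blast
          then show False using uR t(1) by blast
        qed
        then have r1: "reach E V S S1" using r S1_def by blast
        have fS: "f \<in> S" using f QS by blast
        have cl1: "clean E V v S1 g" if "clean E V v S g" for g
          by (rule clean_insert[OF that tv(1)]) (auto simp: S1_def)
        have SQ: "S1 - Q1 = S - Q" using t(1) f QS by (auto simp: S1_def Q1_def)
        have "\<exists>u\<in>S1 - Q1. reach E V S1 (insert f (S1 - {u}))"
        proof (rule near_step[where v = v and q = q and r = r and z = z and x = y])
          show "finite S1" using fin by (simp add: S1_def)
          show "S1 \<subseteq> V" using SV tv by (auto simp: S1_def)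
          show "loose E V S1" using loose_reach[OF r1 loose] .
          show "\<And>s. s \<in> S1 \<Longrightarrow> side s = z" using side tz by (auto simp: S1_def)
          show "Q1 \<subseteq> S1" using QS by (auto simp: S1_def Q1_def)
          show "\<And>g. g \<in> Q1 \<Longrightarrow> clean E V v S1 g" using Qc t(2) cl1 by (auto simp: Q1_def)
          show "\<And>u. u \<in> S1 - Q1 \<Longrightarrow> \<not> E v u" using Rv[OF f(2)] SQ by blast
          show "f \<notin> S1" using fS t(1) by (auto simp: S1_def)
          show "clean E V v S1 f" using cl1 Qc f by blast
          show "q r \<in> S1 - Q1" using qr s SQ by simp
        qed (use v qe f min y in auto)
        then obtain u where u: "u \<in> S - Q" "reach E V S1 (insert f (S1 - {u}))" using SQ by auto
        \<comment> \<open>The hole at \<open>f\<close> made by the exchange is filled again, so in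
          total the unclean \<open>u\<close> has been replaced by \<open>t\<close>.\<close>
        have "insert f (S1 - {u}) = insert t (S - {u})"
          using u(1) t(1) f fS by (auto simp: S1_def)
        then have "reach E V S (insert t (S - {u}))" using r1 u(2) by (metis rtranclp_trans)
        then show ?thesis using concl[OF u(1) t] by blast
      next
        case nQ: False
        obtain x where x: "\<And>f. f \<in> Q \<Longrightarrow> x f \<in> V \<and> E f (x f) \<and> x f \<noteq> v"
          using Qc unfolding clean_def inner_nb_def by metis
        define p where "p i = (if i = 0 then t else q (i - 1))" for i :: nat
        have "\<exists>u\<in>S - Q. \<exists>w\<in>V. \<exists>l<Suc r. E u w \<and> E w (p l) \<and> reach E V S (insert (p 0) (S - {u}))"
        proof (rule via_shift[where z = z and x = x])
          show "edge_in E V (p i) (p (Suc i))" if "i < Suc r" for i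
          proof (cases i)
            case 0 then show ?thesis using tv v(1) sym[OF tv(1)] q0 by (auto simp: p_def edge_in_def)
          next
            case (Suc j) then show ?thesis using qe[of j] that by (auto simp: p_def)
          qed
          show "p (Suc r) \<in> S - Q" using qr s by (auto simp: p_def)
          show "p 0 \<notin> S" "side (p 0) = z" using t tz by (auto simp: p_def)
          show "\<And>g s. g \<in> Q \<Longrightarrow> s \<in> S \<Longrightarrow> E (x g) s \<Longrightarrow> s = g"
            using Qc x unfolding clean_def by blast
          show "p i \<noteq> x g \<and> \<not> E (p i) (x g)" if "i < Suc r" "g \<in> Q" for i g
          proof -
            have g: "g \<in> Q" "side g = z" using that side QS by auto
            have xg: "x g \<in> V" "E g (x g)" "x g \<noteq> v" using x[OF g(1)] by auto
            have xz: "side (x g) \<noteq> z" using opp[of g "x g"] xg g(2) by blast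
            have nt: "\<not> E t (x g)" using common[of "x g" t g v] xg tv Qv[OF g(1)] t(1) QS g(1) sym by blast
            have e2: "(edge_in E V ^^ 2) v (x g)"
              using v(1) xg Qv[OF g(1)] by (auto simp: numeral_2_eq_2 edge_in_def relcompp.simps)
            have g3: "\<not> (r \<ge> 3 \<and> E (x g) (q 3))" using nQ g(1) xg unfolding near_def by blast
            show ?thesis
            proof (cases i)
              case 0 then show ?thesis using nt xz tz by (auto simp: p_def)
            next
              case (Suc l)
              then have l: "l < r" "p i = q l" using that by (auto simp: p_def)
              \<comment> \<open>\<open>x g\<close> has a walk of length 2 from \<open>v\<close> and
                lies on the side of \<open>v\<close>, so on a shortest path it could only be
                \<open>q 2\<close>. Then it is adjacent to \<open>q 3\<close> and makes
                \<open>g\<close> near.\<close>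
              have "q l \<noteq> x g"
              proof
                assume eq: "q l = x g"
                then have "even l" using par[of l] l xz by auto
                moreover have "l \<le> 2" using min[of l 2] e2 eq l by (cases "2 < l") auto
                moreover have "l \<noteq> 0" using eq q0 xg(3) by metis
                ultimately have "l = 2" by (cases "l = 1") auto
                moreover from this have "r \<ge> 3" using l by linarith
                moreover have "Suc 2 = 3" by simp
                ultimately show False using g3 eq qe[of 2] l by (metis edge_in_def)
              qed
              \<comment> \<open>Such a \<open>q l\<close> is reached from \<open>v\<close> in 3
                steps and lies on side \<open>z\<close>, so \<open>l\<close> is 1 or 3. For
                \<open>l = 1\<close> the absence of 4-cycles gives \<open>q 1 = g\<close>, and
                \<open>q 2\<close> makes \<open>g\<close> near; for \<open>l = 3\<close> the vertex
                \<open>x g\<close> itself does.\<close>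
              moreover have "\<not> E (q l) (x g)"
              proof
                assume eq: "E (q l) (x g)"
                then have "side (q l) = z" using opp xz by blast
                then have "odd l" using par[of l] l by auto
                have "(edge_in E V ^^ 1) (x g) (q l)" using sym[OF eq] xg qV[of l] l by (auto simp: edge_in_def eq_OO)
                then have "(edge_in E V ^^ (2 + 1)) v (q l)" using relpowp_add'[OF e2] by blast
                then have "(edge_in E V ^^ 3) v (q l)" by simp
                then have "l \<le> 3" using min[of l 3] l by (cases "3 < l") auto
                then have "l = 1 \<or> l = 3" using \<open>odd l\<close> by (cases "l = 2"; cases "l = 0") auto
                then show False
                proof
                  assume l1: "l = 1"
                  have q1: "E v (q 1)" using qe[of 0] l l1 q0 by (auto simp: edge_in_def)
                  have "q 1 = g"
                    using common[of "x g" "q 1" g v] eq[unfolded l1] xg q1 Qv[OF g(1)] sym by blast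
                  have "r \<noteq> 2" using r_odd by auto
                  then have r3: "r \<ge> 3" using l l1 by linarith
                  have s: "Suc 1 = 2" "Suc 2 = 3" by simp_all
                  have e: "E g (q 2)" "E (q 2) (q 3)" "q 2 \<in> V"
                    using qe[of 1, unfolded s \<open>q 1 = g\<close>] qe[of 2, unfolded s] r3
                    unfolding edge_in_def by simp_all
                  have "q 2 \<noteq> v" using min[of 2 0] r3 by auto
                  then show False using nQ g(1) e r3 unfolding near_def by blast
                next
                  assume "l = 3" then show False using g3 eq l(1) sym by (metis less_imp_le)
                qed
              qed
              ultimately show ?thesis using l by simp
            qed
          qed
        qed (use fin SV loose side QS x in auto)
        then obtain u where "u \<in> S - Q" "reach E V S (insert t (S - {u}))" by (auto simp: p_def)
        then show ?thesis using concl t by blast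
      qed
    qed
  qed
qed

lemma star_all:
  assumes V: "finite V" "connected_on E V" and v: "v \<in> V" "side v \<noteq> z"
    and "S \<subseteq> V" "loose E V S" "\<And>s. s \<in> S \<Longrightarrow> side s = z" "card {t. inner_nb E V v t} > (card S)\<^sup>2"
  shows "\<exists>S'. reach E V S S' \<and> (\<forall>s\<in>S'. inner_nb E V v s)"
  using assms(5-)
proof (induction "weight V v S" arbitrary: S rule: less_induct)
  case less
  show ?case
  proof (cases "\<exists>s\<in>S. \<not> clean E V v S s")
    case False
    then show ?thesis by (intro exI[of _ S]) (auto simp: clean_def)
  next
    case True
    obtain S1 where r: "reach E V S S1" and s1: "\<forall>s\<in>S1. side s = z" and w: "weight V v S1 < weight V v S"
      using star_step[OF V less.prems(1-3) v less.prems(4) True] by blast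
    have fin: "finite S" using V(1) less.prems(1) finite_subset by blast
    have ind: "indep E S" using less.prems(3) by (rule indep_side)
    have "\<exists>S'. reach E V S1 S' \<and> (\<forall>s\<in>S'. inner_nb E V v s)"
    proof (rule less.hyps[OF w])
      show "S1 \<subseteq> V" using reach_indep[OF r ind less.prems(1)] by blast
      show "loose E V S1" using loose_reach[OF r less.prems(2)] .
      show "(card S1)\<^sup>2 < card {t. inner_nb E V v t}" using reach_card[OF r fin] less.prems(4) by simp
    qed (use s1 in blast)
    then show ?thesis using r by (meson rtranclp_trans)
  qed
qed

text \<open>An escape of a neighbour of \<open>v\<close> is adjacent to no other neighbour of
  \<open>v\<close>, for lack of 4-cycles. So all tokens but \<open>s\<close> can be pushed away from
  \<open>v\<close>, and \<open>s\<close> passes through \<open>v\<close> to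
  \<open>t\<close>.\<close>

lemma star_swap:
  assumes V: "finite V" and v: "v \<in> V" "side v \<noteq> z"
    and "\<And>s. s \<in> S \<Longrightarrow> inner_nb E V v s" "\<And>s. s \<in> T \<Longrightarrow> inner_nb E V v s" "card S = card T" "loose E V S"
  shows "reach E V S T"
  using assms(4,6,7)
proof (induction "card (S - T)" arbitrary: S)
  case 0
  have gV: "{s. inner_nb E V v s} \<subseteq> V" by (auto simp: inner_nb_def)
  then have fin: "finite S" "finite T" using 0(2) assms(5) V by (metis Collect_mem_eq Collect_mono finite_subset)+
  then have "S \<subseteq> T" using 0 by simp
  then have "S = T" using fin 0 by (simp add: card_subset_eq)
  then show ?case by simp
next
  case (Suc n)
  have gV: "{s. inner_nb E V v s} \<subseteq> V" by (auto simp: inner_nb_def)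
  then have fin: "finite S" "finite T" using Suc.prems(1) assms(5) V by (metis Collect_mem_eq Collect_mono finite_subset)+
  have SV: "S \<subseteq> V" using gV Suc.prems by blast
  have gz: "side s = z" if "inner_nb E V v s" for s using opp that v(2) unfolding inner_nb_def by blast
  obtain s where s: "s \<in> S - T" using Suc.hyps(2) by (metis card.empty ex_in_conv nat.distinct(1))
  have "T - S \<noteq> {}" using s fin Suc.prems(2) by (metis DiffE Diff_eq_empty_iff card_subset_eq)
  then obtain t where t: "t \<in> T - S" by blast
  obtain x where x: "\<And>f. f \<in> S \<Longrightarrow> x f \<in> V \<and> E f (x f) \<and> x f \<noteq> v"
    using Suc.prems(1) unfolding inner_nb_def by metis
  have gt: "inner_nb E V v t" using t assms(5) by blast
  have priv: "h = g" if "g \<in> S" "inner_nb E V v h" "E (x g) h" for g h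
    using common[of "x g" h g v] that x[OF that(1)] Suc.prems(1)[OF that(1)] sym unfolding inner_nb_def by blast
  define p where "p i = (if i = 0 then t else if i = 1 then v else s)" for i :: nat
  have "\<exists>u\<in>S - (S - {s}). \<exists>w\<in>V. \<exists>l<2. E u w \<and> E w (p l) \<and> reach E V S (insert (p 0) (S - {u}))"
  proof (rule via_shift[where z = z and x = x])
    show "edge_in E V (p i) (p (Suc i))" if "i < 2" for i
      using that gt v(1) sym Suc.prems(1)[of s] s by (auto simp: p_def edge_in_def less_2_cases_iff inner_nb_def)
    show "p 2 \<in> S - (S - {s})" "p 0 \<notin> S" "side (p 0) = z" using s t gz[OF gt] by (auto simp: p_def)
    show "\<And>g h. g \<in> S - {s} \<Longrightarrow> h \<in> S \<Longrightarrow> E (x g) h \<Longrightarrow> h = g" using priv Suc.prems(1) by blast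
    show "p i \<noteq> x g \<and> \<not> E (p i) (x g)" if "i < 2" "g \<in> S - {s}" for i g
    proof -
      have g: "g \<in> S" "side g = z" using that gz Suc.prems(1) by auto
      have xz: "side (x g) \<noteq> z" using opp[of g "x g"] x[OF g(1)] g(2) by blast
      have "\<not> E t (x g)" using priv[OF g(1) gt] sym t g(1) by blast
      moreover have "\<not> E v (x g)" using xz v(2) same_side by blast
      ultimately show ?thesis using xz gz[OF gt] x[OF g(1)] that(1) by (auto simp: p_def)
    qed
  qed (use fin SV Suc.prems(1,3) gz x in auto)
  then have r: "reach E V S (insert t (S - {s}))" by (auto simp: p_def)
  have "reach E V (insert t (S - {s})) T"
  proof (rule Suc.hyps(1))
    have "insert t (S - {s}) - T = (S - T) - {s}" using t by blast
    then show "n = card (insert t (S - {s}) - T)" using Suc.hyps(2) s fin by simp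
    show "card (insert t (S - {s})) = card T" using reach_card[OF r fin(1)] Suc.prems(2) by simp
    show "loose E V (insert t (S - {s}))" using loose_reach[OF r Suc.prems(3)] .
  qed (use Suc.prems(1) gt in auto)
  then show ?case using r by (meson rtranclp_trans)
qed

lemma star:
  assumes V: "finite V" "connected_on E V" and v: "v \<in> V" "side v \<noteq> z"
    and S: "S \<subseteq> V" "loose E V S" "\<And>s. s \<in> S \<Longrightarrow> side s = z"
    and T: "T \<subseteq> V" "loose E V T" "\<And>s. s \<in> T \<Longrightarrow> side s = z"
    and card: "card S = card T" and deg: "card {t. inner_nb E V v t} > (card S)\<^sup>2"
  shows "reach E V S T"
proof -
  obtain S' where S': "reach E V S S'" "\<forall>s\<in>S'. inner_nb E V v s"
    using star_all[OF V v S deg] by blast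
  obtain T' where T': "reach E V T T'" "\<forall>s\<in>T'. inner_nb E V v s"
    using star_all[OF V v T] deg card by auto
  have fin: "finite S" "finite T" using V(1) S(1) T(1) finite_subset by auto
  have "reach E V S' T'"
    by (rule star_swap[OF V(1) v])
      (use S' T' card reach_card[OF S'(1) fin(1)] reach_card[OF T'(1) fin(2)] loose_reach[OF S'(1) S(2)] in auto)
  then show ?thesis using S'(1) reach_sym[OF T'(1)] by (meson rtranclp_trans)
qed

end


section \<open>Components, leaves and rigid tokens\<close>

text \<open>Unions of rigid sets are rigid, so this is the greatest rigid subset of
  \<open>S\<close>.\<close>

definition rigid_core :: "('a \<Rightarrow> 'a \<Rightarrow> bool) \<Rightarrow> 'a set \<Rightarrow> 'a set \<Rightarrow> 'a set" where
  "rigid_core E V S = \<Union>{R. R \<subseteq> S \<and> rigid E V R}"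

definition component_of :: "('a \<Rightarrow> 'a \<Rightarrow> bool) \<Rightarrow> 'a set \<Rightarrow> 'a \<Rightarrow> 'a set" where
  "component_of E V v = {w\<in>V. (edge_in E V)\<^sup>*\<^sup>* v w}"

definition leaf :: "('a \<Rightarrow> 'a \<Rightarrow> bool) \<Rightarrow> 'a set \<Rightarrow> 'a \<Rightarrow> 'a \<Rightarrow> bool" where
  "leaf E V v c \<longleftrightarrow> v \<in> V \<and> c \<in> V \<and> E v c \<and> (\<forall>w\<in>V. E v w \<longrightarrow> w = c)"

text \<open>\<open>K\<close> will consist of the source and target tokens. Apart from
  \<open>K\<close>, the leaf with the least number represents all leaves at the same vertex; this
  choice can be tested by comparisons alone.\<close>

definition trim :: "(nat \<Rightarrow> nat \<Rightarrow> bool) \<Rightarrow> nat set \<Rightarrow> nat set \<Rightarrow> nat set" where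
  "trim E V K = {v\<in>V. v \<in> K \<or> \<not> (\<exists>c. leaf E V v c \<and> (\<exists>w<v. leaf E V w c))}"

text \<open>With degrees at most \<open>d = 4 * k ^ 2\<close>, more than
  \<open>k * (5 * d ^ 4) = 1280 * k ^ 9\<close> vertices contain \<open>k\<close> scattered ones.
  Twice as many vertices guarantee this on one of the two sides.\<close>

definition size_bound :: "nat \<Rightarrow> nat" where
  "size_bound k = 2560 * k ^ 9"

lemma rigid_core_rigid: "rigid E V (rigid_core E V S)"
  unfolding rigid_def rigid_core_def by blast

lemma rigid_core_subset: "rigid_core E V S \<subseteq> S"
  unfolding rigid_core_def by blast

lemma rigid_core_greatest: "R \<subseteq> S \<Longrightarrow> rigid E V R \<Longrightarrow> R \<subseteq> rigid_core E V S"
  unfolding rigid_core_def by blast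

section \<open>Balls and large scattered sets\<close>

context bip_graph
begin

lemma ball_card:
  assumes "finite V" "\<And>x. x \<in> V \<Longrightarrow> card {y\<in>V. E x y} \<le> d" "x \<in> V"
  shows "card {y\<in>V. (edge_in E V ^^ n) x y} \<le> d ^ n"
proof (induction n)
  case 0
  have "{y\<in>V. (edge_in E V ^^ 0) x y} = {x}" using assms(3) by auto
  then show ?case by simp
next
  case (Suc n)
  let ?B = "{y\<in>V. (edge_in E V ^^ n) x y}"
  have "{y\<in>V. (edge_in E V ^^ Suc n) x y} \<subseteq> (\<Union>z\<in>?B. {y\<in>V. E z y})"
    by (auto simp: edge_in_def)
  then have "card {y\<in>V. (edge_in E V ^^ Suc n) x y} \<le> card (\<Union>z\<in>?B. {y\<in>V. E z y})"
    by (rule card_mono[rotated]) (use assms(1) in auto)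
  also have "\<dots> \<le> (\<Sum>z\<in>?B. card {y\<in>V. E z y})"
    by (rule card_UN_le) (use assms(1) in auto)
  also have "\<dots> \<le> (\<Sum>z\<in>?B. d)" by (rule sum_mono) (use assms(2) in auto)
  also have "\<dots> = card ?B * d" by simp
  also have "\<dots> \<le> d ^ n * d" using Suc by simp
  finally show ?case by (simp add: mult.commute)
qed

text \<open>The balls of radius 4 around a maximum scattered subset cover \<open>W\<close>. A ball
  consists of the ends of walks of the five lengths from 0 to 4, at most \<open>d ^ 4\<close> for
  each length.\<close>

lemma big_scattered:
  assumes V: "finite V" and deg: "\<And>x. x \<in> V \<Longrightarrow> card {y\<in>V. E x y} \<le> d" "d \<ge> 1"
    and W: "W \<subseteq> V" and big: "card W > k * (5 * d ^ 4)"
  shows "\<exists>T\<subseteq>W. scattered V T \<and> card T = k"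
proof -
  let ?F = "{T. T \<subseteq> W \<and> scattered V T}"
  have finW: "finite W" using V W finite_subset by blast
  have "finite ?F" "?F \<noteq> {}" using finW by (auto simp: scattered_def)
  then obtain M where M: "M \<subseteq> W" "scattered V M" and max: "\<And>T. T \<subseteq> W \<Longrightarrow> scattered V T \<Longrightarrow> card T \<le> card M"
    using Max_in[of "card ` ?F"] Max_ge[of "card ` ?F"] by (smt (verit, ccfv_SIG) empty_is_image finite_imageI imageE imageI mem_Collect_eq)
  have finM: "finite M" using finW M finite_subset by blast
  have "card M \<ge> k"
  proof (rule ccontr)
    assume less: "\<not> card M \<ge> k"
    have "W \<subseteq> (\<Union>m\<in>M. \<Union>n\<in>{..4}. {y\<in>V. (edge_in E V ^^ n) m y})"
    proof
      fix y assume y: "y \<in> W"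
      show "y \<in> (\<Union>m\<in>M. \<Union>n\<in>{..4}. {y\<in>V. (edge_in E V ^^ n) m y})"
      proof (rule ccontr)
        assume no: "\<not> ?thesis"
        have no': "\<not> (edge_in E V ^^ n) m y" if "m \<in> M" "n \<le> 4" for m n
          using no that y W by blast
        then have no'': "\<not> (edge_in E V ^^ n) y m" if "m \<in> M" "n \<le> 4" for m n
          using that edge_pow_sym by blast
        have "y \<notin> M" using no'[of y 0] by auto
        have "scattered V (insert y M)"
          using M(2) no' no'' unfolding scattered_def by blast
        then have "card (insert y M) \<le> card M" using max M y by blast
        then show False using \<open>y \<notin> M\<close> finM by simp
      qed
    qed
    then have "card W \<le> card (\<Union>m\<in>M. \<Union>n\<in>{..4}. {y\<in>V. (edge_in E V ^^ n) m y})"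
      by (rule card_mono[rotated]) (use finM V in auto)
    also have "\<dots> \<le> (\<Sum>m\<in>M. card (\<Union>n\<in>{..4}. {y\<in>V. (edge_in E V ^^ n) m y}))"
      by (rule card_UN_le[OF finM])
    also have "\<dots> \<le> (\<Sum>m\<in>M. 5 * d ^ 4)"
    proof (rule sum_mono)
      fix m assume "m \<in> M"
      then have mV: "m \<in> V" using M W by blast
      have "card (\<Union>n\<in>{..4}. {y\<in>V. (edge_in E V ^^ n) m y}) \<le> (\<Sum>n\<le>4. card {y\<in>V. (edge_in E V ^^ n) m y})"
        by (rule card_UN_le) simp
      also have "\<dots> \<le> (\<Sum>n\<le>(4::nat). d ^ 4)"
      proof (rule sum_mono)
        fix n :: nat assume "n \<in> {..4}"
        then have "d ^ n \<le> d ^ 4" using deg(2) by (intro power_increasing) auto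
        then show "card {y\<in>V. (edge_in E V ^^ n) m y} \<le> d ^ 4"
          using ball_card[OF V deg(1) mV, of n] by linarith
      qed
      finally show "card (\<Union>n\<in>{..4}. {y\<in>V. (edge_in E V ^^ n) m y}) \<le> 5 * d ^ 4" by simp
    qed
    also have "\<dots> = card M * (5 * d ^ 4)" by simp
    also have "\<dots> \<le> k * (5 * d ^ 4)" using less by (intro mult_right_mono) auto
    finally show False using big by linarith
  qed
  then obtain T where T: "T \<subseteq> M" "card T = k" by (meson obtain_subset_with_card_n)
  then have "scattered V T" using M(2) unfolding scattered_def by blast
  then show ?thesis using T M(1) by blast
qed

text \<open>A rigid set \<open>R\<close> of the remaining graph would form, together with the core,
  a rigid set of the whole graph: a deleted neighbour of \<open>R\<close> is adjacent to a core
  token, which serves as the second neighbour. This contradicts maximality of the core.\<close>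

lemma rigid_core_loose:
  assumes "indep E S" "S \<subseteq> V"
  shows "loose E (V - rigid_core E V S - {v. \<exists>u\<in>rigid_core E V S. E u v}) (S - rigid_core E V S)"
  unfolding loose_def
proof (intro allI impI)
  let ?C = "rigid_core E V S"
  let ?V = "V - ?C - {v. \<exists>u\<in>?C. E u v}"
  fix R assume R: "R \<subseteq> S - ?C" "rigid E ?V R"
  have "rigid E V (R \<union> ?C)" unfolding rigid_def
  proof (intro ballI impI)
    fix u w assume a: "u \<in> R \<union> ?C" "w \<in> V" "E u w"
    show "\<exists>u'\<in>R \<union> ?C. u' \<noteq> u \<and> E w u'"
    proof (cases "u \<in> ?C")
      case True
      then show ?thesis using rigid_core_rigid[of E V S] a unfolding rigid_def by blast
    next
      case False
      have "w \<notin> ?C" using a False R(1) rigid_core_subset[of E V S] assms(1) unfolding indep_def by blast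
      show ?thesis
      proof (cases "\<exists>u'\<in>?C. E u' w")
        case True
        then obtain u' where u': "u' \<in> ?C" "E u' w" by blast
        then have "u' \<noteq> u" "E w u'" using False sym[OF u'(2)] by auto
        then show ?thesis using u'(1) by blast
      next
        case no: False
        then show ?thesis using R(2) a False \<open>w \<notin> ?C\<close> unfolding rigid_def by blast
      qed
    qed
  qed
  then have "R \<union> ?C \<subseteq> ?C" using R(1) rigid_core_subset[of E V S] by (intro rigid_core_greatest) auto
  then show "R = {}" using R(1) by blast
qed

lemma rigid_core_inside:
  assumes "indep E S" "S \<subseteq> V" "C \<subseteq> S"
  shows "S - C \<subseteq> V - C - {v. \<exists>u\<in>C. E u v}"
  using assms unfolding indep_def by blast

text \<open>\<open>C\<close> stays occupied throughout, so no other token ever stands next to it and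
  every move takes place in the remaining graph. Reversibility forces both ends to have the same
  core.\<close>

lemma rigid_core_reach:
  assumes "indep E S" "S \<subseteq> V" "indep E T" "T \<subseteq> V"
  defines "C \<equiv> rigid_core E V S"
  shows "reach E V S T \<longleftrightarrow> rigid_core E V T = C \<and> reach E (V - C - {v. \<exists>u\<in>C. E u v}) (S - C) (T - C)"
proof
  let ?V = "V - C - {v. \<exists>u\<in>C. E u v}"
  have CS: "C \<subseteq> S" unfolding C_def by (rule rigid_core_subset)
  have Cr: "rigid E V C" unfolding C_def by (rule rigid_core_rigid)
  have inV: "I \<inter> ?V = I - C" if "indep E I" "I \<subseteq> V" "C \<subseteq> I" for I
    using rigid_core_inside[OF that] by blast
  {
    assume r: "reach E V S T"
    have "C \<subseteq> rigid_core E V T" using rigid_reach[OF r Cr CS] Cr by (rule rigid_core_greatest)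
    moreover have "rigid_core E V T \<subseteq> C" unfolding C_def
      using rigid_reach[OF reach_sym[OF r] rigid_core_rigid rigid_core_subset] rigid_core_rigid by (rule rigid_core_greatest)
    moreover have "reach E ?V (S \<inter> ?V) (T \<inter> ?V)" using r
    proof (induction rule: rtranclp_induct)
      case (step I J)
      have I: "indep E I" "I \<subseteq> V" "C \<subseteq> I"
        using reach_indep[OF step.hyps(1) assms(1,2)] rigid_reach[OF step.hyps(1) Cr CS] by auto
      have J: "indep E J" "J \<subseteq> V" "C \<subseteq> J"
        using step.hyps(2) rigid_move[OF Cr I(3) step.hyps(2)] unfolding move_def by auto
      have "reach E ?V (I \<inter> ?V) (J \<inter> ?V)"
      proof (rule move_project[OF step.hyps(2)])
        fix u w assume uw: "u \<in> I" "w \<in> J" "E u w"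
        have "u \<notin> C" using uw J unfolding indep_def by blast
        moreover have "w \<notin> C" using uw I unfolding indep_def by blast
        ultimately show "u \<in> ?V \<longleftrightarrow> w \<in> ?V" using inV[OF I] inV[OF J] uw by blast
      qed
      then show ?case using step.IH by (rule rtranclp_trans[rotated])
    qed simp
    ultimately show "rigid_core E V T = C \<and> reach E ?V (S - C) (T - C)"
      using inV[OF assms(1,2) CS] inV[OF assms(3,4)] rigid_core_subset[of E V T] by auto
  }
  {
    assume a: "rigid_core E V T = C \<and> reach E ?V (S - C) (T - C)"
    then have CT: "C \<subseteq> T" using rigid_core_subset[of E V T] by simp
    have "reach E V ((S - C) \<union> C) ((T - C) \<union> C)"
    proof (rule reach_lift[of ?V])
      show "indep E C" using assms(1) CS unfolding indep_def by blast
      show "\<And>c d. c \<in> ?V \<Longrightarrow> d \<in> C \<Longrightarrow> \<not> E c d" using sym by blast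
    qed (use a CS assms(2) in auto)
    then show "reach E V S T" using CS CT by (simp add: Un_absorb2)
  }
qed

section \<open>Connected components\<close>

lemma component_closed:
  assumes "u \<in> component_of E V v" "w \<in> V" "E u w" shows "w \<in> component_of E V v"
proof -
  have "edge_in E V u w" "(edge_in E V)\<^sup>*\<^sup>* v u" using assms by (auto simp: component_of_def edge_in_def)
  then show ?thesis using assms(2) unfolding component_of_def by simp
qed

lemma component_self: "v \<in> V \<Longrightarrow> v \<in> component_of E V v"
  unfolding component_of_def by simp

lemma component_subset: "component_of E V v \<subseteq> V" unfolding component_of_def by blast

lemma component_eq: assumes "w \<in> component_of E V v" shows "component_of E V w = component_of E V v"
proof -
  have vw: "(edge_in E V)\<^sup>*\<^sup>* v w" using assms by (simp add: component_of_def)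
  have "(edge_in E V)\<^sup>*\<^sup>* w x \<longleftrightarrow> (edge_in E V)\<^sup>*\<^sup>* v x" for x
    using rtranclp_trans[OF vw, of x] rtranclp_trans[OF edge_rtrancl_sym[OF vw], of x] by blast
  then show ?thesis by (simp add: component_of_def)
qed

lemma component_disj: "component_of E V v \<inter> component_of E V w = {} \<or> component_of E V v = component_of E V w"
  using component_eq by (metis Int_emptyI)

lemma component_conn: "connected_on E (component_of E V v)"
  unfolding connected_on_def
proof (intro ballI)
  fix x y assume xy: "x \<in> component_of E V v" "y \<in> component_of E V v"
  have vx: "(edge_in E V)\<^sup>*\<^sup>* v x" and vy: "(edge_in E V)\<^sup>*\<^sup>* v y" using xy by (auto simp: component_of_def)
  have "(edge_in E V)\<^sup>*\<^sup>* x y" by (rule rtranclp_trans[OF edge_rtrancl_sym[OF vx] vy])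
  then have "(edge_in E (component_of E V v))\<^sup>*\<^sup>* x y \<and> y \<in> component_of E V v"
  proof (induction rule: rtranclp_induct)
    case (step y z)
    then have "z \<in> component_of E V v" using component_closed[of y V v z] by (auto simp: edge_in_def)
    then have "edge_in E (component_of E V v) y z" using step by (auto simp: edge_in_def)
    then show ?case using step.IH \<open>z \<in> component_of E V v\<close> by (auto intro: rtranclp.rtrancl_into_rtrancl)
  qed (use xy in simp)
  then show "(edge_in E (component_of E V v))\<^sup>*\<^sup>* x y" ..
qed

lemma component_loose:
  assumes "loose E V S" shows "loose E (component_of E V v) (S \<inter> component_of E V v)"
  unfolding loose_def
proof (intro allI impI)
  fix R assume R: "R \<subseteq> S \<inter> component_of E V v" "rigid E (component_of E V v) R"
  have "rigid E V R" unfolding rigid_def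
  proof (intro ballI impI)
    fix u w assume u: "u \<in> R" "w \<in> V" "E u w"
    then have "w \<in> component_of E V v" using component_closed[of u V v w] R(1) by blast
    then show "\<exists>u'\<in>R. u' \<noteq> u \<and> E w u'" using R(2) u unfolding rigid_def by simp
  qed
  then show "R = {}" using assms R(1) unfolding loose_def by simp
qed

lemma reach_restrict:
  assumes "reach E V I J" "C \<subseteq> V" "\<And>u w. u \<in> C \<Longrightarrow> w \<in> V \<Longrightarrow> E u w \<Longrightarrow> w \<in> C"
  shows "reach E C (I \<inter> C) (J \<inter> C)"
  using assms(1)
proof (induction rule: rtranclp_induct)
  case (step I' J')
  have "reach E C (I' \<inter> C) (J' \<inter> C)"
  proof (rule move_project[OF step.hyps(2)])
    fix u w assume "u \<in> I'" "w \<in> J'" "E u w"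
    moreover have "I' \<subseteq> V" "J' \<subseteq> V" using step.hyps(2) unfolding move_def by auto
    ultimately show "u \<in> C \<longleftrightarrow> w \<in> C" using assms(3) sym by blast
  qed
  then show ?case using step.IH by (rule rtranclp_trans[rotated])
qed simp

end

context bip_c4_graph
begin

text \<open>Both configurations are led to a common one: through \<open>star\<close> if some vertex
  has many inner neighbours, and otherwise through a scattered set, since inner neighbours and the
  exceptional ones counted in \<open>bad\<close> together bound the degree by
  \<open>4 * k ^ 2\<close>. Here \<open>k\<close> may exceed \<open>card S\<close>, because only
  part of all tokens need lie in \<open>V\<close>; so only a subset of the scattered set is aimed
  at.\<close>

lemma big_conn:
  assumes V: "finite V" "connected_on E V" and S: "S \<subseteq> V" "loose E V S" "indep E S"
    and T: "T \<subseteq> V" "loose E V T" "indep E T" and card: "card S = card T" "card S \<le> k" "k \<ge> 1"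
    and bad: "\<And>v. v \<in> V \<Longrightarrow> card {y\<in>V. E v y \<and> \<not> inner_nb E V v y} \<le> 2 * k + 1"
    and big: "card V > size_bound k"
  shows "reach E V S T"
proof -
  have fin: "finite S" "finite T" using V(1) S(1) T(1) finite_subset by auto
  have sides: "\<exists>S' T'. reach E V S S' \<and> reach E V T T' \<and> (\<forall>s\<in>S'. side s = z) \<and> (\<forall>s\<in>T'. side s = z) \<and>
      S' \<subseteq> V \<and> T' \<subseteq> V \<and> loose E V S' \<and> loose E V T' \<and> card S' = card S \<and> card T' = card S" for z
  proof -
    obtain S' T' where r: "reach E V S S'" "reach E V T T'" "\<forall>s\<in>S'. side s = z" "\<forall>s\<in>T'. side s = z"
      using to_side[OF fin(1) S(2,1,3)] to_side[OF fin(2) T(2,1,3)] by metis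
    show ?thesis
      using r reach_indep[OF r(1) S(3,1)] reach_indep[OF r(2) T(3,1)] loose_reach[OF r(1) S(2)]
        loose_reach[OF r(2) T(2)] reach_card[OF r(1) fin(1)] reach_card[OF r(2) fin(2)] card(1) by auto
  qed
  have joined: ?thesis if "reach E V S S'" "reach E V T T'" "reach E V S' U" "reach E V T' U" for S' T' U
    using that reach_sym by (meson rtranclp_trans)
  show ?thesis
  proof (cases "\<exists>v\<in>V. card {t. inner_nb E V v t} > (card S)\<^sup>2")
    case True
    then obtain v where v: "v \<in> V" "card {t. inner_nb E V v t} > (card S)\<^sup>2" by blast
    obtain S' T' where st: "reach E V S S'" "reach E V T T'" "\<forall>s\<in>S'. side s = (\<not> side v)" "\<forall>s\<in>T'. side s = (\<not> side v)"
      "S' \<subseteq> V" "T' \<subseteq> V" "loose E V S'" "loose E V T'" "card S' = card S" "card T' = card S"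
      using sides[of "\<not> side v"] by blast
    have "reach E V S' T'"
      by (rule star[OF V v(1), of "\<not> side v"]) (use st v in auto)
    then show ?thesis using joined[OF st(1,2)] by blast
  next
    case False
    let ?d = "4 * k\<^sup>2"
    have deg: "card {y\<in>V. E v y} \<le> ?d" if "v \<in> V" for v
    proof -
      have "{y\<in>V. E v y} \<subseteq> {t. inner_nb E V v t} \<union> {y\<in>V. E v y \<and> \<not> inner_nb E V v y}" by blast
      moreover have "finite {t. inner_nb E V v t}" by (rule finite_subset[OF _ V(1)]) (auto simp: inner_nb_def)
      ultimately have "card {y\<in>V. E v y} \<le> card ({t. inner_nb E V v t} \<union> {y\<in>V. E v y \<and> \<not> inner_nb E V v y})"
        by (intro card_mono) (use V(1) in auto)
      also have "\<dots> \<le> card {t. inner_nb E V v t} + card {y\<in>V. E v y \<and> \<not> inner_nb E V v y}"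
        by (rule card_Un_le)
      also have "\<dots> \<le> (card S)\<^sup>2 + (2 * k + 1)"
        using False bad[OF that] that by (intro add_mono) (auto simp: not_less)
      also have "\<dots> \<le> k\<^sup>2 + (2 * k + 1)" using card(2) by (simp add: power_mono)
      also have "k \<le> k * k" using card(3) by simp
      then have "k\<^sup>2 + (2 * k + 1) \<le> ?d" using card(3) unfolding power2_eq_square by linarith
      finally show ?thesis .
    qed
    have "V = {x\<in>V. side x} \<union> {x\<in>V. \<not> side x}" by blast
    then have "card V \<le> card {x\<in>V. side x} + card {x\<in>V. \<not> side x}" by (metis card_Un_le)
    moreover have "?d ^ 4 = 256 * k ^ 8" by (simp add: power_mult_distrib flip: power_mult)
    then have "size_bound k = k * (5 * ?d ^ 4) + k * (5 * ?d ^ 4)"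
      unfolding size_bound_def using power_Suc[of k 8] by simp
    ultimately have "card {x\<in>V. side x} > k * (5 * ?d ^ 4) \<or> card {x\<in>V. \<not> side x} > k * (5 * ?d ^ 4)"
      using big by linarith
    then have "card {x\<in>V. side x = True} > k * (5 * ?d ^ 4) \<or> card {x\<in>V. side x = False} > k * (5 * ?d ^ 4)"
      by simp
    then have "\<exists>z. card {x\<in>V. side x = z} > k * (5 * ?d ^ 4)"
      by blast
    then obtain z where "card {x\<in>V. side x = z} > k * (5 * ?d ^ 4)" by blast
    then obtain U where U: "U \<subseteq> {x\<in>V. side x = z}" "scattered V U" "card U = k"
      using big_scattered[OF V(1) deg, of "{x\<in>V. side x = z}" k] card(3) by auto
    then obtain U' where U': "U' \<subseteq> U" "card U' = card S" using card(2) by (metis obtain_subset_with_card_n)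
    then have sc: "scattered V U'" using U(2) unfolding scattered_def by blast
    obtain S' T' where st: "reach E V S S'" "reach E V T T'" "\<forall>s\<in>S'. side s = z" "\<forall>s\<in>T'. side s = z"
      "S' \<subseteq> V" "T' \<subseteq> V" "loose E V S'" "loose E V T'" "card S' = card S" "card T' = card S"
      using sides[of z] by blast
    have "reach E V S' U'" "reach E V T' U'"
      by (rule scatter[OF V, where z = z]; use st U U' sc in auto)+
    then show ?thesis using joined[OF st(1,2)] by blast
  qed
qed

lemma inner_nb_component:
  assumes "v \<in> component_of E V w" shows "inner_nb E (component_of E V w) v t \<longleftrightarrow> inner_nb E V v t"
proof
  assume g: "inner_nb E V v t"
  then have t: "t \<in> component_of E V w" using assms component_closed[of v V w t] by (simp add: inner_nb_def)
  obtain x where x: "x \<in> V" "E t x" "x \<noteq> v" using g by (auto simp: inner_nb_def)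
  then have "x \<in> component_of E V w" using component_closed[OF t] by simp
  then show "inner_nb E (component_of E V w) v t" using g t x by (auto simp: inner_nb_def)
next
  assume "inner_nb E (component_of E V w) v t"
  then show "inner_nb E V v t" using component_subset[of V w] by (auto simp: inner_nb_def)
qed

text \<open>A component outside \<open>X\<close> is empty of source tokens or so large that
  \<open>big_conn\<close> applies; in both cases equal numbers of tokens are the only condition it
  imposes. The size of \<open>X\<close> follows because each of its components contains one of at
  most \<open>k\<close> tokens.\<close>

lemma comps_reach:
  assumes V: "finite V" and S: "S \<subseteq> V" "loose E V S" "indep E S"
    and T: "T \<subseteq> V" "loose E V T" "indep E T" and k: "card S = card T" "card S \<le> k" "k \<ge> 1"
    and bad: "\<And>v. v \<in> V \<Longrightarrow> card {y\<in>V. E v y \<and> \<not> inner_nb E V v y} \<le> 2 * k + 1"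
  defines "X \<equiv> {v\<in>V. S \<inter> component_of E V v \<noteq> {} \<and> card (component_of E V v) \<le> size_bound k}"
  shows "reach E V S T \<longleftrightarrow> (\<forall>v\<in>V. card (S \<inter> component_of E V v) = card (T \<inter> component_of E V v)) \<and> reach E X (S \<inter> X) (T \<inter> X)"
    and "\<forall>v\<in>V. card (S \<inter> component_of E V v) = card (T \<inter> component_of E V v) \<Longrightarrow> card (S \<inter> X) = card (T \<inter> X)"
    and "card X \<le> k * size_bound k"
proof -
  have fin: "finite S" "finite T" using V S(1) T(1) finite_subset by auto
  have XV: "X \<subseteq> V" unfolding X_def by blast
  have Xcl: "w \<in> X" if "u \<in> X" "w \<in> V" "E u w" for u w
  proof -
    have "w \<in> component_of E V u" using that component_self[of u V] component_closed unfolding X_def by blast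
    then have "component_of E V w = component_of E V u" by (rule component_eq)
    then show ?thesis using that unfolding X_def by auto
  qed
  have Xcomp: "component_of E V v \<inter> X = {}" if "v \<in> V - X" for v
  proof -
    have "w \<notin> X" if "w \<in> component_of E V v" for w
    proof
      assume "w \<in> X"
      then show False using component_eq[OF that] \<open>v \<in> V - X\<close> unfolding X_def by auto
    qed
    then show ?thesis by blast
  qed
  have outside: "reach E V S ((S \<inter> X) \<union> (T - X))"
    if c: "\<forall>v\<in>V. card (S \<inter> component_of E V v) = card (T \<inter> component_of E V v)"
  proof -
    have "reach E V S ((S - (\<Union>v\<in>L. component_of E V v)) \<union> (T \<inter> (\<Union>v\<in>L. component_of E V v)))" if "finite L" "L \<subseteq> V - X" for L
      using that
    proof (induction L)
      case (insert v L)
      let ?U = "\<Union>v\<in>L. component_of E V v" and ?C = "component_of E V v"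
      let ?I = "(S - ?U) \<union> (T \<inter> ?U)"
      have IH: "reach E V S ?I" using insert by blast
      have v: "v \<in> V - X" using insert by blast
      \<comment> \<open>The induction runs over vertices, so the component of \<open>v\<close> may
        have been treated already; otherwise it is disjoint from all treated ones.\<close>
      consider "?C \<subseteq> ?U" | "?C \<inter> ?U = {}"
      proof (cases "\<exists>w\<in>L. component_of E V v \<inter> component_of E V w \<noteq> {}")
        case True
        then obtain w where "w \<in> L" "component_of E V v = component_of E V w" using component_disj[of V v] by blast
        then show ?thesis using that(1) by blast
      next
        case False
        then show ?thesis using that(2) by blast
      qed
      then show ?case
      proof cases
        case 1
        then have "(\<Union>v\<in>insert v L. component_of E V v) = ?U" by auto
        then show ?thesis using IH by simp
      next
        case 2
        have "reach E ?C (S \<inter> ?C) (T \<inter> ?C)"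
        proof (cases "S \<inter> ?C = {}")
          case True
          then have "card (T \<inter> ?C) = 0" using c v by auto
          then show ?thesis using True fin by auto
        next
          case False
          then have "card ?C > size_bound k" using v unfolding X_def by auto
          then show ?thesis
          proof (rule big_conn[rotated -1])
            show "finite ?C" using component_subset V finite_subset by blast
            show "connected_on E ?C" by (rule component_conn)
            show "indep E (S \<inter> ?C)" "indep E (T \<inter> ?C)" using S T unfolding indep_def by blast+
            show "card (S \<inter> ?C) = card (T \<inter> ?C)" using c v by blast
            show "k \<ge> 1" by (rule k(3))
            show "card (S \<inter> ?C) \<le> k" using k(2) card_mono[OF fin(1), of "S \<inter> ?C"] by simp
            fix w assume w: "w \<in> ?C"
            then have wV: "w \<in> V" using component_subset by blast
            have "card {y \<in> ?C. E w y \<and> \<not> inner_nb E ?C w y} \<le> card {y\<in>V. E w y \<and> \<not> inner_nb E V w y}"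
              by (rule card_mono) (use V inner_nb_component[OF w] component_subset in auto)
            then show "card {y \<in> ?C. E w y \<and> \<not> inner_nb E ?C w y} \<le> 2 * k + 1" using bad[OF wV] by linarith
          qed (use component_loose S T in auto)
        qed
        moreover have Ii: "indep E ?I" "?I \<subseteq> V" using reach_indep[OF IH S(3,1)] by auto
        ultimately have "reach E V ((S \<inter> ?C) \<union> (?I - ?C)) ((T \<inter> ?C) \<union> (?I - ?C))"
          by (intro reach_lift[of ?C])
            (use component_subset component_closed in \<open>auto simp: indep_def\<close>)
        moreover have "(S \<inter> ?C) \<union> (?I - ?C) = ?I" using 2 by blast
        moreover have "(T \<inter> ?C) \<union> (?I - ?C) = (S - (\<Union>v\<in>insert v L. component_of E V v)) \<union> (T \<inter> (\<Union>v\<in>insert v L. component_of E V v))"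
          using 2 by auto
        ultimately show ?thesis using IH by (metis rtranclp_trans)
      qed
    qed simp
    from this[of "V - X"] have "reach E V S ((S - (\<Union>v\<in>V - X. component_of E V v)) \<union> (T \<inter> (\<Union>v\<in>V - X. component_of E V v)))"
      using V by blast
    moreover have "(\<Union>v\<in>V - X. component_of E V v) = V - X"
      using Xcomp component_self component_subset by blast
    moreover have "(S - (V - X)) \<union> (T \<inter> (V - X)) = (S \<inter> X) \<union> (T - X)" using S(1) T(1) by blast
    ultimately show ?thesis by metis
  qed
  show "card (S \<inter> X) = card (T \<inter> X)" if c: "\<forall>v\<in>V. card (S \<inter> component_of E V v) = card (T \<inter> component_of E V v)"
  proof -
    have "card ((S \<inter> X) \<union> (T - X)) = card S" using reach_card[OF outside[OF c] fin(1)] by blast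
    moreover have "card ((S \<inter> X) \<union> (T - X)) = card (S \<inter> X) + card (T - X)"
      using fin by (intro card_Un_disjoint) auto
    moreover have "card T = card (T \<inter> X) + card (T - X)"
      using fin by (subst card_Un_disjoint[symmetric]) (auto intro: arg_cong[of _ _ card])
    ultimately show ?thesis using k(1) by linarith
  qed
  show "reach E V S T \<longleftrightarrow> (\<forall>v\<in>V. card (S \<inter> component_of E V v) = card (T \<inter> component_of E V v)) \<and> reach E X (S \<inter> X) (T \<inter> X)"
  proof
    assume r: "reach E V S T"
    have "card (S \<inter> component_of E V v) = card (T \<inter> component_of E V v)" for v
    proof -
      have "reach E (component_of E V v) (S \<inter> component_of E V v) (T \<inter> component_of E V v)"
        by (rule reach_restrict[OF r component_subset]) (rule component_closed)
      from reach_card[OF this] show ?thesis using fin by simp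
    qed
    moreover have "reach E X (S \<inter> X) (T \<inter> X)" by (rule reach_restrict[OF r XV]) (rule Xcl)
    ultimately show "(\<forall>v\<in>V. card (S \<inter> component_of E V v) = card (T \<inter> component_of E V v)) \<and> reach E X (S \<inter> X) (T \<inter> X)"
      by blast
  next
    assume a: "(\<forall>v\<in>V. card (S \<inter> component_of E V v) = card (T \<inter> component_of E V v)) \<and> reach E X (S \<inter> X) (T \<inter> X)"
    have "reach E V ((S \<inter> X) \<union> (T - X)) ((T \<inter> X) \<union> (T - X))"
    proof (rule reach_lift[of X])
      show "indep E (T - X)" using T(3) unfolding indep_def by blast
      show "\<And>c d. c \<in> X \<Longrightarrow> d \<in> T - X \<Longrightarrow> \<not> E c d" using Xcl T(1) by blast
    qed (use a XV T(1) in auto)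
    moreover have "(T \<inter> X) \<union> (T - X) = T" by blast
    ultimately show "reach E V S T" using outside a by (metis rtranclp_trans)
  qed
  have "X \<subseteq> (\<Union>s\<in>S \<inter> X. component_of E V s)"
  proof
    fix v assume v: "v \<in> X"
    then obtain s where s: "s \<in> S" "s \<in> component_of E V v" unfolding X_def by blast
    have e: "component_of E V s = component_of E V v" using component_eq[OF s(2)] .
    then have "s \<in> X" using v s S(1) unfolding X_def by auto
    moreover have "v \<in> component_of E V s" using e v XV component_self by blast
    ultimately show "v \<in> (\<Union>s\<in>S \<inter> X. component_of E V s)" using s by blast
  qed
  then have "card X \<le> card (\<Union>s\<in>S \<inter> X. component_of E V s)"
    by (rule card_mono[rotated]) (use fin V component_subset in \<open>auto intro: finite_subset\<close>)
  also have "\<dots> \<le> (\<Sum>s\<in>S \<inter> X. card (component_of E V s))" by (rule card_UN_le) (use fin in auto)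
  also have "\<dots> \<le> (\<Sum>s\<in>S \<inter> X. size_bound k)" by (rule sum_mono) (auto simp: X_def)
  also have "\<dots> = card (S \<inter> X) * size_bound k" by simp
  also have "\<dots> \<le> k * size_bound k"
    using card_mono[OF fin(1), of "S \<inter> X"] k(2) by (intro mult_right_mono) auto
  finally show "card X \<le> k * size_bound k" .
qed

end

locale bip_c4_nat = bip_c4_graph E side for E :: "nat \<Rightarrow> nat \<Rightarrow> bool" and side
begin

lemma leaf_unique: "leaf E V v c \<Longrightarrow> leaf E V v c' \<Longrightarrow> c = c'"
  unfolding leaf_def by blast

lemma trim_subset: "trim E V K \<subseteq> V" unfolding trim_def by blast

lemma trim_least:
  assumes "leaf E V v c"
  shows "leaf E V (LEAST w. leaf E V w c) c" "(LEAST w. leaf E V w c) \<in> trim E V K"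
proof -
  show l: "leaf E V (LEAST w. leaf E V w c) c" using assms by (rule LeastI)
  have no: "\<not> leaf E V w c'" if "leaf E V (LEAST w. leaf E V w c) c'" "w < (LEAST w. leaf E V w c)" for w c'
    using not_less_Least[OF that(2)] leaf_unique[OF that(1) l] by simp
  then show "(LEAST w. leaf E V w c) \<in> trim E V K"
    using no l unfolding trim_def leaf_def[of _ _ _ c] by blast
qed

text \<open>A deleted neighbour of a token \<open>u\<close> is a leaf at \<open>u\<close>, and so is
  its surviving representative. The latter has no neighbour but \<open>u\<close>, so a set
  containing \<open>u\<close> is not rigid in the trimmed graph either.\<close>

lemma trim_loose:
  assumes "loose E V S" "S \<subseteq> V" "S \<subseteq> K" shows "loose E (trim E V K) S"
  unfolding loose_def
proof (intro allI impI)
  fix R assume R: "R \<subseteq> S" "rigid E (trim E V K) R"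
  have "rigid E V R" unfolding rigid_def
  proof (intro ballI impI)
    fix u w assume u: "u \<in> R" "w \<in> V" "E u w"
    show "\<exists>u'\<in>R. u' \<noteq> u \<and> E w u'"
    proof (cases "w \<in> trim E V K")
      case True
      then show ?thesis using R u unfolding rigid_def by blast
    next
      case False
      then obtain c where c: "leaf E V w c" using u(2) unfolding trim_def by blast
      have "c = u" using c u R assms(2) sym unfolding leaf_def by blast
      let ?m = "LEAST w. leaf E V w c"
      have m: "leaf E V ?m u" "?m \<in> trim E V K" using trim_least[OF c] \<open>c = u\<close> by auto
      then obtain u' where "u' \<in> R" "u' \<noteq> u" "E ?m u'" using R(2) u(1) sym unfolding rigid_def leaf_def by blast
      then show ?thesis using m(1) R(1) assms(2) unfolding leaf_def by blast
    qed
  qed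
  then show "R = {}" using R(1) assms(1) unfolding loose_def by blast
qed

text \<open>A sliding sequence is mapped into the trimmed graph by replacing deleted leaves by their
  representatives. Looseness is what keeps this map injective on every configuration of the
  sequence.\<close>

lemma trim_reach:
  assumes fin: "finite S" and S: "loose E V S" "S \<subseteq> V" "S \<subseteq> K" "indep E S" and T: "T \<subseteq> V" "T \<subseteq> K"
  shows "reach E V S T \<longleftrightarrow> reach E (trim E V K) S T"
proof
  assume "reach E (trim E V K) S T"
  then show "reach E V S T" using reach_mono trim_subset by blast
next
  assume r: "reach E V S T"
  let ?V = "trim E V K"
  \<comment> \<open>A retraction to the surviving vertices. It fixes \<open>S\<close> and
    \<open>T\<close>, which lie in \<open>K\<close>.\<close>
  define \<rho> where "\<rho> v = (if v \<in> ?V then v else LEAST w. \<exists>c. leaf E V v c \<and> leaf E V w c)" for v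
  have \<rho>_id: "\<rho> v = v" if "v \<in> ?V" for v using that by (simp add: \<rho>_def)
  have \<rho>_leaf: "\<exists>c. leaf E V v c \<and> leaf E V (\<rho> v) c \<and> \<rho> v \<in> ?V \<and> \<rho> v \<noteq> v" if v: "v \<in> V" "v \<notin> ?V" for v
  proof -
    obtain c where c: "leaf E V v c" using v unfolding trim_def by blast
    have "(\<exists>c. leaf E V v c \<and> leaf E V w c) \<longleftrightarrow> leaf E V w c" for w using c leaf_unique[OF c] by metis
    then have "\<rho> v = (LEAST w. leaf E V w c)" using v by (simp add: \<rho>_def)
    then show ?thesis using trim_least(1)[OF c] trim_least(2)[OF c, of K] c v by metis
  qed
  have \<rho>V: "\<rho> v \<in> ?V" if "v \<in> V" for v using that \<rho>_id \<rho>_leaf by (cases "v \<in> ?V") auto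
  have Eiff: "E (\<rho> a) (\<rho> b) \<longleftrightarrow> E a b" if ab: "a \<in> V" "b \<in> V" for a b
  proof -
    have main: "E (\<rho> a) (\<rho> b) \<longleftrightarrow> E a b" if m: "a \<in> V" "b \<in> V" "a \<notin> ?V" for a b
    proof -
      obtain c where c: "leaf E V a c" "leaf E V (\<rho> a) c" "\<rho> a \<noteq> a" using \<rho>_leaf[OF m(1,3)] by blast
      \<comment> \<open>\<open>c\<close> has the two distinct neighbours \<open>a\<close> and
        \<open>\<rho> a\<close>, so it is not a leaf and cannot have been deleted.\<close>
      have cV: "c \<in> ?V"
      proof (rule ccontr)
        assume "c \<notin> ?V"
        then obtain d where d: "leaf E V c d" using c(1) unfolding trim_def leaf_def[of E V a] by blast
        have "E c a" "E c (\<rho> a)" using c(1,2) sym unfolding leaf_def by blast+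
        then have "a = d" "\<rho> a = d" using d c(1,2) unfolding leaf_def by blast+
        then show False using c(3) by simp
      qed
      have "E (\<rho> a) (\<rho> b) \<longleftrightarrow> \<rho> b = c" using c(2) \<rho>V[OF that(2)] trim_subset[of V K] unfolding leaf_def by blast
      moreover have "\<rho> b = c \<longleftrightarrow> b = c"
      proof
        assume bc: "\<rho> b = c"
        show "b = c"
        proof (cases "b \<in> ?V")
          case True then show ?thesis using bc \<rho>_id by simp
        next
          case False
          then obtain d where d: "leaf E V b d" "leaf E V c d" using \<rho>_leaf[OF m(2)] bc by blast
          have "E c a" "E c (\<rho> a)" using c(1,2) sym unfolding leaf_def by blast+
          then have "a = d" "\<rho> a = d" using d(2) c(1,2) unfolding leaf_def by blast+
          then show ?thesis using c(3) by simp
        qed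
      qed (use cV \<rho>_id in simp)
      moreover have "E a b \<longleftrightarrow> b = c" using c(1) that(2) unfolding leaf_def by blast
      ultimately show ?thesis by blast
    qed
    show ?thesis
    proof (cases "a \<in> ?V")
      case False then show ?thesis using main ab by blast
    next
      case aV: True
      show ?thesis
      proof (cases "b \<in> ?V")
        case False
        have "E (\<rho> a) (\<rho> b) \<longleftrightarrow> E (\<rho> b) (\<rho> a)" "E a b \<longleftrightarrow> E b a" using sym by blast+
        then show ?thesis using main[OF ab(2,1) False] by simp
      next
        case True then show ?thesis using aV \<rho>_id by simp
      qed
    qed
  qed
  \<comment> \<open>Two tokens with the same image would be leaves at a common vertex
    \<open>c\<close>. As \<open>c\<close> is the only neighbour of both, they would form a rigid
    set.\<close>
  have inj: "a = b" if ab: "a \<in> I" "b \<in> I" "\<rho> a = \<rho> b" and I: "I \<subseteq> V" "loose E V I" for I a b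
  proof (rule ccontr)
    assume ne: "a \<noteq> b"
    have "\<exists>c. leaf E V a c \<and> leaf E V b c"
    proof (cases "a \<in> ?V")
      case True
      then have "b \<notin> ?V" using ne ab \<rho>_id by auto
      then show ?thesis using \<rho>_leaf[of b] ab I True \<rho>_id[of a] by auto
    next
      case False
      then obtain c where c: "leaf E V a c" "leaf E V (\<rho> a) c" using \<rho>_leaf[of a] ab I by blast
      show ?thesis
      proof (cases "b \<in> ?V")
        case True then show ?thesis using c ab \<rho>_id by auto
      next
        case False
        then obtain d where "leaf E V b d" "leaf E V (\<rho> b) d" using \<rho>_leaf[of b] ab I by blast
        then show ?thesis using c ab leaf_unique by metis
      qed
    qed
    then obtain c where c: "leaf E V a c" "leaf E V b c" by blast
    then have "E c a" "E c b" using sym unfolding leaf_def by blast+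
    then have "rigid E V {a, b}" using ne c unfolding rigid_def leaf_def by auto
    then show False using I(2)[unfolded loose_def, rule_format, of "{a, b}"] ab by auto
  qed
  have "reach E ?V (\<rho> ` S) (\<rho> ` T)" using r
  proof (induction rule: rtranclp_induct)
    case (step I J)
    have I: "loose E V I" "I \<subseteq> V" "indep E I"
      using loose_reach[OF step.hyps(1) S(1)] reach_indep[OF step.hyps(1) S(4,2)] by auto
    have J: "loose E V J" "J \<subseteq> V" "indep E J"
      using loose_reach[OF r_into_rtranclp[of "move E V", OF step.hyps(2)] I(1)] step.hyps(2) unfolding move_def by auto
    obtain u w where uw: "u \<in> I" "w \<notin> I" "E u w" "J = insert w (I - {u})"
      using step.hyps(2) unfolding move_def by blast
    have "move E ?V (\<rho> ` I) (\<rho> ` J)"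
    proof (rule moveI[of "\<rho> u" _ "\<rho> w"])
      show "\<rho> w \<notin> \<rho> ` I"
      proof
        assume "\<rho> w \<in> \<rho> ` I"
        then obtain x where x: "x \<in> I" "\<rho> w = \<rho> x" by blast
        show False
        proof (cases "x = u")
          case True
          have "E (\<rho> u) (\<rho> w)" using Eiff uw I J by blast
          then show False using True x irrefl by simp
        next
          case False
          then have "w = x" using inj[of w J x] x uw J by auto
          then show False using x uw by simp
        qed
      qed
      show "E (\<rho> u) (\<rho> w)" using Eiff uw I J by blast
      have "inj_on \<rho> I" using inj[of _ I] I by (intro inj_onI)
      then have "\<rho> ` (I - {u}) = \<rho> ` I - {\<rho> u}" using uw(1) by (simp add: inj_on_image_set_diff)
      then show "\<rho> ` J = insert (\<rho> w) (\<rho> ` I - {\<rho> u})" using uw(4) by simp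
      show "\<rho> ` I \<subseteq> ?V" "\<rho> ` J \<subseteq> ?V" using \<rho>V I J by auto
      have ind: "indep E (\<rho> ` H)" if "indep E H" "H \<subseteq> V" for H
        using that Eiff unfolding indep_def by (simp add: subset_iff)
      show "indep E (\<rho> ` I)" "indep E (\<rho> ` J)" using ind I J by simp_all
    qed (use uw in blast)
    with step.IH show ?case by (rule rtranclp.rtrancl_into_rtrancl)
  qed simp
  moreover have "\<rho> ` S = S" "\<rho> ` T = T"
  proof -
    have "S \<subseteq> ?V" "T \<subseteq> ?V" using S T unfolding trim_def by auto
    then show "\<rho> ` S = S" "\<rho> ` T = T" using \<rho>_id
      by (metis image_cong image_ident subsetD)+
  qed
  ultimately show "reach E ?V S T" by simp
qed

text \<open>If \<open>v\<close> is not a leaf, its neighbours without a further neighbour were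
  leaves already before trimming. Of these only the least one and those in \<open>K\<close>
  survive.\<close>

lemma trim_bad:
  assumes "finite V" "finite K" "v \<in> trim E V K"
  shows "card {y\<in>trim E V K. E v y \<and> \<not> inner_nb E (trim E V K) v y} \<le> card K + 1"
proof -
  let ?V = "trim E V K"
  let ?B = "{y\<in>?V. E v y \<and> \<not> inner_nb E ?V v y}"
  show ?thesis
  proof (cases "\<exists>c. leaf E V v c")
    case True
    then obtain c where "leaf E V v c" by blast
    then have "?B \<subseteq> {c}" using trim_subset[of V K] unfolding leaf_def by blast
    then have "card ?B \<le> card {c}" by (rule card_mono[rotated]) simp
    then show ?thesis by simp
  next
    case False
    have "?B \<subseteq> insert (LEAST w. leaf E V w v) K"
    proof
      fix y assume y: "y \<in> ?B"
      then have yV: "y \<in> V" "y \<in> ?V" "E v y" using trim_subset by auto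
      have vV: "v \<in> V" using assms(3) trim_subset by blast
      have ly: "leaf E V y v"
      proof (rule ccontr)
        assume "\<not> ?thesis"
        then obtain z where z: "z \<in> V" "E y z" "z \<noteq> v" using yV vV sym unfolding leaf_def by blast
        then have "z \<notin> ?V" using y yV unfolding inner_nb_def by blast
        then obtain c where c: "leaf E V z c" using z unfolding trim_def by blast
        have "c = y" using c z yV sym unfolding leaf_def by blast
        then have m: "leaf E V (LEAST w. leaf E V w c) y" "(LEAST w. leaf E V w c) \<in> ?V" using trim_least[OF c] by auto
        \<comment> \<open>The representative of the deleted leaf \<open>z\<close> is a surviving
          neighbour of \<open>y\<close>. By the choice of \<open>y\<close> it can only be
          \<open>v\<close>, which would make \<open>v\<close> a leaf.\<close>
        then have "(LEAST w. leaf E V w c) = v" using y yV sym unfolding inner_nb_def leaf_def by blast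
        then show False using m(1) False by auto
      qed
      have "y = (LEAST w. leaf E V w v)" if "y \<notin> K"
      proof -
        have "\<not> (\<exists>w<y. leaf E V w v)" using yV(2) that ly unfolding trim_def by blast
        then show ?thesis using ly by (metis LeastI Least_le le_neq_implies_less)
      qed
      then show "y \<in> insert (LEAST w. leaf E V w v) K" by blast
    qed
    then have "card ?B \<le> card (insert (LEAST w. leaf E V w v) K)"
      by (rule card_mono[rotated]) (use assms in auto)
    also have "\<dots> \<le> card K + 1" using assms by (simp add: card_insert_if)
    finally show ?thesis .
  qed
qed

end


section \<open>A programming language with counting quantifiers\<close>

text \<open>The only iteration inside an expression is a sum over the \<open>n\<close> vertices.
  This makes every expression computable in polynomial time, while truth values as numbers turn sums
  into quantifiers and counters.\<close>

datatype expr =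
    Num nat
  | Var nat
  | Size
  | Arr nat expr
  | Plus expr expr
  | Minus expr expr
  | Lt expr expr
  | Ite expr expr expr
  | Sum nat expr

primrec val :: "expr \<Rightarrow> nat \<Rightarrow> (nat \<Rightarrow> nat) \<Rightarrow> (nat \<Rightarrow> nat \<Rightarrow> nat) \<Rightarrow> nat" where
  "val (Num c) n \<sigma> A = c"
| "val (Var x) n \<sigma> A = \<sigma> x"
| "val Size n \<sigma> A = n"
| "val (Arr a i) n \<sigma> A = A a (val i n \<sigma> A)"
| "val (Plus e1 e2) n \<sigma> A = val e1 n \<sigma> A + val e2 n \<sigma> A"
| "val (Minus e1 e2) n \<sigma> A = val e1 n \<sigma> A - val e2 n \<sigma> A"
| "val (Lt e1 e2) n \<sigma> A = of_bool (val e1 n \<sigma> A < val e2 n \<sigma> A)"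
| "val (Ite b e1 e2) n \<sigma> A = (if 0 < val b n \<sigma> A then val e1 n \<sigma> A else val e2 n \<sigma> A)"
| "val (Sum x e) n \<sigma> A = (\<Sum>v<n. val e n (\<sigma>(x := v)) A)"

primrec reads :: "expr \<Rightarrow> nat set" where
  "reads (Num c) = {}"
| "reads (Var x) = {}"
| "reads Size = {}"
| "reads (Arr a i) = insert a (reads i)"
| "reads (Plus e1 e2) = reads e1 \<union> reads e2"
| "reads (Minus e1 e2) = reads e1 \<union> reads e2"
| "reads (Lt e1 e2) = reads e1 \<union> reads e2"
| "reads (Ite b e1 e2) = reads b \<union> reads e1 \<union> reads e2"
| "reads (Sum x e) = reads e"

lemma val_cong: "(\<And>a. a \<in> reads e \<Longrightarrow> A a = B a) \<Longrightarrow> val e n \<sigma> A = val e n \<sigma> B"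
  by (induction e arbitrary: \<sigma>) auto

text \<open>Register 1 holds the length of the output, register 2 the number of vertices and register 3 the
  counter of the outermost loops. The even registers from 4 on are the variables of expressions, the
  odd registers from 5 on a stack of temporaries.\<close>

definition vreg :: "nat \<Rightarrow> nat" where "vreg x = 2 * x + 4"
definition treg :: "nat \<Rightarrow> nat" where "treg d = 2 * d + 5"

lemma reg_simps [simp]:
  "vreg x = vreg y \<longleftrightarrow> x = y" "treg x = treg y \<longleftrightarrow> x = y" "vreg x \<noteq> treg y" "treg y \<noteq> vreg x"
  "even (vreg x)" "odd (treg x)" "treg x < treg y \<longleftrightarrow> x < y"
  "vreg x \<noteq> 1" "vreg x \<noteq> Suc 0" "vreg x \<noteq> 2" "vreg x \<noteq> 3" "treg x \<noteq> 1" "treg x \<noteq> Suc 0" "treg x \<noteq> 2" "treg x \<noteq> 3"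
  "vreg x \<noteq> 0" "0 < vreg x" "3 < treg x" "1 < treg x" "Suc 0 < treg x"
  "1 \<noteq> vreg x" "Suc 0 \<noteq> vreg x" "2 \<noteq> vreg x" "3 \<noteq> vreg x"
proof -
  show "vreg x \<noteq> treg y" "treg y \<noteq> vreg x" unfolding vreg_def treg_def by presburger+
qed (auto simp: vreg_def treg_def)

definition for_loop :: "nat \<Rightarrow> com \<Rightarrow> com" where
  "for_loop r c = Seq (Assign r (Const 0))
     (While (Less (Reg r) (Reg 2)) (Seq c (Assign r (Add (Reg r) (Const 1)))))"

text \<open>The result goes to \<open>treg d\<close>, and only temporaries from level
  \<open>d\<close> on are overwritten. A sum accumulates in \<open>treg d\<close> and saves the old
  value of its variable in the next temporary, so nested sums may bind the same variable.\<close>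

primrec compile :: "nat \<Rightarrow> expr \<Rightarrow> com" where
  "compile d (Num c) = Assign (treg d) (Const c)"
| "compile d (Var x) = Assign (treg d) (Reg (vreg x))"
| "compile d Size = Assign (treg d) (Reg 2)"
| "compile d (Arr a i) = Seq (compile d i) (Assign (treg d) (Read a (Reg (treg d))))"
| "compile d (Plus e1 e2) = Seq (compile d e1) (Seq (compile (Suc d) e2)
     (Assign (treg d) (Add (Reg (treg d)) (Reg (treg (Suc d))))))"
| "compile d (Minus e1 e2) = Seq (compile d e1) (Seq (compile (Suc d) e2)
     (Assign (treg d) (Sub (Reg (treg d)) (Reg (treg (Suc d))))))"
| "compile d (Lt e1 e2) = Seq (compile d e1) (Seq (compile (Suc d) e2)
     (Cond (Less (Reg (treg d)) (Reg (treg (Suc d)))) (Assign (treg d) (Const 1)) (Assign (treg d) (Const 0))))"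
| "compile d (Ite b e1 e2) = Seq (compile d b)
     (Cond (Less (Const 0) (Reg (treg d))) (compile d e1) (compile d e2))"
| "compile d (Sum x e) = Seq (Assign (treg d) (Const 0)) (Seq (Assign (treg (Suc d)) (Reg (vreg x)))
     (Seq (for_loop (vreg x) (Seq (compile (Suc (Suc d)) e)
        (Assign (treg d) (Add (Reg (treg d)) (Reg (treg (Suc (Suc d))))))))
     (Assign (vreg x) (Reg (treg (Suc d))))))"

text \<open>Polynomials in the number of vertices. A conditional is charged for both branches, which
  makes the bound independent of the data. A round of a sum costs 3 beyond its body: accumulation,
  increment and loop test.\<close>

primrec cost :: "expr \<Rightarrow> nat poly" where
  "cost (Num c) = 1"
| "cost (Var x) = 1"
| "cost Size = 1"
| "cost (Arr a i) = cost i + 1"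
| "cost (Plus e1 e2) = cost e1 + (cost e2 + 1)"
| "cost (Minus e1 e2) = cost e1 + (cost e2 + 1)"
| "cost (Lt e1 e2) = cost e1 + (cost e2 + 2)"
| "cost (Ite b e1 e2) = cost b + (cost e1 + cost e2 + 1)"
| "cost (Sum x e) = [:0, 1:] * (cost e + 3) + 5"

abbreviation set_reg :: "state \<Rightarrow> nat \<Rightarrow> nat \<Rightarrow> state" where
  "set_reg s r c \<equiv> s\<lparr>regs := (regs s)(r := c)\<rparr>"

text \<open>A total-correctness triple with an upper bound on the time, so that branches of
  different duration can be joined.\<close>

definition runs :: "com \<Rightarrow> state \<Rightarrow> nat \<Rightarrow> (state \<Rightarrow> bool) \<Rightarrow> bool" where
  "runs c s T Q \<longleftrightarrow> (\<exists>t s'. exec c s t s' \<and> t \<le> T \<and> Q s')"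

lemma runs_mono: "runs c s T Q \<Longrightarrow> (\<And>s'. Q s' \<Longrightarrow> Q' s') \<Longrightarrow> T \<le> T' \<Longrightarrow> runs c s T' Q'"
  unfolding runs_def using order_trans by blast

lemma runs_Skip: "Q s \<Longrightarrow> runs Skip s 1 Q"
  unfolding runs_def using exec.Skip by blast

lemma runs_Assign: "Q (set_reg s x (aval e s)) \<Longrightarrow> runs (Assign x e) s 1 Q"
  unfolding runs_def using exec.Assign by blast

lemma runs_Write:
  "Q (s\<lparr>arrs := (arrs s)(a := (arrs s a)(aval i s := aval e s))\<rparr>) \<Longrightarrow> runs (Write a i e) s 1 Q"
  unfolding runs_def using exec.Write by blast

lemma runs_Seq: "runs c1 s T1 (\<lambda>s'. runs c2 s' T2 Q) \<Longrightarrow> runs (Seq c1 c2) s (T1 + T2) Q"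
  unfolding runs_def using exec.Seq add_mono by blast

lemma runs_Cond:
  assumes "bval b s \<Longrightarrow> runs c1 s T Q" "\<not> bval b s \<Longrightarrow> runs c2 s T Q"
  shows "runs (Cond b c1 c2) s (T + 1) Q"
proof (cases "bval b s")
  case True
  then show ?thesis using assms(1) exec.CondTrue unfolding runs_def by (metis Suc_eq_plus1 Suc_le_mono)
next
  case False
  then show ?thesis using assms(2) exec.CondFalse unfolding runs_def by (metis Suc_eq_plus1 Suc_le_mono)
qed

lemma runs_for:
  assumes init: "I 0 (set_reg s r 0)"
    and I: "\<And>i s. I i s \<Longrightarrow> regs s r = i \<and> regs s 2 = n"
    and step: "\<And>i s. i < n \<Longrightarrow> I i s \<Longrightarrow>
      runs c s T (\<lambda>s'. regs s' r = i \<and> I (Suc i) (set_reg s' r (Suc i)))"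
  shows "runs (for_loop r c) s (n * (T + 2) + 2) (I n)"
proof -
  let ?c = "Seq c (Assign r (Add (Reg r) (Const 1)))"
  have loop: "runs (While (Less (Reg r) (Reg 2)) ?c) s' ((n - i) * (T + 2) + 1) (I n)" if "i \<le> n" "I i s'" for i s'
    using that
  proof (induction "n - i" arbitrary: i s')
    case 0
    then have "i = n" by simp
    then have "\<not> bval (Less (Reg r) (Reg 2)) s'" using I 0 by auto
    then have "exec (While (Less (Reg r) (Reg 2)) ?c) s' 1 s'" by (rule exec.WhileFalse)
    then show ?case using 0 \<open>i = n\<close> unfolding runs_def by auto
  next
    case (Suc m)
    then have i: "i < n" by simp
    then have b: "bval (Less (Reg r) (Reg 2)) s'" using I Suc.prems by auto
    have "runs ?c s' (T + 1) (I (Suc i))"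
    proof (rule runs_Seq, rule runs_mono[OF step[OF i Suc.prems(2)] _ order_refl])
      fix s'' assume "regs s'' r = i \<and> I (Suc i) (set_reg s'' r (Suc i))"
      then show "runs (Assign r (Add (Reg r) (Const 1))) s'' 1 (I (Suc i))"
        by (intro runs_Assign) simp
    qed
    then obtain t1 s1 where 1: "exec ?c s' t1 s1" "t1 \<le> T + 1" "I (Suc i) s1" unfolding runs_def by blast
    have "runs (While (Less (Reg r) (Reg 2)) ?c) s1 ((n - Suc i) * (T + 2) + 1) (I n)"
      by (rule Suc.hyps(1)) (use Suc.hyps(2) i 1 in auto)
    then obtain t2 s2 where 2: "exec (While (Less (Reg r) (Reg 2)) ?c) s1 t2 s2"
      "t2 \<le> (n - Suc i) * (T + 2) + 1" "I n s2" unfolding runs_def by blast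
    have "exec (While (Less (Reg r) (Reg 2)) ?c) s' (Suc (t1 + t2)) s2"
      by (rule exec.WhileTrue[OF b 1(1) 2(1)])
    moreover have "n - i = Suc (n - Suc i)" using i by simp
    then have "Suc (t1 + t2) \<le> (n - i) * (T + 2) + 1" using 1(2) 2(2) by simp
    ultimately show ?case using 2(3) unfolding runs_def by blast
  qed
  have "runs (for_loop r c) s (1 + (n * (T + 2) + 1)) (I n)" unfolding for_loop_def
    by (intro runs_Seq runs_Assign) (use loop[of 0] init in auto)
  then show ?thesis by (rule runs_mono) auto
qed

text \<open>The even registers hold the variables and the number of vertices. The registers below
  \<open>treg d\<close> include the output length, the outer loop counter and the operands still
  pending on the stack.\<close>

definition computed :: "nat \<Rightarrow> nat \<Rightarrow> state \<Rightarrow> state \<Rightarrow> bool" where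
  "computed d c s s' \<longleftrightarrow> arrs s' = arrs s \<and> regs s' (treg d) = c \<and>
     (\<forall>r. even r \<or> r < treg d \<longrightarrow> regs s' r = regs s r)"

lemma computed_same:
  assumes "computed d c s s'"
  shows "regs s' 2 = regs s 2" "(\<lambda>x. regs s' (vreg x)) = (\<lambda>x. regs s (vreg x))" "arrs s' = arrs s"
  using assms by (auto simp: computed_def)

lemma computed_two:
  assumes "runs c1 s T1 (computed d x s)"
    and "\<And>s'. computed d x s s' \<Longrightarrow> runs c2 s' T2 (computed (Suc d) y s')"
    and "\<And>s'. arrs s' = arrs s \<Longrightarrow> regs s' (treg d) = x \<Longrightarrow> regs s' (treg (Suc d)) = y \<Longrightarrow>
      (\<And>r. even r \<or> r < treg d \<Longrightarrow> regs s' r = regs s r) \<Longrightarrow> runs c s' T Q"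
  shows "runs (Seq c1 (Seq c2 c)) s (T1 + (T2 + T)) Q"
proof (rule runs_Seq, rule runs_mono[OF assms(1) _ order_refl])
  fix s1 assume 1: "computed d x s s1"
  show "runs (Seq c2 c) s1 (T2 + T) Q"
  proof (rule runs_Seq, rule runs_mono[OF assms(2)[OF 1] _ order_refl])
    fix s2 assume 2: "computed (Suc d) y s1 s2"
    have lt: "r < treg (Suc d)" if "r < treg d" for r using that by (simp add: treg_def)
    show "runs c s2 T Q"
      by (rule assms(3)) (use 1 2 lt in \<open>auto simp: computed_def\<close>)
  qed
qed

lemma compile_runs:
  "runs (compile d e) s (poly (cost e) (regs s 2)) (computed d (val e (regs s 2) (\<lambda>x. regs s (vreg x)) (arrs s)) s)"
proof (induction e arbitrary: d s)
  case (Arr a i)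
  let ?v = "val i (regs s 2) (\<lambda>x. regs s (vreg x)) (arrs s)"
  have "runs (compile d (Arr a i)) s (poly (cost i) (regs s 2) + 1) (computed d (arrs s a ?v) s)"
    unfolding compile.simps
  proof (rule runs_Seq, rule runs_mono[OF Arr.IH _ order_refl])
    fix s' assume "computed d ?v s s'"
    then show "runs (Assign (treg d) (Read a (Reg (treg d)))) s' 1 (computed d (arrs s a ?v) s)"
      by (intro runs_Assign) (auto simp: computed_def)
  qed
  then show ?case by simp
next
  case (Plus e1 e2)
  let ?x = "val e1 (regs s 2) (\<lambda>x. regs s (vreg x)) (arrs s)"
  let ?y = "val e2 (regs s 2) (\<lambda>x. regs s (vreg x)) (arrs s)"
  have "runs (compile d (Plus e1 e2)) s (poly (cost e1) (regs s 2) + (poly (cost e2) (regs s 2) + 1))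
    (computed d (?x + ?y) s)"
    unfolding compile.simps
  proof (rule computed_two[OF Plus.IH(1)])
    show "runs (compile (Suc d) e2) s' (poly (cost e2) (regs s 2)) (computed (Suc d) ?y s')"
      if "computed d ?x s s'" for s'
      using Plus.IH(2)[of "Suc d" s'] computed_same[OF that] by simp
    fix s' :: state assume "arrs s' = arrs s" "regs s' (treg d) = ?x" "regs s' (treg (Suc d)) = ?y"
      "\<And>r. even r \<or> r < treg d \<Longrightarrow> regs s' r = regs s r"
    then show "runs (Assign (treg d) (Add (Reg (treg d)) (Reg (treg (Suc d))))) s' 1 (computed d (?x + ?y) s)"
      by (intro runs_Assign) (auto simp: computed_def)
  qed
  then show ?case by simp
next
  case (Minus e1 e2)
  let ?x = "val e1 (regs s 2) (\<lambda>x. regs s (vreg x)) (arrs s)"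
  let ?y = "val e2 (regs s 2) (\<lambda>x. regs s (vreg x)) (arrs s)"
  have "runs (compile d (Minus e1 e2)) s (poly (cost e1) (regs s 2) + (poly (cost e2) (regs s 2) + 1))
    (computed d (?x - ?y) s)"
    unfolding compile.simps
  proof (rule computed_two[OF Minus.IH(1)])
    show "runs (compile (Suc d) e2) s' (poly (cost e2) (regs s 2)) (computed (Suc d) ?y s')"
      if "computed d ?x s s'" for s'
      using Minus.IH(2)[of "Suc d" s'] computed_same[OF that] by simp
    fix s' :: state assume "arrs s' = arrs s" "regs s' (treg d) = ?x" "regs s' (treg (Suc d)) = ?y"
      "\<And>r. even r \<or> r < treg d \<Longrightarrow> regs s' r = regs s r"
    then show "runs (Assign (treg d) (Sub (Reg (treg d)) (Reg (treg (Suc d))))) s' 1 (computed d (?x - ?y) s)"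
      by (intro runs_Assign) (auto simp: computed_def)
  qed
  then show ?case by simp
next
  case (Lt e1 e2)
  let ?x = "val e1 (regs s 2) (\<lambda>x. regs s (vreg x)) (arrs s)"
  let ?y = "val e2 (regs s 2) (\<lambda>x. regs s (vreg x)) (arrs s)"
  have "runs (compile d (Lt e1 e2)) s (poly (cost e1) (regs s 2) + (poly (cost e2) (regs s 2) + (1 + 1)))
    (computed d (of_bool (?x < ?y)) s)"
    unfolding compile.simps
  proof (rule computed_two[OF Lt.IH(1)])
    show "runs (compile (Suc d) e2) s' (poly (cost e2) (regs s 2)) (computed (Suc d) ?y s')"
      if "computed d ?x s s'" for s'
      using Lt.IH(2)[of "Suc d" s'] computed_same[OF that] by simp
    fix s' :: state assume "arrs s' = arrs s" "regs s' (treg d) = ?x" "regs s' (treg (Suc d)) = ?y"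
      "\<And>r. even r \<or> r < treg d \<Longrightarrow> regs s' r = regs s r"
    then show "runs (Cond (Less (Reg (treg d)) (Reg (treg (Suc d)))) (Assign (treg d) (Const 1)) (Assign (treg d) (Const 0))) s' (1 + 1) (computed d (of_bool (?x < ?y)) s)"
      by (intro runs_Cond runs_Assign) (auto simp: computed_def)
  qed
  then show ?case by simp
next
  case (Ite b e1 e2)
  show ?case
  proof -
    let ?n = "regs s 2" and ?\<sigma> = "\<lambda>x. regs s (vreg x)"
    have "runs (compile d (Ite b e1 e2)) s (poly (cost b) ?n + (poly (cost e1) ?n + poly (cost e2) ?n + 1))
      (computed d (val (Ite b e1 e2) ?n ?\<sigma> (arrs s)) s)"
      unfolding compile.simps
    proof (rule runs_Seq, rule runs_mono[OF Ite.IH(1) _ order_refl])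
    fix s' assume c: "computed d (val b (regs s 2) (\<lambda>x. regs s (vreg x)) (arrs s)) s s'"
    note same = computed_same[OF c]
    have tr: "computed d v s' s'' \<Longrightarrow> computed d v s s''" for v s''
      using c by (auto simp: computed_def)
    show "runs (Cond (Less (Const 0) (Reg (treg d))) (compile d e1) (compile d e2)) s'
      (poly (cost e1) (regs s 2) + poly (cost e2) (regs s 2) + 1)
      (computed d (val (Ite b e1 e2) (regs s 2) (\<lambda>x. regs s (vreg x)) (arrs s)) s)"
    proof (rule runs_Cond)
      assume "bval (Less (Const 0) (Reg (treg d))) s'"
      then have "0 < val b (regs s 2) (\<lambda>x. regs s (vreg x)) (arrs s)" using c by (simp add: computed_def)
      then show "runs (compile d e1) s' (poly (cost e1) (regs s 2) + poly (cost e2) (regs s 2))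
        (computed d (val (Ite b e1 e2) (regs s 2) (\<lambda>x. regs s (vreg x)) (arrs s)) s)"
        by (intro runs_mono[OF Ite.IH(2)]) (auto simp: same intro: tr)
    next
      assume "\<not> bval (Less (Const 0) (Reg (treg d))) s'"
      then have "\<not> 0 < val b (regs s 2) (\<lambda>x. regs s (vreg x)) (arrs s)" using c by (simp add: computed_def)
      then show "runs (compile d e2) s' (poly (cost e1) (regs s 2) + poly (cost e2) (regs s 2))
        (computed d (val (Ite b e1 e2) (regs s 2) (\<lambda>x. regs s (vreg x)) (arrs s)) s)"
        by (intro runs_mono[OF Ite.IH(3)]) (auto simp: same intro: tr)
    qed
    qed
    then show ?thesis by simp
  qed
next
  case (Sum x e)
  let ?n = "regs s 2" and ?\<sigma> = "\<lambda>x. regs s (vreg x)"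
  let ?b = "Seq (compile (Suc (Suc d)) e) (Assign (treg d) (Add (Reg (treg d)) (Reg (treg (Suc (Suc d))))))"
  define I where "I i s' \<longleftrightarrow> arrs s' = arrs s \<and> regs s' (vreg x) = i \<and>
    regs s' (treg d) = (\<Sum>v<i. val e ?n (?\<sigma>(x := v)) (arrs s)) \<and> regs s' (treg (Suc d)) = regs s (vreg x) \<and>
    (\<forall>r. (even r \<or> r < treg d) \<and> r \<noteq> vreg x \<longrightarrow> regs s' r = regs s r)" for i and s' :: state
  define s1 where "s1 = set_reg (set_reg s (treg d) 0) (treg (Suc d)) (regs s (vreg x))"
  have "runs (for_loop (vreg x) ?b) s1 (?n * ((poly (cost e) ?n + 1) + 2) + 2) (I ?n)"
  proof (rule runs_for)
    show "I 0 (set_reg s1 (vreg x) 0)" by (simp add: I_def s1_def)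
    show "regs s' (vreg x) = i \<and> regs s' 2 = ?n" if "I i s'" for i s'
      using that by (simp add: I_def)
    fix i s' assume I: "i < ?n" "I i s'"
    have same: "regs s' 2 = ?n" "(\<lambda>y. regs s' (vreg y)) = ?\<sigma>(x := i)" "arrs s' = arrs s"
      using I by (auto simp: I_def fun_eq_iff)
    show "runs ?b s' (poly (cost e) ?n + 1)
      (\<lambda>s'. regs s' (vreg x) = i \<and> I (Suc i) (set_reg s' (vreg x) (Suc i)))"
    proof (rule runs_Seq, rule runs_mono[of _ _ _ _ _ "poly (cost e) ?n"])
      show "runs (compile (Suc (Suc d)) e) s' (poly (cost e) ?n)
          (computed (Suc (Suc d)) (val e ?n (?\<sigma>(x := i)) (arrs s)) s')"
        using Sum.IH[of "Suc (Suc d)" s'] unfolding same .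
      fix s'' assume c: "computed (Suc (Suc d)) (val e ?n (?\<sigma>(x := i)) (arrs s)) s' s''"
      have old: "regs s'' r = regs s' r" if "even r \<or> r < treg (Suc (Suc d))" for r
        using c that by (auto simp: computed_def)
      have o: "regs s'' (treg d) = regs s' (treg d)" "regs s'' (treg (Suc d)) = regs s' (treg (Suc d))"
        "regs s'' (vreg x) = i" using old I(2) by (auto simp: I_def)
      have lt: "r < treg (Suc (Suc d))" if "r < treg d" for r using that by (simp add: treg_def)
      show "runs (Assign (treg d) (Add (Reg (treg d)) (Reg (treg (Suc (Suc d)))))) s'' 1
        (\<lambda>s'. regs s' (vreg x) = i \<and> I (Suc i) (set_reg s' (vreg x) (Suc i)))"
        by (rule runs_Assign) (use c I(2) o old lt in \<open>auto simp: I_def computed_def\<close>)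
    qed simp
  qed
  then have "runs (for_loop (vreg x) ?b) s1 (?n * (poly (cost e) ?n + 3) + 2) (I ?n)"
    by (rule runs_mono) (auto simp: algebra_simps)
  then have "runs (Seq (for_loop (vreg x) ?b) (Assign (vreg x) (Reg (treg (Suc d))))) s1
    ((?n * (poly (cost e) ?n + 3) + 2) + 1) (computed d (val (Sum x e) ?n ?\<sigma> (arrs s)) s)"
    by (rule runs_Seq[OF runs_mono[OF _ runs_Assign order_refl]]) (auto simp: I_def computed_def)
  note run = this
  have "runs (compile d (Sum x e)) s (1 + (1 + ((?n * (poly (cost e) ?n + 3) + 2) + 1)))
    (computed d (val (Sum x e) ?n ?\<sigma> (arrs s)) s)"
    unfolding compile.simps
    by (rule runs_Seq, rule runs_Assign, rule runs_Seq, rule runs_Assign) (use run in \<open>simp add: s1_def\<close>)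
  then show ?case by (rule runs_mono) auto
qed (auto intro!: runs_Assign[unfolded One_nat_def] simp: computed_def)

definition loop2 :: "com \<Rightarrow> com" where
  "loop2 c = Seq (for_loop (vreg 0) (for_loop (vreg 1) c))
     (Seq (Assign (vreg 0) (Const 0)) (Assign (vreg 1) (Const 0)))"

text \<open>The double loop is treated as one pass over the matrix in row order: the invariant
  \<open>K\<close> is indexed by \<open>u * n + v\<close>, and the end of one row is the start of
  the next. The hypothesis \<open>frame\<close> says that \<open>K\<close> ignores the loop
  variables.\<close>

lemma runs_loop2:
  assumes s: "K 0 s" "regs s 2 = n" "\<And>x. regs s (vreg x) = 0"
    and frame: "\<And>i s x c. K i s \<Longrightarrow> K i (set_reg s (vreg x) c)"
    and step: "\<And>u v s. u < n \<Longrightarrow> v < n \<Longrightarrow> K (u * n + v) s \<Longrightarrow> regs s 2 = n \<Longrightarrow>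
      (\<lambda>x. regs s (vreg x)) = (\<lambda>_. 0)(0 := u, 1 := v) \<Longrightarrow>
      runs c s T (\<lambda>s'. K (Suc (u * n + v)) s' \<and> (\<forall>r. even r \<longrightarrow> regs s' r = regs s r))"
  shows "runs (loop2 c) s (n * (n * (T + 2) + 4) + 4)
    (\<lambda>s'. K (n * n) s' \<and> regs s' 2 = n \<and> (\<forall>x. regs s' (vreg x) = 0))"
proof -
  define J where "J u s' \<longleftrightarrow> K (u * n) s' \<and> regs s' (vreg 0) = u \<and> regs s' 2 = n \<and>
    (\<forall>x. 1 < x \<longrightarrow> regs s' (vreg x) = 0)" for u s'
  have "runs (for_loop (vreg 0) (for_loop (vreg 1) c)) s (n * ((n * (T + 2) + 2) + 2) + 2) (J n)"
  proof (rule runs_for)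
    show "J 0 (set_reg s (vreg 0) 0)" using s frame by (simp add: J_def)
    show "regs s (vreg 0) = i \<and> regs s 2 = n" if "J i s" for i s using that by (simp add: J_def)
    fix u s1 assume u: "u < n" "J u s1"
    define I where "I v s' \<longleftrightarrow> K (u * n + v) s' \<and> regs s' (vreg 0) = u \<and> regs s' (vreg 1) = v \<and> regs s' 2 = n \<and>
      (\<forall>x. 1 < x \<longrightarrow> regs s' (vreg x) = 0)" for v s'
    have "runs (for_loop (vreg 1) c) s1 (n * (T + 2) + 2) (I n)"
    proof (rule runs_for)
      show "I 0 (set_reg s1 (vreg 1) 0)" using u frame by (simp add: I_def J_def)
      show "regs s (vreg 1) = i \<and> regs s 2 = n" if "I i s" for i s using that by (simp add: I_def)
      fix v s2 assume v: "v < n" "I v s2"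
      have \<sigma>: "(\<lambda>x. regs s2 (vreg x)) = (\<lambda>_. 0)(0 := u, 1 := v)"
      proof
        fix x show "regs s2 (vreg x) = ((\<lambda>_. 0)(0 := u, 1 := v)) x"
        proof (cases "1 < x")
          case False
          then have "x = 0 \<or> x = 1" by linarith
          then show ?thesis using v by (auto simp: I_def)
        qed (use v in \<open>auto simp: I_def\<close>)
      qed
      have K: "K (u * n + v) s2" "regs s2 2 = n" using v by (auto simp: I_def)
      show "runs c s2 T (\<lambda>s'. regs s' (vreg 1) = v \<and> I (Suc v) (set_reg s' (vreg 1) (Suc v)))"
        by (rule runs_mono[OF step[OF u(1) v(1) K \<sigma>]])
          (use v frame in \<open>auto simp: I_def\<close>)
    qed
    then show "runs (for_loop (vreg 1) c) s1 (n * (T + 2) + 2)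
      (\<lambda>s'. regs s' (vreg 0) = u \<and> J (Suc u) (set_reg s' (vreg 0) (Suc u)))"
      by (rule runs_mono) (use frame in \<open>auto simp: I_def J_def add.commute\<close>)
  qed
  note outer = this
  have "runs (loop2 c) s ((n * ((n * (T + 2) + 2) + 2) + 2) + (1 + 1))
    (\<lambda>s'. K (n * n) s' \<and> regs s' 2 = n \<and> (\<forall>x. regs s' (vreg x) = 0))"
    unfolding loop2_def
  proof (rule runs_Seq, rule runs_mono[OF outer _ order_refl])
    fix s' assume J: "J n s'"
    have K2: "K (n * n) (set_reg (set_reg s' (vreg 0) 0) (vreg 1) 0)"
      by (rule frame, rule frame) (use J in \<open>simp add: J_def\<close>)
    have z: "regs s' (vreg x) = 0" if "x \<noteq> 0" "x \<noteq> Suc 0" for x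
      using J that by (auto simp: J_def)
    show "runs (Seq (Assign (vreg 0) (Const 0)) (Assign (vreg 1) (Const 0))) s' (1 + 1)
      (\<lambda>s'. K (n * n) s' \<and> regs s' 2 = n \<and> (\<forall>x. regs s' (vreg x) = 0))"
      by (intro runs_Seq runs_Assign) (use K2 J z in \<open>auto simp: J_def\<close>)
  qed
  then show ?thesis by (rule runs_mono) (auto simp: algebra_simps)
qed

type_synonym memory = "(nat \<Rightarrow> nat \<Rightarrow> nat) \<times> nat list"

text \<open>Array 1 is excluded because it holds the output.\<close>

definition holds :: "nat \<Rightarrow> nat \<Rightarrow> memory \<Rightarrow> state \<Rightarrow> bool" where
  "holds n j D s \<longleftrightarrow> regs s 2 = n \<and> regs s 3 = j \<and> (\<forall>x. regs s (vreg x) = 0) \<and>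
     (\<forall>a. a \<noteq> 1 \<longrightarrow> arrs s a = fst D a) \<and> output_of s = snd D"

definition env :: "nat \<Rightarrow> nat \<Rightarrow> nat \<Rightarrow> nat" where
  "env n i = (\<lambda>_. 0)(0 := i div n, 1 := i mod n)"

definition def_cmd :: "nat \<Rightarrow> expr \<Rightarrow> com" where
  "def_cmd a e = loop2 (Seq (compile 0 e)
     (Write a (Add (Read 2 (Reg (vreg 0))) (Reg (vreg 1))) (Reg (treg 0))))"

definition def_sem :: "nat \<Rightarrow> expr \<Rightarrow> nat \<Rightarrow> memory \<Rightarrow> memory" where
  "def_sem a e n D = ((fst D)(a := \<lambda>i. if i < n * n then val e n (env n i) (fst D) else fst D a i), snd D)"

definition emit_cmd :: "expr \<Rightarrow> expr \<Rightarrow> com" where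
  "emit_cmd b e = loop2 (Seq (compile 0 b) (Cond (Less (Const 0) (Reg (treg 0)))
     (Seq (compile 0 e) (Seq (Write 1 (Reg 1) (Reg (treg 0))) (Assign 1 (Add (Reg 1) (Const 1))))) Skip))"

definition emit_sem :: "expr \<Rightarrow> expr \<Rightarrow> nat \<Rightarrow> memory \<Rightarrow> memory" where
  "emit_sem b e n D = (fst D, snd D @
     concat (map (\<lambda>i. if 0 < val b n (env n i) (fst D) then [val e n (env n i) (fst D)] else []) [0..<n * n]))"

definition implements :: "nat set \<Rightarrow> com \<Rightarrow> (nat \<Rightarrow> memory \<Rightarrow> memory) \<Rightarrow> bool" where
  "implements J c F \<longleftrightarrow> (\<exists>p. \<forall>n. \<forall>j\<in>J. \<forall>D s. holds n j D s \<longrightarrow> (\<forall>u\<le>n. fst D 2 u = u * n) \<longrightarrow>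
     runs c s (poly p n) (holds n j (F n D)) \<and> fst (F n D) 2 = fst D 2)"

lemma env_index: "u < n \<Longrightarrow> v < n \<Longrightarrow> env n (u * n + v) = (\<lambda>_. 0)(0 := u, 1 := v)"
  by (simp add: env_def)

lemma index_less: "u < n \<Longrightarrow> v < n \<Longrightarrow> u * n + v < n * n" for n :: nat
proof -
  assume uv: "u < n" "v < n"
  have "u * n + v < Suc u * n" using uv(2) by simp
  also have "\<dots> \<le> n * n" using uv(1) by (intro mult_right_mono) auto
  finally show ?thesis .
qed

text \<open>\<open>a\<close> must not be read by \<open>e\<close>, since it is overwritten entry by
  entry while later entries are still being computed. Array 1 is excluded as the abstract memory
  does not describe it.\<close>

lemma implements_def_cmd:
  assumes "a \<noteq> 1" "a \<noteq> 2" "a \<notin> reads e" "1 \<notin> reads e"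
  shows "implements UNIV (def_cmd a e) (def_sem a e)"
proof -
  let ?p = "[:0, 1:] * ([:0, 1:] * ((cost e + 1) + 2) + 4) + 4"
  have "runs (def_cmd a e) s (poly ?p n) (holds n j (def_sem a e n D)) \<and> fst (def_sem a e n D) 2 = fst D 2"
    if h: "holds n j D s" and off: "\<forall>u\<le>n. fst D 2 u = u * n" for n j D s
  proof
    define F where "F i = val e n (env n i) (fst D)" for i
    have upd: "(\<lambda>m. if m < i then F m else g m)(i := F i) = (\<lambda>m. if m < Suc i then F m else g m)" for i g
      by (auto simp: fun_eq_iff less_Suc_eq)
    define K where "K i s' \<longleftrightarrow> regs s' 3 = j \<and> (\<forall>b. b \<noteq> 1 \<and> b \<noteq> a \<longrightarrow> arrs s' b = fst D b) \<and>
      arrs s' a = (\<lambda>m. if m < i then F m else fst D a m) \<and> output_of s' = snd D" for i s'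
    have "runs (def_cmd a e) s (n * (n * ((poly (cost e) n + 1) + 2) + 4) + 4)
      (\<lambda>s'. K (n * n) s' \<and> regs s' 2 = n \<and> (\<forall>x. regs s' (vreg x) = 0))"
      unfolding def_cmd_def
    proof (rule runs_loop2)
      show "K 0 s" using h assms(1) by (auto simp: K_def holds_def)
      show "regs s 2 = n" "\<And>x. regs s (vreg x) = 0" using h by (auto simp: holds_def)
      show "K i (set_reg s (vreg x) c)" if "K i s" for i s x c
        using that by (simp add: K_def output_of_def)
      fix u v s1
      assume uv: "u < n" "v < n" and K: "K (u * n + v) s1" and n: "regs s1 2 = n"
        and \<sigma>: "(\<lambda>x. regs s1 (vreg x)) = (\<lambda>_. 0)(0 := u, 1 := v)"
      have \<sigma>': "regs s1 (vreg 0) = u" "regs s1 (vreg (Suc 0)) = v"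
        using fun_cong[OF \<sigma>, of 0] fun_cong[OF \<sigma>, of 1] by simp_all
      have F: "val e n (\<lambda>x. regs s1 (vreg x)) (arrs s1) = F (u * n + v)"
        unfolding F_def \<sigma> env_index[OF uv]
      proof (rule val_cong)
        fix b assume "b \<in> reads e"
        then have "b \<noteq> 1" "b \<noteq> a" using assms by metis+
        then show "arrs s1 b = fst D b" using K by (simp add: K_def)
      qed
      show "runs (Seq (compile 0 e) (Write a (Add (Read 2 (Reg (vreg 0))) (Reg (vreg 1))) (Reg (treg 0)))) s1
        (poly (cost e) n + 1) (\<lambda>s'. K (Suc (u * n + v)) s' \<and> (\<forall>r. even r \<longrightarrow> regs s' r = regs s1 r))"
      proof (rule runs_Seq, rule runs_mono[of _ _ _ _ _ "poly (cost e) n"])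
        show "runs (compile 0 e) s1 (poly (cost e) n) (computed 0 (F (u * n + v)) s1)"
          using compile_runs[of 0 e s1] unfolding n F .
        fix s2 assume c: "computed 0 (F (u * n + v)) s1 s2"
        have r: "regs s2 1 = regs s1 1" "regs s2 3 = regs s1 3" "arrs s2 = arrs s1" "regs s2 (treg 0) = F (u * n + v)"
          "regs s2 (vreg 0) = u" "regs s2 (vreg (Suc 0)) = v" "\<And>r. even r \<Longrightarrow> regs s2 r = regs s1 r"
          using c \<sigma>' by (auto simp: computed_def)
        have "arrs s1 2 = fst D 2" using K assms(2) by (simp add: K_def)
        then have i: "arrs s1 2 u + v = u * n + v" using off uv by simp
        show "runs (Write a (Add (Read 2 (Reg (vreg 0))) (Reg (vreg 1))) (Reg (treg 0))) s2 1
          (\<lambda>s'. K (Suc (u * n + v)) s' \<and> (\<forall>r. even r \<longrightarrow> regs s' r = regs s1 r))"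
          by (rule runs_Write) (use K r i assms(1) in \<open>auto simp: K_def output_of_def upd\<close>)
      qed simp
    qed
    then show "runs (def_cmd a e) s (poly ?p n) (holds n j (def_sem a e n D))"
      by (rule runs_mono) (auto simp: K_def holds_def def_sem_def F_def)
    show "fst (def_sem a e n D) 2 = fst D 2" using assms(2) by (simp add: def_sem_def)
  qed
  then show ?thesis unfolding implements_def by blast
qed

lemma implements_emit_cmd:
  assumes "1 \<notin> reads b" "1 \<notin> reads e"
  shows "implements UNIV (emit_cmd b e) (emit_sem b e)"
proof -
  let ?p = "[:0, 1:] * ([:0, 1:] * ((cost b + (cost e + 2 + 1)) + 2) + 4) + 4"
  have "runs (emit_cmd b e) s (poly ?p n) (holds n j (emit_sem b e n D)) \<and> fst (emit_sem b e n D) 2 = fst D 2"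
    if h: "holds n j D s" for n j D s
  proof
    define G where "G i = (if 0 < val b n (env n i) (fst D) then [val e n (env n i) (fst D)] else [])" for i
    define K where "K i s' \<longleftrightarrow> regs s' 3 = j \<and> (\<forall>a. a \<noteq> 1 \<longrightarrow> arrs s' a = fst D a) \<and>
      output_of s' = snd D @ concat (map G [0..<i])" for i s'
    have "runs (emit_cmd b e) s (n * (n * ((poly (cost b) n + (poly (cost e) n + 2 + 1)) + 2) + 4) + 4)
      (\<lambda>s'. K (n * n) s' \<and> regs s' 2 = n \<and> (\<forall>x. regs s' (vreg x) = 0))"
      unfolding emit_cmd_def
    proof (rule runs_loop2)
      show "K 0 s" using h by (auto simp: K_def holds_def)
      show "regs s 2 = n" "\<And>x. regs s (vreg x) = 0" using h by (auto simp: holds_def)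
      show "K i (set_reg s (vreg x) c)" if "K i s" for i s x c
        using that by (simp add: K_def output_of_def)
      fix u v s1
      assume uv: "u < n" "v < n" and K: "K (u * n + v) s1" and n: "regs s1 2 = n"
        and \<sigma>: "(\<lambda>x. regs s1 (vreg x)) = (\<lambda>_. 0)(0 := u, 1 := v)"
      let ?i = "u * n + v"
      let ?Q = "\<lambda>s'. K (Suc ?i) s' \<and> (\<forall>r. even r \<longrightarrow> regs s' r = regs s1 r)"
      have arr: "arrs s1 a = fst D a" if "a \<in> reads b \<union> reads e" for a
      proof -
        have "a \<noteq> 1" using that assms by auto
        then show ?thesis using K by (simp add: K_def)
      qed
      have vals: "val b n (\<lambda>x. regs s1 (vreg x)) (arrs s1) = val b n (env n ?i) (fst D)"
        "val e n (\<lambda>x. regs s1 (vreg x)) (arrs s1) = val e n (env n ?i) (fst D)"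
        unfolding \<sigma> env_index[OF uv] by (rule val_cong; use arr in blast)+
      show "runs (Seq (compile 0 b) (Cond (Less (Const 0) (Reg (treg 0)))
         (Seq (compile 0 e) (Seq (Write 1 (Reg 1) (Reg (treg 0))) (Assign 1 (Add (Reg 1) (Const 1))))) Skip)) s1
        (poly (cost b) n + (poly (cost e) n + 2 + 1)) ?Q"
      proof (rule runs_Seq, rule runs_mono[of _ _ _ _ _ "poly (cost b) n"])
        show "runs (compile 0 b) s1 (poly (cost b) n) (computed 0 (val b n (env n ?i) (fst D)) s1)"
          using compile_runs[of 0 b s1] unfolding n vals .
        fix s2 assume c: "computed 0 (val b n (env n ?i) (fst D)) s1 s2"
        have r: "regs s2 1 = regs s1 1" "regs s2 3 = regs s1 3" "arrs s2 = arrs s1"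
          "regs s2 (treg 0) = val b n (env n ?i) (fst D)" "\<And>r. even r \<Longrightarrow> regs s2 r = regs s1 r"
          using c by (auto simp: computed_def)
        show "runs (Cond (Less (Const 0) (Reg (treg 0)))
         (Seq (compile 0 e) (Seq (Write 1 (Reg 1) (Reg (treg 0))) (Assign 1 (Add (Reg 1) (Const 1))))) Skip) s2
          (poly (cost e) n + 2 + 1) ?Q"
        proof (rule runs_Cond)
          assume "\<not> bval (Less (Const 0) (Reg (treg 0))) s2"
          then have "G ?i = []" using r by (simp add: G_def)
          then have "runs Skip s2 1 ?Q"
            by (intro runs_Skip) (use K r in \<open>auto simp: K_def output_of_def\<close>)
          then show "runs Skip s2 (poly (cost e) n + 2) ?Q" by (rule runs_mono) auto
        next
          assume "bval (Less (Const 0) (Reg (treg 0))) s2"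
          then have G: "G ?i = [val e n (env n ?i) (fst D)]" using r by (simp add: G_def)
          have "(\<lambda>x. regs s2 (vreg x)) = (\<lambda>x. regs s1 (vreg x))" "regs s2 2 = n" using r(5) n by auto
          then have run: "runs (compile 0 e) s2 (poly (cost e) n) (computed 0 (val e n (env n ?i) (fst D)) s2)"
            using compile_runs[of 0 e s2] r(3) vals(2) by simp
          have "runs (Seq (compile 0 e) (Seq (Write 1 (Reg 1) (Reg (treg 0))) (Assign 1 (Add (Reg 1) (Const 1))))) s2
            (poly (cost e) n + (1 + 1)) ?Q"
          proof (rule runs_Seq, rule runs_mono[OF run _ order_refl])
            fix s3 assume "computed 0 (val e n (env n ?i) (fst D)) s2 s3"
            then have r3: "regs s3 1 = regs s1 1" "regs s3 3 = regs s1 3" "arrs s3 = arrs s1"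
              "regs s3 (treg 0) = val e n (env n ?i) (fst D)" "\<And>r. even r \<Longrightarrow> regs s3 r = regs s1 r"
              using r by (auto simp: computed_def)
            show "runs (Seq (Write 1 (Reg 1) (Reg (treg 0))) (Assign 1 (Add (Reg 1) (Const 1)))) s3 (1 + 1) ?Q"
              by (intro runs_Seq runs_Write runs_Assign)
                (use K r3 G in \<open>auto simp: K_def output_of_def\<close>)
          qed
          then show "runs (Seq (compile 0 e) (Seq (Write 1 (Reg 1) (Reg (treg 0))) (Assign 1 (Add (Reg 1) (Const 1))))) s2
            (poly (cost e) n + 2) ?Q"
            by (rule runs_mono) auto
        qed
      qed simp
    qed
    then show "runs (emit_cmd b e) s (poly ?p n) (holds n j (emit_sem b e n D))"
      by (rule runs_mono) (auto simp: K_def holds_def emit_sem_def G_def[abs_def])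
    show "fst (emit_sem b e n D) 2 = fst D 2" by (simp add: emit_sem_def)
  qed
  then show ?thesis unfolding implements_def by blast
qed

lemma implements_seq:
  assumes "implements J c1 F1" "implements J c2 F2"
  shows "implements J (Seq c1 c2) (\<lambda>n D. F2 n (F1 n D))"
proof -
  obtain p1 where 1: "\<And>n j D s. j \<in> J \<Longrightarrow> holds n j D s \<Longrightarrow> (\<forall>u\<le>n. fst D 2 u = u * n) \<Longrightarrow>
     runs c1 s (poly p1 n) (holds n j (F1 n D)) \<and> fst (F1 n D) 2 = fst D 2"
    using assms(1) unfolding implements_def by blast
  obtain p2 where 2: "\<And>n j D s. j \<in> J \<Longrightarrow> holds n j D s \<Longrightarrow> (\<forall>u\<le>n. fst D 2 u = u * n) \<Longrightarrow>
     runs c2 s (poly p2 n) (holds n j (F2 n D)) \<and> fst (F2 n D) 2 = fst D 2"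
    using assms(2) unfolding implements_def by blast
  have "runs (Seq c1 c2) s (poly (p1 + p2) n) (holds n j (F2 n (F1 n D))) \<and> fst (F2 n (F1 n D)) 2 = fst D 2"
    if a: "j \<in> J" "holds n j D s" "\<forall>u\<le>n. fst D 2 u = u * n" for n j D s
  proof -
    have r1: "runs c1 s (poly p1 n) (holds n j (F1 n D))" and f1: "fst (F1 n D) 2 = fst D 2" using 1[OF a] by auto
    have off: "\<forall>u\<le>n. fst (F1 n D) 2 u = u * n" using f1 a(3) by simp
    have "runs (Seq c1 c2) s (poly p1 n + poly p2 n) (holds n j (F2 n (F1 n D)))"
      by (rule runs_Seq, rule runs_mono[OF r1 _ order_refl]) (use 2[OF a(1) _ off] in blast)
    \<comment> \<open>\<open>implements\<close> speaks only of memories held by some state, so the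
      final state of the first program is needed to conclude that the second preserves array
      2.\<close>
    moreover obtain t s' where "holds n j (F1 n D) s'" using r1 unfolding runs_def by blast
    ultimately show ?thesis using 2[OF a(1) _ off] f1 by auto
  qed
  then show ?thesis unfolding implements_def by blast
qed

lemma implements_weaken: "implements J c F \<Longrightarrow> J' \<subseteq> J \<Longrightarrow> implements J' c F"
  unfolding implements_def by blast

definition repeat_cmd :: "com \<Rightarrow> com" where
  "repeat_cmd c = Seq (for_loop 3 c) (Assign 3 (Const 0))"

lemma implements_repeat:
  assumes "implements UNIV c F"
  shows "implements {0} (repeat_cmd c) (\<lambda>n. F n ^^ n)"
proof -
  obtain p where p: "\<And>n j D s. holds n j D s \<Longrightarrow> (\<forall>u\<le>n. fst D 2 u = u * n) \<Longrightarrow>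
     runs c s (poly p n) (holds n j (F n D)) \<and> fst (F n D) 2 = fst D 2"
    using assms unfolding implements_def by blast
  have reg3: "holds n j' D (set_reg s 3 j')" if "holds n j D s" for n j j' D s
    using that by (auto simp: holds_def output_of_def)
  have "runs (repeat_cmd c) s (poly ([:0, 1:] * (p + 2) + 3) n) (holds n 0 ((F n ^^ n) D)) \<and>
      fst ((F n ^^ n) D) 2 = fst D 2"
    if h: "holds n 0 D s" and off: "\<forall>u\<le>n. fst D 2 u = u * n" for n D s
  proof -
    define I where "I i s' \<longleftrightarrow> holds n i ((F n ^^ i) D) s' \<and> fst ((F n ^^ i) D) 2 = fst D 2" for i s'
    have "runs (for_loop 3 c) s (n * (poly p n + 2) + 2) (I n)"
    proof (rule runs_for)
      show "I 0 (set_reg s 3 0)" using reg3[OF h] by (simp add: I_def)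
      show "regs s 3 = i \<and> regs s 2 = n" if "I i s" for i s using that by (simp add: I_def holds_def)
      fix i s1 assume "i < n" and I: "I i s1"
      have "runs c s1 (poly p n) (holds n i (F n ((F n ^^ i) D)))" "fst (F n ((F n ^^ i) D)) 2 = fst D 2"
        using p[of n i "(F n ^^ i) D" s1] I off by (auto simp: I_def)
      then show "runs c s1 (poly p n) (\<lambda>s'. regs s' 3 = i \<and> I (Suc i) (set_reg s' 3 (Suc i)))"
        by (elim runs_mono) (auto simp: I_def holds_def output_of_def)
    qed
    then have r: "runs (repeat_cmd c) s (n * (poly p n + 2) + 2 + 1) (\<lambda>s'. holds n 0 ((F n ^^ n) D) s' \<and> fst ((F n ^^ n) D) 2 = fst D 2)"
      unfolding repeat_cmd_def
    proof (intro runs_Seq, elim runs_mono)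
      fix s' assume I: "I n s'"
      show "runs (Assign 3 (Const 0)) s' 1 (\<lambda>s'. holds n 0 ((F n ^^ n) D) s' \<and> fst ((F n ^^ n) D) 2 = fst D 2)"
        by (rule runs_Assign) (use I reg3[of n n "(F n ^^ n) D" s' 0] in \<open>simp add: I_def\<close>)
    qed simp
    then have "fst ((F n ^^ n) D) 2 = fst D 2" unfolding runs_def by blast
    moreover have "runs (repeat_cmd c) s (poly ([:0, 1:] * (p + 2) + 3) n) (holds n 0 ((F n ^^ n) D))"
      using r by (rule runs_mono) auto
    ultimately show ?thesis by blast
  qed
  then show ?thesis unfolding implements_def by blast
qed

text \<open>Fills array 2 with the multiples of \<open>n\<close>, including \<open>n * n\<close>, by
  repeated addition. They replace the multiplication that the machine lacks.\<close>

definition init_cmd :: com where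
  "init_cmd = Seq (Assign 2 (Read 0 (Const 0))) (Seq
     (for_loop (vreg 0) (Write 2 (Add (Reg (vreg 0)) (Const 1)) (Add (Read 2 (Reg (vreg 0))) (Reg 2))))
     (Assign (vreg 0) (Const 0)))"

definition init_arrays :: "nat \<Rightarrow> nat list \<Rightarrow> nat \<Rightarrow> nat \<Rightarrow> nat" where
  "init_arrays n xs a i = (if a = 0 \<and> i < length xs then xs ! i else if a = 2 \<and> i \<le> n then i * n else 0)"

lemma init_runs:
  assumes "xs \<noteq> []" "xs ! 0 = n"
  shows "runs init_cmd (input_state xs) (n * 3 + 4) (holds n 0 (init_arrays n xs, []))"
proof -
  define I where "I i s \<longleftrightarrow> regs s 2 = n \<and> regs s 1 = 0 \<and> regs s 3 = 0 \<and> regs s (vreg 0) = i \<and>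
    (\<forall>x. x \<noteq> 0 \<longrightarrow> regs s (vreg x) = 0) \<and> (\<forall>a. a \<noteq> 2 \<longrightarrow> arrs s a = init_arrays n xs a) \<and>
    arrs s 2 = (\<lambda>m. if m \<le> i then m * n else 0)" for i and s :: state
  let ?s = "set_reg (input_state xs) 2 n"
  have I0: "I 0 (set_reg ?s (vreg 0) 0)"
    using assms by (auto simp: I_def input_state_def init_arrays_def fun_eq_iff)
  have "runs (for_loop (vreg 0) (Write 2 (Add (Reg (vreg 0)) (Const 1)) (Add (Read 2 (Reg (vreg 0))) (Reg 2)))) ?s
    (n * (1 + 2) + 2) (I n)"
  proof (rule runs_for)
    fix i s assume "i < n" "I i s"
    then show "runs (Write 2 (Add (Reg (vreg 0)) (Const 1)) (Add (Read 2 (Reg (vreg 0))) (Reg 2))) s 1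
       (\<lambda>s'. regs s' (vreg 0) = i \<and> I (Suc i) (set_reg s' (vreg 0) (Suc i)))"
      by (intro runs_Write) (auto simp: I_def fun_eq_iff le_Suc_eq)
  qed (use I0 in \<open>auto simp: I_def\<close>)
  moreover have "holds n 0 (init_arrays n xs, []) (set_reg s (vreg 0) 0)" if "I n s" for s
  proof -
    have "arrs s a = init_arrays n xs a" for a
      by (cases "a = 2") (use that in \<open>auto simp: I_def init_arrays_def fun_eq_iff\<close>)
    then show ?thesis using that by (auto simp: I_def holds_def output_of_def)
  qed
  ultimately have "runs (Seq (for_loop (vreg 0) (Write 2 (Add (Reg (vreg 0)) (Const 1)) (Add (Read 2 (Reg (vreg 0))) (Reg 2))))
      (Assign (vreg 0) (Const 0))) ?s ((n * (1 + 2) + 2) + 1) (holds n 0 (init_arrays n xs, []))"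
    by (intro runs_Seq) (erule runs_mono, rule runs_Assign, simp_all)
  then have "runs init_cmd (input_state xs) (1 + ((n * (1 + 2) + 2) + 1)) (holds n 0 (init_arrays n xs, []))"
    unfolding init_cmd_def
    by (intro runs_Seq[of "Assign 2 _"] runs_Assign) (use assms in \<open>simp add: input_state_def\<close>)
  then show ?thesis by (rule runs_mono) auto
qed

lemma poly_nat_mono: "m \<le> n \<Longrightarrow> poly p m \<le> poly p n" for p :: "nat poly"
  by (induction p) (auto intro: mult_mono add_mono)

text \<open>The running time is polynomial in the first input entry. Polynomials over the naturals
  are monotone, so the bound carries over to the length of the input.\<close>

lemma polytime_on_implements:
  assumes impl: "implements {0} c F"
    and enc: "\<And>x. x \<in> D \<Longrightarrow> enc x \<noteq> [] \<and> enc x ! 0 \<le> length (enc x)"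
    and out: "\<And>x. x \<in> D \<Longrightarrow> snd (F (enc x ! 0) (init_arrays (enc x ! 0) (enc x), [])) = enc (K x)"
  shows "polytime_on D enc K"
proof -
  obtain p where p: "\<And>n D s. holds n 0 D s \<Longrightarrow> (\<forall>u\<le>n. fst D 2 u = u * n) \<Longrightarrow>
     runs c s (poly p n) (holds n 0 (F n D)) \<and> fst (F n D) 2 = fst D 2"
    using impl unfolding implements_def by blast
  let ?p = "[:4, 3:] + p"
  have "\<exists>t s. exec (Seq init_cmd c) (input_state (enc x)) t s \<and> output_of s = enc (K x) \<and> t \<le> poly ?p (length (enc x))"
    if x: "x \<in> D" for x
  proof -
    let ?n = "enc x ! 0" and ?A = "init_arrays (enc x ! 0) (enc x)"
    have off: "\<forall>u\<le>?n. fst (?A, [] :: nat list) 2 u = u * ?n" by (simp add: init_arrays_def)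
    have "runs (Seq init_cmd c) (input_state (enc x)) ((?n * 3 + 4) + poly p ?n) (holds ?n 0 (F ?n (?A, [])))"
      by (rule runs_Seq, rule runs_mono[OF init_runs _ order_refl]) (use enc[OF x] p[OF _ off] in auto)
    then obtain t s where ts: "exec (Seq init_cmd c) (input_state (enc x)) t s" "t \<le> (?n * 3 + 4) + poly p ?n"
      "holds ?n 0 (F ?n (?A, [])) s" unfolding runs_def by blast
    have "t \<le> poly ?p ?n" using ts(2) by (simp add: mult.commute)
    also have "\<dots> \<le> poly ?p (length (enc x))" by (rule poly_nat_mono) (use enc[OF x] in blast)
    finally show ?thesis using ts out[OF x] by (auto simp: holds_def)
  qed
  then show ?thesis unfolding polytime_on_def by blast
qed


section \<open>The ts_kernel\<close>

text \<open>Every round before stabilization loses an element, so after \<open>n\<close> rounds the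
  set is stable or empty, and the empty set is stable too.\<close>

lemma decreasing_fixpoint:
  assumes f: "\<And>R. R \<subseteq> S \<Longrightarrow> f R \<subseteq> R" and "finite S" "card S \<le> n"
  shows "f ((f ^^ n) S) = (f ^^ n) S" "(f ^^ n) S \<subseteq> S"
proof -
  have inc: "(f ^^ i) S \<subseteq> S" for i
  proof (induction i)
    case (Suc i)
    then show ?case using f[OF Suc] by simp
  qed simp
  then show "(f ^^ n) S \<subseteq> S" .
  have "f ((f ^^ i) S) = (f ^^ i) S \<or> card ((f ^^ i) S) + i \<le> card S" for i
  proof (induction i)
    case (Suc i)
    show ?case
    proof (cases "f ((f ^^ i) S) = (f ^^ i) S")
      case False
      then have "f ((f ^^ i) S) \<subset> (f ^^ i) S" using f[OF inc] by blast
      then have "card (f ((f ^^ i) S)) < card ((f ^^ i) S)"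
        by (rule psubset_card_mono[rotated]) (rule finite_subset[OF inc assms(2)])
      then show ?thesis using Suc False by auto
    qed simp
  qed simp
  then consider "f ((f ^^ n) S) = (f ^^ n) S" | "card ((f ^^ n) S) + n \<le> card S" by blast
  then show "f ((f ^^ n) S) = (f ^^ n) S"
  proof cases
    case 2
    then have "card ((f ^^ n) S) = 0" using assms(3) by linarith
    then have "(f ^^ n) S = {}" using finite_subset[OF inc[of n] assms(2)] by simp
    then show ?thesis using f[of "{}"] by simp
  qed
qed

lemma increasing_fixpoint:
  assumes f: "\<And>B. B \<subseteq> W \<Longrightarrow> B \<subseteq> f B \<and> f B \<subseteq> W" and W: "finite W" "card W \<le> n" and B: "B \<subseteq> W"
  shows "f ((f ^^ n) B) = (f ^^ n) B" "B \<subseteq> (f ^^ n) B"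
proof -
  have inc: "(f ^^ i) B \<subseteq> W \<and> B \<subseteq> (f ^^ i) B" for i
  proof (induction i)
    case (Suc i)
    then show ?case using f[of "(f ^^ i) B"] by auto
  qed (use B in simp)
  then show "B \<subseteq> (f ^^ n) B" by blast
  have fin: "finite ((f ^^ i) B)" for i using inc[of i] W(1) finite_subset by blast
  have "f ((f ^^ i) B) = (f ^^ i) B \<or> i \<le> card ((f ^^ i) B)" for i
  proof (induction i)
    case (Suc i)
    show ?case
    proof (cases "f ((f ^^ i) B) = (f ^^ i) B")
      case False
      then have "(f ^^ i) B \<subset> f ((f ^^ i) B)" using f[of "(f ^^ i) B"] inc[of i] by blast
      then have "card ((f ^^ i) B) < card (f ((f ^^ i) B))"
        by (rule psubset_card_mono[rotated]) (use fin[of "Suc i"] in simp)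
      then show ?thesis using Suc False by auto
    qed simp
  qed simp
  then consider "f ((f ^^ n) B) = (f ^^ n) B" | "n \<le> card ((f ^^ n) B)" by blast
  then show "f ((f ^^ n) B) = (f ^^ n) B"
  proof cases
    case 2
    then have "card ((f ^^ n) B) = card W"
      using W card_mono[OF W(1), of "(f ^^ n) B"] inc[of n] by linarith
    then have "(f ^^ n) B = W" using inc[of n] W(1) by (simp add: card_subset_eq)
    then show ?thesis using f[of W] by auto
  qed
qed

text \<open>One simultaneous round of discarding the tokens that have a private neighbour. The rigid
  core is its greatest fixed point below \<open>S\<close>.\<close>

definition shrink :: "('a \<Rightarrow> 'a \<Rightarrow> bool) \<Rightarrow> 'a set \<Rightarrow> 'a set \<Rightarrow> 'a set" where
  "shrink E V R = {v\<in>R. \<forall>w\<in>V. E v w \<longrightarrow> (\<exists>u\<in>R. u \<noteq> v \<and> E w u)}"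

lemma shrink_rigid_core:
  assumes "finite S" "card S \<le> n"
  shows "(shrink E V ^^ n) S = rigid_core E V S"
proof
  have "shrink E V R \<subseteq> R" for R by (auto simp: shrink_def)
  then have fix_: "shrink E V ((shrink E V ^^ n) S) = (shrink E V ^^ n) S" "(shrink E V ^^ n) S \<subseteq> S"
    using decreasing_fixpoint[of S "shrink E V" n] assms by auto
  have "rigid E V R" if "shrink E V R = R" for R
    using that unfolding shrink_def rigid_def by blast
  then show "(shrink E V ^^ n) S \<subseteq> rigid_core E V S" using fix_ by (intro rigid_core_greatest) auto
  have "rigid_core E V S \<subseteq> (shrink E V ^^ i) S" for i
  proof (induction i)
    case 0
    show ?case using rigid_core_subset[of E V S] by simp
  next
    case (Suc i)
    then show ?case using rigid_core_rigid[of E V S] unfolding rigid_def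
      by (auto simp: shrink_def) blast
  qed
  then show "rigid_core E V S \<subseteq> (shrink E V ^^ n) S" .
qed

definition grow :: "('a \<Rightarrow> 'a \<Rightarrow> bool) \<Rightarrow> 'a set \<Rightarrow> 'a set \<Rightarrow> 'a set" where
  "grow E V B = B \<union> {v\<in>V. \<exists>w\<in>B. E w v}"

lemma grow_component:
  assumes "finite V" "card V \<le> n" "v \<in> V"
  shows "(grow E V ^^ n) {v} = component_of E V v"
proof
  have "(grow E V ^^ i) {v} \<subseteq> component_of E V v" for i
  proof (induction i)
    case 0
    then show ?case using assms(3) by (simp add: component_of_def)
  next
    case (Suc i)
    have "x \<in> component_of E V v" if x: "x \<in> V" "w \<in> component_of E V v" "E w x" for x w
    proof -
      have "edge_in E V w x" "(edge_in E V)\<^sup>*\<^sup>* v w" using x by (auto simp: component_of_def edge_in_def)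
      then show ?thesis using x(1) unfolding component_of_def by simp
    qed
    then show ?case using Suc by (auto simp: grow_def)
  qed
  then show "(grow E V ^^ n) {v} \<subseteq> component_of E V v" .
  let ?B = "(grow E V ^^ n) {v}"
  have fix_: "grow E V ?B = ?B" "{v} \<subseteq> ?B"
    using increasing_fixpoint[of V "grow E V" n "{v}"] assms by (auto simp: grow_def)
  have "x \<in> ?B" if "(edge_in E V)\<^sup>*\<^sup>* v x" for x
    using that
  proof (induction rule: rtranclp_induct)
    case (step y z)
    then have "z \<in> grow E V ?B" unfolding grow_def[of E V ?B] edge_in_def by blast
    then show ?case using fix_ by simp
  qed (use fix_ in simp)
  then show "component_of E V v \<subseteq> ?B" by (auto simp: component_of_def)
qed

section \<open>Transport along isomorphisms and renumbering of vertices\<close>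

definition embeds :: "('b \<Rightarrow> 'a) \<Rightarrow> 'b set \<Rightarrow> ('b \<Rightarrow> 'b \<Rightarrow> bool) \<Rightarrow> ('a \<Rightarrow> 'a \<Rightarrow> bool) \<Rightarrow> bool" where
  "embeds h V E' E \<longleftrightarrow> inj_on h V \<and> (\<forall>i\<in>V. \<forall>j\<in>V. E' i j \<longleftrightarrow> E (h i) (h j))"

lemma move_image:
  assumes h: "embeds h V E' E" and "move E' V I J"
  shows "move E (h ` V) (h ` I) (h ` J)"
proof -
  obtain u w where m: "u \<in> I" "w \<notin> I" "E' u w" "J = insert w (I - {u})" "I \<subseteq> V" "J \<subseteq> V" "indep E' I" "indep E' J"
    using assms(2) unfolding move_def by blast
  have ind: "indep E (h ` H)" if "indep E' H" "H \<subseteq> V" for H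
    using that h unfolding indep_def embeds_def by (simp add: subset_iff)
  have inj: "inj_on h V" using h by (simp add: embeds_def)
  have uw: "u \<in> V" "w \<in> V" using m by auto
  show ?thesis
  proof (rule moveI[of "h u" _ "h w"])
    show "h w \<notin> h ` I" using inj_on_image_mem_iff[OF inj uw(2) m(5)] m(2) by simp
    show "E (h u) (h w)" using h m(3) uw by (simp add: embeds_def)
    have "h ` (I - {u}) = h ` I - {h u}" using inj_on_image_set_diff[OF inj, of I "{u}"] m(5) uw by auto
    then show "h ` J = insert (h w) (h ` I - {h u})" using m(4) by simp
    show "indep E (h ` I)" "indep E (h ` J)" using ind m by blast+
  qed (use m in auto)
qed

lemma reach_image:
  assumes h: "embeds h V E' E" and "reach E' V I J"
  shows "reach E (h ` V) (h ` I) (h ` J)"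
  using assms(2)
proof (induction rule: rtranclp_induct)
  case (step J K)
  show ?case by (rule rtranclp.rtrancl_into_rtrancl[OF step.IH move_image[OF h step.hyps(2)]])
qed simp

lemma reach_iso:
  assumes h: "embeds h V E' E" and IJ: "I \<subseteq> V" "J \<subseteq> V"
  shows "reach E' V I J \<longleftrightarrow> reach E (h ` V) (h ` I) (h ` J)"
proof
  show "reach E' V I J \<Longrightarrow> reach E (h ` V) (h ` I) (h ` J)" by (rule reach_image[OF h])
  let ?g = "the_inv_into V h"
  have inj: "inj_on h V" using h by (simp add: embeds_def)
  have g: "?g (h i) = i" if "i \<in> V" for i using the_inv_into_f_f[OF inj that] .
  have gi: "?g ` (h ` H) = H" if "H \<subseteq> V" for H
  proof -
    have "?g ` (h ` H) = (\<lambda>i. i) ` H" unfolding image_image by (rule image_cong) (use that g in auto)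
    then show ?thesis by simp
  qed
  assume r: "reach E (h ` V) (h ` I) (h ` J)"
  have "inj_on ?g (h ` V)" by (rule inj_onI) (auto simp: g)
  moreover have "E i j \<longleftrightarrow> E' (?g i) (?g j)" if "i \<in> h ` V" "j \<in> h ` V" for i j
    using that g h by (auto simp: embeds_def)
  ultimately have "embeds ?g (h ` V) E E'" by (simp add: embeds_def)
  then have "reach E' (?g ` (h ` V)) (?g ` (h ` I)) (?g ` (h ` J))" by (rule reach_image) (rule r)
  then show "reach E' V I J" using gi IJ by simp
qed

abbreviation adj :: "'a pair_pre_digraph \<Rightarrow> 'a \<Rightarrow> 'a \<Rightarrow> bool" where
  "adj G u v \<equiv> (u, v) \<in> parcs G"

lemma independent_set_iff: "independent_set G I \<longleftrightarrow> I \<subseteq> pverts G \<and> indep (adj G) I"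
  by (simp add: independent_set_def indep_def)

lemma slidable_reach:
  assumes "independent_set G S" "finite S"
  shows "slidable G (card S) S T \<longleftrightarrow> reach (adj G) (pverts G) S T"
proof
  assume "slidable G (card S) S T"
  then obtain l I where I: "I 0 = S" "I l = T" "\<forall>i\<le>l. independent_set G (I i) \<and> card (I i) = card S"
    "\<forall>i<l. slide G (I i) (I (Suc i))"
    unfolding slidable_def by blast
  have "move (adj G) (pverts G) (I i) (I (Suc i))" if "i < l" for i
  proof -
    obtain u w where "u \<in> I i" "w \<notin> I i" "(u, w) \<in> parcs G" "I (Suc i) = (I i - {u}) \<union> {w}"
      using I(4) \<open>i < l\<close> unfolding slide_def by blast
    moreover have "independent_set G (I i)" "independent_set G (I (Suc i))" using I(3) \<open>i < l\<close> by auto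
    ultimately show ?thesis unfolding independent_set_iff by (intro moveI[of u _ w]) auto
  qed
  then have "(move (adj G) (pverts G) ^^ l) S T" unfolding relpowp_fun_conv using I(1,2) by blast
  then show "reach (adj G) (pverts G) S T" by (rule relpowp_imp_rtranclp)
next
  assume r: "reach (adj G) (pverts G) S T"
  then obtain l where "(move (adj G) (pverts G) ^^ l) S T" using rtranclp_imp_relpowp by metis
  then obtain I where I: "I 0 = S" "I l = T" "\<And>i. i < l \<Longrightarrow> move (adj G) (pverts G) (I i) (I (Suc i))"
    unfolding relpowp_fun_conv by blast
  have S: "S \<subseteq> pverts G" "indep (adj G) S" using assms(1) unfolding independent_set_iff by auto
  have reach: "reach (adj G) (pverts G) S (I i)" if "i \<le> l" for i
    using that
  proof (induction i)
    case (Suc i)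
    then show ?case using I(3)[of i] by (auto intro: rtranclp.rtrancl_into_rtrancl)
  qed (use I in simp)
  have "independent_set G (I i) \<and> card (I i) = card S" if "i \<le> l" for i
    using reach_indep[OF reach[OF that] S(2,1)] reach_card[OF reach[OF that] assms(2)]
    unfolding independent_set_iff by blast
  moreover have "slide G (I i) (I (Suc i))" if "i < l" for i
    using I(3)[OF that] unfolding move_def slide_def by auto
  ultimately show "slidable G (card S) S T" unfolding slidable_def using I(1,2) by blast
qed

text \<open>Valid instances have vertices \<open>0, ..., m - 1\<close>, so a vertex becomes its
  position in the sorted list of \<open>X\<close>. This order is the one in which loops over the
  vertices emit the encoding.\<close>

definition sub_instance :: "nat set \<Rightarrow> (nat \<Rightarrow> nat \<Rightarrow> bool) \<Rightarrow> nat set \<Rightarrow> nat set \<Rightarrow> ts_instance" where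
  "sub_instance X E S T = (let xs = sorted_list_of_set X in
     \<lparr>ts_graph = \<lparr>pverts = {..<card X}, parcs = {(i, j). i < card X \<and> j < card X \<and> E (xs ! i) (xs ! j)}\<rparr>,
      ts_source = {i. i < card X \<and> xs ! i \<in> S}, ts_target = {i. i < card X \<and> xs ! i \<in> T}\<rparr>)"

lemma sub_instance_encode:
  assumes "finite X"
  defines "xs \<equiv> sorted_list_of_set X"
  shows "ts_encode (sub_instance X E S T) =
    card X # concat (map (\<lambda>u. map (\<lambda>v. of_bool (E u v)) xs) xs)
      @ map (\<lambda>v. of_bool (v \<in> S)) xs @ map (\<lambda>v. of_bool (v \<in> T)) xs"
proof -
  have len: "length xs = card X" by (simp add: xs_def)
  have m: "map (\<lambda>i. f (xs ! i)) [0..<card X] = map f xs" for f :: "nat \<Rightarrow> 'b"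
    unfolding len[symmetric] by (rule nth_equalityI) auto
  have "ts_encode (sub_instance X E S T) =
    card X # concat (map (\<lambda>i. map (\<lambda>j. of_bool (E (xs ! i) (xs ! j))) [0..<card X]) [0..<card X])
      @ map (\<lambda>i. of_bool (xs ! i \<in> S)) [0..<card X] @ map (\<lambda>i. of_bool (xs ! i \<in> T)) [0..<card X]"
    by (auto simp: ts_encode_def sub_instance_def Let_def xs_def intro!: arg_cong[of _ _ concat] map_cong)
  also have "\<dots> = card X # concat (map (\<lambda>u. map (\<lambda>v. of_bool (E u v)) xs) xs)
      @ map (\<lambda>v. of_bool (v \<in> S)) xs @ map (\<lambda>v. of_bool (v \<in> T)) xs"
    unfolding m[of "\<lambda>v. of_bool (v \<in> S)"] m[of "\<lambda>v. of_bool (v \<in> T)"]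
      m[of "\<lambda>u. map (\<lambda>j. of_bool (E u (xs ! j))) [0..<card X]"]
    by (simp add: m[of "\<lambda>v. of_bool (E _ v)"])
  finally show ?thesis .
qed

locale renumbering =
  fixes X :: "nat set" and E :: "nat \<Rightarrow> nat \<Rightarrow> bool" and side :: "nat \<Rightarrow> bool" and S T :: "nat set"
  assumes finX: "finite X" and bip_graph: "bip_c4_graph E side" and indS: "indep E (S \<inter> X)" and indT: "indep E (T \<inter> X)"
    and card_eq: "card (S \<inter> X) = card (T \<inter> X)" and ne: "S \<inter> X \<noteq> {}"
begin

sublocale bip_c4_graph E side by (rule bip_graph)

abbreviation "h \<equiv> (!) (sorted_list_of_set X)"
abbreviation "P \<equiv> sub_instance X E S T"

lemma h_bij: "bij_betw h {..<card X} X"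
  using bij_betw_nth[of "sorted_list_of_set X" "{..<card X}" X] finX by (simp add: lessThan_atLeast0)

lemma h_inj: "inj_on h {..<card X}" and h_image: "h ` {..<card X} = X"
  using h_bij by (auto simp: bij_betw_def)

lemma fields: "pverts (ts_graph P) = {..<card X}" "ts_source P = {i. i < card X \<and> h i \<in> S}"
  "ts_target P = {i. i < card X \<and> h i \<in> T}" "adj (ts_graph P) i j \<longleftrightarrow> i < card X \<and> j < card X \<and> E (h i) (h j)"
  by (auto simp: sub_instance_def Let_def)

lemma image_set: "h ` {i. i < card X \<and> h i \<in> H} = H \<inter> X"
  using h_image by auto

lemma card_set: "card {i. i < card X \<and> h i \<in> H} = card (H \<inter> X)"
proof -
  have "card (h ` {i. i < card X \<and> h i \<in> H}) = card {i. i < card X \<and> h i \<in> H}"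
    by (rule card_image) (rule inj_on_subset[OF h_inj], auto)
  then show ?thesis using image_set by simp
qed

lemma indep_sub: "indep E (H \<inter> X) \<Longrightarrow> independent_set (ts_graph P) {i. i < card X \<and> h i \<in> H}"
  unfolding independent_set_iff indep_def fields using h_image by auto

lemma valid: "ts_valid P"
proof -
  have "pair_graph (ts_graph P)"
  proof
    show "finite (pverts (ts_graph P))" by (simp add: fields)
    have "parcs (ts_graph P) \<subseteq> {..<card X} \<times> {..<card X}" using fields(4) by auto
    then show "finite (parcs (ts_graph P))" by (rule finite_subset) simp
    show "symmetric (with_proj (ts_graph P))"
      unfolding symmetric_def by (rule symI) (use sym in \<open>auto simp: fields(4)\<close>)
    fix e assume "e \<in> parcs (ts_graph P)"
    then show "fst e \<in> pverts (ts_graph P)" "snd e \<in> pverts (ts_graph P)" "fst e \<noteq> snd e"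
      using irrefl by (cases e; force simp: fields)+
  qed
  moreover have "card (S \<inter> X) \<ge> 1" using ne finX by (simp add: Suc_le_eq card_gt_0_iff)
  ultimately show ?thesis
    unfolding ts_valid_def using indep_sub indS indT card_eq by (simp add: fields card_set)
qed

lemma graph_class: "bipartite (ts_graph P) \<and> C4_free (ts_graph P)"
proof
  let ?A = "{i\<in>{..<card X}. side (h i)}" and ?B = "{i\<in>{..<card X}. \<not> side (h i)}"
  have "parcs (ts_graph P) \<subseteq> ?A \<times> ?B \<union> ?B \<times> ?A" using fields(4) opp by force
  then show "bipartite (ts_graph P)" unfolding bipartite_def fields(1)
    by (intro exI[of _ ?A] exI[of _ ?B]) auto
  show "C4_free (ts_graph P)" unfolding C4_free_def
  proof
    assume "\<exists>a b c d. distinct [a, b, c, d] \<and> {a, b, c, d} \<subseteq> pverts (ts_graph P) \<and>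
      adj (ts_graph P) a b \<and> adj (ts_graph P) b c \<and> adj (ts_graph P) c d \<and> adj (ts_graph P) d a \<and>
      \<not> adj (ts_graph P) a c \<and> \<not> adj (ts_graph P) b d"
    then obtain a b c d where d: "distinct [a, b, c, d]" "E (h a) (h b)" "E (h b) (h c)" "E (h c) (h d)" "E (h d) (h a)"
      and lt: "a < card X" "b < card X" "c < card X" "d < card X" unfolding fields by auto
    have "h a = h c \<or> h b = h d" using c4[OF d(2-5)] .
    then have "a = c \<or> b = d" using h_inj lt by (auto dest: inj_onD)
    then show False using d(1) by auto
  qed
qed

lemma yes_iff: "ts_yes P \<longleftrightarrow> reach E X (S \<inter> X) (T \<inter> X)"
proof -
  have "ts_yes P \<longleftrightarrow> reach (adj (ts_graph P)) {..<card X} (ts_source P) (ts_target P)"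
    unfolding ts_yes_def ts_param_def
    by (subst slidable_reach) (use indep_sub[OF indS] in \<open>simp_all add: fields\<close>)
  also have "\<dots> \<longleftrightarrow> reach E (h ` {..<card X}) (h ` ts_source P) (h ` ts_target P)"
    by (rule reach_iso) (use h_inj in \<open>auto simp: fields embeds_def\<close>)
  finally show ?thesis by (simp add: h_image fields image_set)
qed

end

section \<open>The kernel and its correctness\<close>

definition ts_removed :: "ts_instance \<Rightarrow> nat set" where
  "ts_removed P = rigid_core (adj (ts_graph P)) (pverts (ts_graph P)) (ts_source P)"

definition ts_unblocked :: "ts_instance \<Rightarrow> nat set" where
  "ts_unblocked P = pverts (ts_graph P) - ts_removed P - {v. \<exists>u\<in>ts_removed P. adj (ts_graph P) u v}"

definition ts_trimmed :: "ts_instance \<Rightarrow> nat set" where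
  "ts_trimmed P = trim (adj (ts_graph P)) (ts_unblocked P) (ts_source P \<union> ts_target P)"

definition ts_component :: "ts_instance \<Rightarrow> nat \<Rightarrow> nat set" where
  "ts_component P = component_of (adj (ts_graph P)) (ts_trimmed P)"

definition ts_refuted :: "ts_instance \<Rightarrow> bool" where
  "ts_refuted P \<longleftrightarrow> rigid_core (adj (ts_graph P)) (pverts (ts_graph P)) (ts_target P) \<noteq> ts_removed P \<or>
     (\<exists>v\<in>ts_trimmed P. card (ts_source P \<inter> ts_component P v) \<noteq> card (ts_target P \<inter> ts_component P v))"

definition ts_kept :: "ts_instance \<Rightarrow> nat set" where
  "ts_kept P = {v\<in>ts_trimmed P. ts_source P \<inter> ts_component P v \<noteq> {} \<and> card (ts_component P v) \<le> size_bound (ts_param P)}"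

text \<open>A valid instance needs a token, so decided cases get explicit small instances: two
  isolated vertices with the token on the wrong one, or a single vertex. They are the reason for the
  additive 2 in the size bound.\<close>

definition ts_kernel :: "ts_instance \<Rightarrow> ts_instance" where
  "ts_kernel P = (if ts_refuted P then sub_instance {0, 1} (\<lambda>_ _. False) {0} {1}
     else if ts_source P \<inter> ts_kept P = {} then sub_instance {0} (\<lambda>_ _. False) {0} {0}
     else sub_instance (ts_kept P) (adj (ts_graph P)) (ts_source P) (ts_target P))"

locale ts_input =
  fixes P :: ts_instance
  assumes valid: "ts_valid P" and bipartite: "bipartite (ts_graph P)" and C4_free: "C4_free (ts_graph P)"
begin

abbreviation "k \<equiv> ts_param P"
abbreviation "V \<equiv> pverts (ts_graph P)"
abbreviation "E \<equiv> adj (ts_graph P)"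
abbreviation "S \<equiv> ts_source P"
abbreviation "T \<equiv> ts_target P"

lemma fin: "finite V"
  using valid unfolding ts_valid_def by (metis finite_lessThan)

lemma indepS: "indep E S" "S \<subseteq> V" and indepT: "indep E T" "T \<subseteq> V"
  using valid unfolding ts_valid_def independent_set_iff by auto

lemma cards: "card T = card S" "card S = k" "k \<ge> 1"
  using valid unfolding ts_valid_def ts_param_def by auto

lemma edge_V: "E u v \<Longrightarrow> u \<in> V \<and> v \<in> V"
proof -
  assume "E u v"
  interpret pair_graph "ts_graph P" using valid unfolding ts_valid_def by blast
  show ?thesis using in_arcsD1[OF \<open>E u v\<close>] in_arcsD2[OF \<open>E u v\<close>] by blast
qed

lemma bip_c4_nat: "\<exists>side. bip_c4_nat E side"
proof -
  obtain A B where AB: "A \<union> B = V" "A \<inter> B = {}" "parcs (ts_graph P) \<subseteq> (A \<times> B) \<union> (B \<times> A)"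
    using bipartite unfolding bipartite_def by blast
  interpret pair_graph "ts_graph P" using valid unfolding ts_valid_def by blast
  have s: "E v u" if "E u v" for u v
    using pair_sym_arcs that unfolding symmetric_def by (auto dest: symD)
  have opp: "u \<in> A \<longleftrightarrow> v \<notin> A" if "E u v" for u v using AB that by auto
  have "bip_c4_nat E (\<lambda>v. v \<in> A)"
  proof
    show "E u v \<Longrightarrow> E v u" for u v by (rule s)
    show "E u v \<Longrightarrow> (u \<in> A) \<noteq> (v \<in> A)" for u v using opp by blast
    fix a b c d assume e: "E a b" "E b c" "E c d" "E d a"
    show "a = c \<or> b = d"
    proof (rule ccontr)
      assume ne: "\<not> (a = c \<or> b = d)"
      have "distinct [a, b, c, d]" using ne e opp by auto
      \<comment> \<open>Opposite vertices of a 4-cycle lie on the same side, so in a bipartite graph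
        every 4-cycle is induced.\<close>
      moreover have "\<not> E a c" "\<not> E b d" using e opp by blast+
      moreover have "{a, b, c, d} \<subseteq> V" using e edge_V by blast
      ultimately show False using C4_free e unfolding C4_free_def by blast
    qed
  qed
  then show ?thesis by blast
qed

lemma renumbering_trivial:
  "renumbering {0, 1} (\<lambda>_ _. False) (\<lambda>_. True) {0} {1}" "renumbering {0} (\<lambda>_ _. False) (\<lambda>_. True) {0} {0}"
  by (unfold_locales; simp add: indep_def)+

lemma not_reach_empty: "\<not> reach (\<lambda>_ _. False) X {0} {Suc 0}"
proof
  assume "reach (\<lambda>_ _. False) X {0} {Suc 0}"
  then have "{Suc 0} = ({0} :: nat set)"
    by (induction rule: rtranclp_induct) (auto simp: move_def)
  then show False by simp
qed

theorem ts_kernel_correct: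
  "ts_kernel P \<in> ts_instances_on (\<lambda>G. bipartite G \<and> C4_free G)"
  "ts_yes (ts_kernel P) \<longleftrightarrow> ts_yes P"
  "card (pverts (ts_graph (ts_kernel P))) \<le> k * size_bound k + 2"
proof -
  obtain side where "bip_c4_nat E side" using bip_c4_nat by blast
  then interpret bip_c4_nat E side .
  let ?R = "ts_removed P" and ?K = "S \<union> T" and ?V = "ts_trimmed P" and ?X = "ts_kept P"
  let ?S = "S - ?R" and ?T = "T - ?R"
  have finST: "finite S" "finite T" using fin indepS(2) indepT(2) finite_subset by auto
  have yes: "ts_yes P \<longleftrightarrow> reach E V S T"
    unfolding ts_yes_def cards(2)[symmetric]
    by (rule slidable_reach) (use indepS finST in \<open>auto simp: independent_set_iff\<close>)
  also have "\<dots> \<longleftrightarrow> rigid_core E V T = ?R \<and> reach E (ts_unblocked P) ?S ?T"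
    unfolding ts_removed_def ts_unblocked_def by (rule rigid_core_reach[OF indepS indepT])
  finally have 1: "ts_yes P \<longleftrightarrow> rigid_core E V T = ?R \<and> reach E (ts_unblocked P) ?S ?T" .
  have comp_V: "ts_component P v \<subseteq> ?V" for v unfolding ts_component_def component_of_def by blast
  have VU: "?V \<subseteq> ts_unblocked P" unfolding ts_trimmed_def by (rule trim_subset)
  then have VR: "?V \<inter> ?R = {}" unfolding ts_unblocked_def by blast
  then have compR: "S \<inter> ts_component P v = ?S \<inter> ts_component P v" "T \<inter> ts_component P v = ?T \<inter> ts_component P v" for v
    using comp_V[of v] by blast+
  have XR: "S \<inter> ?X = ?S \<inter> ?X" "T \<inter> ?X = ?T \<inter> ?X" using VR unfolding ts_kept_def by blast+
  have finX: "finite ?X" and finV: "finite ?V"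
    using fin VU unfolding ts_kept_def ts_unblocked_def by (auto intro: finite_subset)
  \<comment> \<open>All later sets are built from the rigid core of the source. Only when the target
    has the same core are its remaining tokens loose in the same graph.\<close>
  have X_small: "card ?X \<le> k * size_bound k"
    and X_card: "\<not> ts_refuted P \<Longrightarrow> card (S \<inter> ?X) = card (T \<inter> ?X)"
    and X_reach: "ts_yes P \<longleftrightarrow> \<not> ts_refuted P \<and> reach E ?X (S \<inter> ?X) (T \<inter> ?X)"
    if eq: "rigid_core E V T = ?R"
  proof -
    have S': "loose E (ts_unblocked P) ?S" "?S \<subseteq> ts_unblocked P" "indep E ?S"
      using rigid_core_loose[OF indepS] rigid_core_inside[OF indepS rigid_core_subset[of E V S]] indepS(1)
      unfolding ts_removed_def ts_unblocked_def by (simp_all add: indep_def)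
    have T': "loose E (ts_unblocked P) ?T" "?T \<subseteq> ts_unblocked P" "indep E ?T"
      using rigid_core_loose[OF indepT] rigid_core_inside[OF indepT rigid_core_subset[of E V T]] indepT(1)
      unfolding eq ts_unblocked_def by (simp_all add: indep_def)
    have RS: "?R \<subseteq> S" "?R \<subseteq> T" using rigid_core_subset[of E V S] rigid_core_subset[of E V T] eq
      unfolding ts_removed_def by auto
    have SV: "?S \<subseteq> ?V" "?T \<subseteq> ?V" using S' T' unfolding ts_trimmed_def trim_def by auto
    have c: "card ?S = card ?T" "card ?S \<le> k"
      using RS finST cards card_mono[OF finST(1), of ?S] by (simp_all add: card_Diff_subset finite_subset)
    have finU: "finite (ts_unblocked P)" using fin unfolding ts_unblocked_def by simp
    have cK: "card ?K \<le> 2 * k" using card_Un_le[of S T] cards by simp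
    have bad: "card {y\<in>?V. E v y \<and> \<not> inner_nb E ?V v y} \<le> 2 * k + 1" if "v \<in> ?V" for v
    proof -
      have "card {y\<in>?V. E v y \<and> \<not> inner_nb E ?V v y} \<le> card ?K + 1"
        unfolding ts_trimmed_def by (rule trim_bad) (use finU finST that in \<open>auto simp: ts_trimmed_def\<close>)
      then show ?thesis using cK by linarith
    qed
    have 2: "reach E (ts_unblocked P) ?S ?T \<longleftrightarrow> reach E ?V ?S ?T"
      unfolding ts_trimmed_def by (rule trim_reach) (use S' T' finST in auto)
    have loose: "loose E ?V ?S" "loose E ?V ?T"
      unfolding ts_trimmed_def by (rule trim_loose; use S' T' in auto)+
    have X: "?X = {v\<in>?V. ?S \<inter> component_of E ?V v \<noteq> {} \<and> card (component_of E ?V v) \<le> size_bound k}"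
      unfolding ts_kept_def ts_component_def compR[unfolded ts_component_def] ..
    note comps = comps_reach[OF finV SV(1) loose(1) S'(3) SV(2) loose(2) T'(3) c cards(3) bad, folded X]
    have ref: "ts_refuted P \<longleftrightarrow> \<not> (\<forall>v\<in>?V. card (?S \<inter> component_of E ?V v) = card (?T \<inter> component_of E ?V v))"
      unfolding ts_refuted_def eq ts_component_def compR[unfolded ts_component_def] by simp
    show "card ?X \<le> k * size_bound k" by (rule comps(3))
    show "\<not> ts_refuted P \<Longrightarrow> card (S \<inter> ?X) = card (T \<inter> ?X)" using comps(2) ref XR by simp
    show "ts_yes P \<longleftrightarrow> \<not> ts_refuted P \<and> reach E ?X (S \<inter> ?X) (T \<inter> ?X)"
      using 1 2 comps(1) eq ref XR by simp
  qed
  have ref1: "\<not> ts_yes P" if "ts_refuted P"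
    using X_reach 1 that by blast
  have unref: "rigid_core E V T = ?R" if "\<not> ts_refuted P" using that unfolding ts_refuted_def by blast
  let ?C = "\<lambda>G. bipartite G \<and> C4_free G"
  have "ts_kernel P \<in> ts_instances_on ?C \<and> (ts_yes (ts_kernel P) \<longleftrightarrow> ts_yes P) \<and>
    card (pverts (ts_graph (ts_kernel P))) \<le> k * size_bound k + 2"
  proof -
    consider (no) "ts_refuted P" | (yes) "\<not> ts_refuted P" "S \<inter> ?X = {}" | (rest) "\<not> ts_refuted P" "S \<inter> ?X \<noteq> {}" by blast
    then show ?thesis
    proof cases
      case no
      interpret K: renumbering "{0, 1}" "\<lambda>_ _. False" "\<lambda>_. True" "{0}" "{1}" by (rule renumbering_trivial)
      have e: "ts_kernel P = sub_instance {0, 1} (\<lambda>_ _. False) {0} {1}" using no by (simp add: ts_kernel_def)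
      have "\<not> ts_yes (ts_kernel P)" unfolding e K.yes_iff using not_reach_empty by simp
      moreover have "card (pverts (ts_graph (ts_kernel P))) = 2" unfolding e K.fields by simp
      ultimately show ?thesis unfolding ts_instances_on_def
        using K.valid K.graph_class ref1[OF no] by (simp add: e)
    next
      case yes
      interpret K: renumbering "{0}" "\<lambda>_ _. False" "\<lambda>_. True" "{0}" "{0}" by (rule renumbering_trivial)
      have e: "ts_kernel P = sub_instance {0} (\<lambda>_ _. False) {0} {0}" using yes by (simp add: ts_kernel_def)
      have "card (T \<inter> ?X) = 0" using X_card[OF unref] yes by simp
      then have "T \<inter> ?X = {}" using finX by simp
      then have "ts_yes P" using X_reach[OF unref] yes by simp
      moreover have "ts_yes (ts_kernel P)" unfolding e K.yes_iff by simp
      moreover have "card (pverts (ts_graph (ts_kernel P))) = 1" unfolding e K.fields by simp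
      ultimately show ?thesis unfolding ts_instances_on_def
        using K.valid K.graph_class by (simp add: e)
    next
      case rest
      interpret K: renumbering ?X E side S T
        by unfold_locales (use finX rest X_card[OF unref] indepS(1) indepT(1) c4 in \<open>auto simp: indep_def\<close>)
      have e: "ts_kernel P = sub_instance ?X E S T" using rest by (simp add: ts_kernel_def)
      have "ts_yes (ts_kernel P) \<longleftrightarrow> ts_yes P" unfolding e K.yes_iff X_reach[OF unref[OF rest(1)]] using rest by blast
      moreover have "card (pverts (ts_graph (ts_kernel P))) = card ?X" unfolding e K.fields by simp
      ultimately show ?thesis unfolding ts_instances_on_def
        using K.valid K.graph_class X_small[OF unref[OF rest(1)]] by (simp add: e)
    qed
  qed
  then show "ts_kernel P \<in> ts_instances_on ?C" "ts_yes (ts_kernel P) \<longleftrightarrow> ts_yes P"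
    "card (pverts (ts_graph (ts_kernel P))) \<le> k * size_bound k + 2" by auto
qed

end


section \<open>The kernelization program\<close>

declare One_nat_def [simp del]

definition holds_at :: "expr \<Rightarrow> nat \<Rightarrow> (nat \<Rightarrow> nat) \<Rightarrow> (nat \<Rightarrow> nat \<Rightarrow> nat) \<Rightarrow> bool" where
  "holds_at e n \<sigma> A \<longleftrightarrow> 0 < val e n \<sigma> A"

definition eNot :: "expr \<Rightarrow> expr" where "eNot e = Lt e (Num 1)"
definition eAnd :: "expr \<Rightarrow> expr \<Rightarrow> expr" where "eAnd a b = Ite a b (Num 0)"
definition eOr :: "expr \<Rightarrow> expr \<Rightarrow> expr" where "eOr a b = Ite a (Num 1) b"
definition eEq :: "expr \<Rightarrow> expr \<Rightarrow> expr" where "eEq a b = eAnd (eNot (Lt a b)) (eNot (Lt b a))"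
definition eEx :: "nat \<Rightarrow> expr \<Rightarrow> expr" where "eEx x e = Lt (Num 0) (Sum x e)"
definition eAll :: "nat \<Rightarrow> expr \<Rightarrow> expr" where "eAll x e = eNot (eEx x (eNot e))"
definition eBool :: "expr \<Rightarrow> expr" where "eBool e = Ite e (Num 1) (Num 0)"
definition eCount :: "nat \<Rightarrow> expr \<Rightarrow> expr" where "eCount x e = Sum x (eBool e)"

lemma sum_pos_iff: "0 < (\<Sum>v<n. f v) \<longleftrightarrow> (\<exists>v<n. 0 < f v)" for f :: "nat \<Rightarrow> nat"
  unfolding neq0_conv[symmetric] by auto

lemma holds_at_simps [simp]:
  "holds_at (eNot a) n \<sigma> A \<longleftrightarrow> \<not> holds_at a n \<sigma> A"
  "holds_at (eAnd a b) n \<sigma> A \<longleftrightarrow> holds_at a n \<sigma> A \<and> holds_at b n \<sigma> A"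
  "holds_at (eOr a b) n \<sigma> A \<longleftrightarrow> holds_at a n \<sigma> A \<or> holds_at b n \<sigma> A"
  "holds_at (eEq a b) n \<sigma> A \<longleftrightarrow> val a n \<sigma> A = val b n \<sigma> A"
  "holds_at (Lt a b) n \<sigma> A \<longleftrightarrow> val a n \<sigma> A < val b n \<sigma> A"
  "holds_at (Ite a b c) n \<sigma> A \<longleftrightarrow> (if holds_at a n \<sigma> A then holds_at b n \<sigma> A else holds_at c n \<sigma> A)"
  "holds_at (eEx x a) n \<sigma> A \<longleftrightarrow> (\<exists>v<n. holds_at a n (\<sigma>(x := v)) A)"
  "holds_at (eAll x a) n \<sigma> A \<longleftrightarrow> (\<forall>v<n. holds_at a n (\<sigma>(x := v)) A)"
  by (auto simp: holds_at_def eNot_def eAnd_def eOr_def eEq_def eEx_def eAll_def sum_pos_iff)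

lemma val_eBool [simp]: "val (eBool a) n \<sigma> A = of_bool (holds_at a n \<sigma> A)"
  by (simp add: eBool_def holds_at_def)

lemma val_eCount [simp]: "val (eCount x a) n \<sigma> A = card {v. v < n \<and> holds_at a n (\<sigma>(x := v)) A}"
proof -
  have "val (eCount x a) n \<sigma> A = card ({..<n} \<inter> {v. holds_at a n (\<sigma>(x := v)) A})"
    by (simp add: eCount_def sum.If_cases of_bool_def)
  also have "{..<n} \<inter> {v. holds_at a n (\<sigma>(x := v)) A} = {v. v < n \<and> holds_at a n (\<sigma>(x := v)) A}" by auto
  finally show ?thesis .
qed

definition row :: "nat \<Rightarrow> (nat \<Rightarrow> nat \<Rightarrow> nat) \<Rightarrow> nat \<Rightarrow> nat \<Rightarrow> nat set" where
  "row n A a u = {v. v < n \<and> 0 < A a (u * n + v)}"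

definition eMem :: "nat \<Rightarrow> expr \<Rightarrow> expr" where "eMem a v = Arr a v"
text \<open>\<open>Arr 2 u\<close> looks up the offset \<open>u * n\<close> of row
  \<open>u\<close>.\<close>

definition eRow :: "nat \<Rightarrow> expr \<Rightarrow> expr \<Rightarrow> expr" where "eRow a u v = Arr a (Plus (Arr 2 u) v)"

definition offsets :: "nat \<Rightarrow> (nat \<Rightarrow> nat \<Rightarrow> nat) \<Rightarrow> bool" where
  "offsets n A \<longleftrightarrow> (\<forall>u\<le>n. A 2 u = u * n)"

lemma holds_at_eMem [simp]: "val v n \<sigma> A < n \<Longrightarrow> holds_at (eMem a v) n \<sigma> A \<longleftrightarrow> val v n \<sigma> A \<in> row n A a 0"
  by (simp add: holds_at_def eMem_def row_def)

lemma holds_at_eRow [simp]: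
  "offsets n A \<Longrightarrow> val u n \<sigma> A < n \<Longrightarrow> val v n \<sigma> A < n \<Longrightarrow>
    holds_at (eRow a u v) n \<sigma> A \<longleftrightarrow> val v n \<sigma> A \<in> row n A a (val u n \<sigma> A)"
  by (simp add: holds_at_def eRow_def row_def offsets_def)

abbreviation env2 :: "nat \<Rightarrow> nat \<Rightarrow> nat \<Rightarrow> nat" where
  "env2 u v \<equiv> (\<lambda>_. 0)(0 := u, 1 := v)"

lemma row_def_sem:
  assumes "u < n"
  shows "row n (fst (def_sem a e n D)) a u = {v. v < n \<and> holds_at e n (env2 u v) (fst D)}"
  using assms by (auto simp: row_def def_sem_def holds_at_def env_index index_less)

lemma def_sem_other: "b \<noteq> a \<Longrightarrow> fst (def_sem a e n D) b = fst D b" "snd (def_sem a e n D) = snd D"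
  by (auto simp: def_sem_def)

lemma row_cong: "A a = B a \<Longrightarrow> row n A a u = row n B a u"
  by (simp add: row_def)

text \<open>Array 4 buffers the new contents, so that all entries are updated simultaneously.\<close>

definition step_sem :: "nat \<Rightarrow> expr \<Rightarrow> nat \<Rightarrow> memory \<Rightarrow> memory" where
  "step_sem a e n D = def_sem a (eRow 4 (Var 0) (Var 1)) n (def_sem 4 e n D)"

definition iter_cmd :: "nat \<Rightarrow> expr \<Rightarrow> com" where
  "iter_cmd a e = repeat_cmd (Seq (def_cmd 4 e) (def_cmd a (eRow 4 (Var 0) (Var 1))))"

definition iter_sem :: "nat \<Rightarrow> expr \<Rightarrow> nat \<Rightarrow> memory \<Rightarrow> memory" where
  "iter_sem a e n = step_sem a e n ^^ n"

lemma implements_iter: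
  assumes "a \<noteq> 1" "a \<noteq> 2" "a \<noteq> 4" "4 \<notin> reads e" "1 \<notin> reads e"
  shows "implements {0} (iter_cmd a e) (iter_sem a e)"
proof -
  have "implements UNIV (Seq (def_cmd 4 e) (def_cmd a (eRow 4 (Var 0) (Var 1)))) (step_sem a e)"
    unfolding step_sem_def[abs_def]
    by (intro implements_seq implements_def_cmd) (use assms in \<open>auto simp: eRow_def\<close>)
  then show ?thesis unfolding iter_cmd_def iter_sem_def[abs_def] by (rule implements_repeat)
qed

lemma iter_sem_other:
  assumes "b \<noteq> a" "b \<noteq> 4"
  shows "fst (iter_sem a e n D) b = fst D b" "snd (iter_sem a e n D) = snd D"
proof -
  have "fst ((step_sem a e n ^^ i) D) b = fst D b \<and> snd ((step_sem a e n ^^ i) D) = snd D" for i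
    by (induction i) (use assms in \<open>auto simp: step_sem_def def_sem_other\<close>)
  then show "fst (iter_sem a e n D) b = fst D b" "snd (iter_sem a e n D) = snd D"
    by (auto simp: iter_sem_def)
qed

text \<open>The premise on \<open>f\<close> says that a new row depends only on the same row of the
  old matrix. Rows therefore evolve independently, and one repeated command can carry out a search
  from every vertex in parallel.\<close>

lemma row_iter_sem:
  assumes off: "offsets n (fst D)" and u: "u < n" and a: "a \<noteq> 2" "a \<noteq> 4"
    and step: "\<And>A. (\<And>b. b \<noteq> a \<Longrightarrow> b \<noteq> 4 \<Longrightarrow> A b = fst D b) \<Longrightarrow>
      {v. v < n \<and> holds_at e n (env2 u v) A} = f (row n A a u)"
  shows "row n (fst (iter_sem a e n D)) a u = (f ^^ n) (row n (fst D) a u)"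
proof -
  have "row n (fst ((step_sem a e n ^^ i) D)) a u = (f ^^ i) (row n (fst D) a u) \<and>
    (\<forall>b. b \<noteq> a \<longrightarrow> b \<noteq> 4 \<longrightarrow> fst ((step_sem a e n ^^ i) D) b = fst D b)" for i
  proof (induction i)
    case (Suc i)
    let ?D = "(step_sem a e n ^^ i) D"
    let ?D' = "def_sem 4 e n ?D"
    have off': "offsets n (fst ?D')" using off Suc a by (auto simp: offsets_def def_sem_other)
    have "row n (fst (step_sem a e n ?D)) a u = {v. v < n \<and> v \<in> row n (fst ?D') 4 u}"
      unfolding step_sem_def[of a e n ?D] row_def_sem[OF u, of a]
      by (rule Collect_cong) (use off' u in auto)
    also have "\<dots> = row n (fst ?D') 4 u" by (auto simp: row_def)
    also have "\<dots> = f (row n (fst ?D) a u)" unfolding row_def_sem[OF u] by (rule step) (use Suc in auto)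
    finally have "row n (fst (step_sem a e n ?D)) a u = (f ^^ Suc i) (row n (fst D) a u)" using Suc by simp
    moreover have "fst (step_sem a e n ?D) b = fst D b" if "b \<noteq> a" "b \<noteq> 4" for b
      using that Suc by (simp add: step_sem_def[of a e n ?D] def_sem_other)
    ultimately show ?case by simp
  qed simp
  then show ?thesis by (simp add: iter_sem_def)
qed

text \<open>Positions in the encoded input: the 1 skips the vertex count, \<open>Arr 2 Size\<close>
  is the size \<open>n * n\<close> of the adjacency matrix, and the vectors of source and target
  follow. The table in array 2 must therefore extend to index \<open>n\<close>.\<close>

definition eE :: "expr \<Rightarrow> expr \<Rightarrow> expr" where "eE u v = Arr 0 (Plus (Num 1) (Plus (Arr 2 u) v))"
definition eS :: "expr \<Rightarrow> expr" where "eS v = Arr 0 (Plus (Num 1) (Plus (Arr 2 Size) v))"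
definition eT :: "expr \<Rightarrow> expr" where "eT v = Arr 0 (Plus (Num 1) (Plus (Arr 2 Size) (Plus Size v)))"

definition shrink_expr :: "nat \<Rightarrow> expr" where
  "shrink_expr a = eAnd (eMem a (Var 1)) (eAll 2 (eOr (eNot (eE (Var 1) (Var 2)))
     (eEx 3 (eAnd (eMem a (Var 3)) (eAnd (eNot (eEq (Var 3) (Var 1))) (eE (Var 2) (Var 3)))))))"

definition unblocked_expr :: expr where
  "unblocked_expr = eAnd (eNot (eMem 3 (Var 1))) (eNot (eEx 2 (eAnd (eMem 3 (Var 2)) (eE (Var 2) (Var 1)))))"

definition leaf_expr :: "expr \<Rightarrow> expr" where
  "leaf_expr v = eAnd (eMem 6 v) (eAnd (eMem 6 (Var 2)) (eAnd (eE v (Var 2))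
     (eAll 4 (eOr (eNot (eAnd (eMem 6 (Var 4)) (eE v (Var 4)))) (eEq (Var 4) (Var 2))))))"

definition trimmed_expr :: expr where
  "trimmed_expr = eAnd (eMem 6 (Var 1)) (eOr (eOr (eS (Var 1)) (eT (Var 1)))
     (eNot (eEx 2 (eAnd (leaf_expr (Var 1)) (eEx 3 (eAnd (Lt (Var 3) (Var 1)) (leaf_expr (Var 3))))))))"

definition grow_expr :: expr where
  "grow_expr = eOr (eRow 8 (Var 0) (Var 1)) (eAnd (eMem 7 (Var 1))
     (eEx 2 (eAnd (eRow 8 (Var 0) (Var 2)) (eE (Var 2) (Var 1)))))"

definition refuted_expr :: expr where
  "refuted_expr = eOr (eEx 2 (eNot (eEq (eBool (eMem 3 (Var 2))) (eBool (eMem 5 (Var 2))))))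
     (eEx 2 (eAnd (eMem 7 (Var 2)) (eNot (eEq (eCount 3 (eAnd (eS (Var 3)) (eRow 8 (Var 2) (Var 3))))
        (eCount 3 (eAnd (eT (Var 3)) (eRow 8 (Var 2) (Var 3))))))))"

text \<open>Multiplication by the number of tokens, as a sum over the vertices below that
  number.\<close>

definition times_k :: "expr \<Rightarrow> expr" where
  "times_k e = Sum 3 (Ite (Lt (Var 3) (eCount 4 (eS (Var 4)))) e (Num 0))"

definition kept_expr :: expr where
  "kept_expr = eAnd (eMem 7 (Var 1)) (eAnd (eEx 2 (eAnd (eS (Var 2)) (eRow 8 (Var 1) (Var 2))))
     (eNot (Lt ((times_k ^^ 9) (Num 2560)) (eCount 2 (eRow 8 (Var 1) (Var 2))))))"

definition trivial_expr :: expr where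
  "trivial_expr = eNot (eEx 2 (eAnd (eS (Var 2)) (eMem 10 (Var 2))))"

definition choose_expr :: "expr \<Rightarrow> expr \<Rightarrow> expr \<Rightarrow> expr" where
  "choose_expr e1 e2 e3 = Ite (eMem 9 (Var 1)) e1 (Ite (eMem 11 (Var 1)) e2 e3)"

text \<open>Expressions are evaluated with \<open>Var 0\<close> and \<open>Var 1\<close> as row and column of an \<open>n \<times> n\<close> matrix. Sets of
  vertices are stored in row 0, flags as matrices with constant rows.\<close>

datatype instr = Define nat expr | Iterate nat expr | Emit expr expr

primrec instr_cmd :: "instr \<Rightarrow> com" where
  "instr_cmd (Define a e) = def_cmd a e"
| "instr_cmd (Iterate a e) = iter_cmd a e"
| "instr_cmd (Emit b e) = emit_cmd b e"

primrec instr_sem :: "instr \<Rightarrow> nat \<Rightarrow> memory \<Rightarrow> memory" where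
  "instr_sem (Define a e) = def_sem a e"
| "instr_sem (Iterate a e) = iter_sem a e"
| "instr_sem (Emit b e) = emit_sem b e"

primrec instr_ok :: "instr \<Rightarrow> bool" where
  "instr_ok (Define a e) \<longleftrightarrow> a \<notin> {1, 2} \<and> reads e \<inter> {1, a} = {}"
| "instr_ok (Iterate a e) \<longleftrightarrow> a \<notin> {1, 2, 4} \<and> reads e \<inter> {1, 4} = {}"
| "instr_ok (Emit b e) \<longleftrightarrow> 1 \<notin> reads b \<union> reads e"

definition program_cmd :: "instr list \<Rightarrow> com" where
  "program_cmd is = foldr (\<lambda>i. Seq (instr_cmd i)) is Skip"

definition program_sem :: "instr list \<Rightarrow> nat \<Rightarrow> memory \<Rightarrow> memory" where
  "program_sem is n = fold (\<lambda>i. instr_sem i n) is"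

lemma implements_program:
  assumes "\<forall>i\<in>set is. instr_ok i" shows "implements {0} (program_cmd is) (program_sem is)"
  using assms
proof (induction "is")
  case Nil
  have "runs Skip s (poly [:1:] n) (holds n j D)" if "holds n j D s" for n j D s
    by (rule runs_mono[OF runs_Skip[of "holds n j D"]]) (use that in auto)
  then show ?case unfolding implements_def program_cmd_def program_sem_def by (intro exI[of _ "[:1:]"]) simp
next
  case (Cons i "is")
  have "implements {0} (instr_cmd i) (instr_sem i)"
  proof (cases i)
    case (Define a e)
    have "implements UNIV (def_cmd a e) (def_sem a e)"
      by (rule implements_def_cmd) (use Cons.prems Define in auto)
    then show ?thesis unfolding Define instr_cmd.simps instr_sem.simps by (rule implements_weaken) simp
  next
    case (Iterate a e)
    have "implements {0} (iter_cmd a e) (iter_sem a e)"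
      by (rule implements_iter) (use Cons.prems Iterate in auto)
    then show ?thesis unfolding Iterate by simp
  next
    case (Emit b e)
    have "implements UNIV (emit_cmd b e) (emit_sem b e)"
      by (rule implements_emit_cmd) (use Cons.prems Emit in auto)
    then show ?thesis unfolding Emit instr_cmd.simps instr_sem.simps by (rule implements_weaken) simp
  qed
  moreover have "implements {0} (program_cmd is) (program_sem is)" using Cons by simp
  ultimately have "implements {0} (Seq (instr_cmd i) (program_cmd is)) (\<lambda>n D. program_sem is n (instr_sem i n D))"
    by (rule implements_seq)
  then show ?case by (simp add: program_cmd_def program_sem_def o_def)
qed

text \<open>Array 3 receives the rigid tokens of the source and array 5 those of the target, array 6 the vertices
  remaining after the deletion of the rigid tokens and array 7 those remaining after the deletion of
  leaves, row \<open>u\<close> of array 8 the component of \<open>u\<close>. Arrays 9 and 11 are the flags for trivial no- and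
  yes-instances, array 10 holds the small components, array 12 the vertices of the output.\<close>

definition prepare_program :: "instr list" where
  "prepare_program =
    [Define 3 (eS (Var 1)), Iterate 3 (shrink_expr 3), Define 5 (eT (Var 1)), Iterate 5 (shrink_expr 5),
     Define 6 unblocked_expr, Define 7 trimmed_expr,
     Define 8 (eAnd (eMem 7 (Var 1)) (eEq (Var 0) (Var 1))), Iterate 8 grow_expr,
     Define 9 refuted_expr, Define 10 kept_expr, Define 11 trivial_expr,
     Define 12 (choose_expr (Lt (Var 1) (Num 2)) (Lt (Var 1) (Num 1)) (eMem 10 (Var 1)))]"

text \<open>The four commands produce the four parts of \<open>ts_encode\<close> in order. Requiring
  \<open>Var 0\<close> to be 0 reduces the double loop to a single row.\<close>

definition output_program :: "instr list" where
  "output_program =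
    [Emit (eAnd (eEq (Var 0) (Num 0)) (eEq (Var 1) (Num 0))) (eCount 2 (eMem 12 (Var 2))),
     Emit (eAnd (eMem 12 (Var 0)) (eMem 12 (Var 1))) (eBool (choose_expr (Num 0) (Num 0) (eE (Var 0) (Var 1)))),
     Emit (eAnd (eEq (Var 0) (Num 0)) (eMem 12 (Var 1)))
       (eBool (choose_expr (eEq (Var 1) (Num 0)) (eEq (Var 1) (Num 0)) (eS (Var 1)))),
     Emit (eAnd (eEq (Var 0) (Num 0)) (eMem 12 (Var 1)))
       (eBool (choose_expr (eEq (Var 1) (Num 1)) (eEq (Var 1) (Num 0)) (eT (Var 1))))]"

abbreviation "prepare_sem \<equiv> program_sem prepare_program"
abbreviation "kernel_program \<equiv> prepare_program @ output_program"
abbreviation "kernel_sem \<equiv> program_sem kernel_program"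

lemmas expr_defs = eNot_def eAnd_def eOr_def eEq_def eEx_def eAll_def eBool_def eCount_def eMem_def eRow_def
  eE_def eS_def eT_def shrink_expr_def unblocked_expr_def leaf_expr_def trimmed_expr_def grow_expr_def
  refuted_expr_def trivial_expr_def choose_expr_def

lemma reads_times_k: "reads ((times_k ^^ m) (Num c)) \<subseteq> {0, 2}"
  by (induction m) (auto simp: times_k_def eCount_def eBool_def eS_def)

lemma kernel_program_ok: "\<forall>i\<in>set kernel_program. instr_ok i"
proof -
  have "reads kept_expr \<subseteq> {0, 2, 7, 8}"
    unfolding kept_expr_def using reads_times_k[of 9 2560] by (auto simp: expr_defs)
  then have "instr_ok (Define 10 kept_expr)" by auto
  then show ?thesis by (simp add: prepare_program_def output_program_def expr_defs)
qed

lemma kernel_sem_eq: "kernel_sem n D = program_sem output_program n (prepare_sem n D)"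
  by (simp add: program_sem_def)

lemma output_sem_eq: "program_sem output_program n D =
  emit_sem (eAnd (eEq (Var 0) (Num 0)) (eMem 12 (Var 1)))
    (eBool (choose_expr (eEq (Var 1) (Num 1)) (eEq (Var 1) (Num 0)) (eT (Var 1)))) n
  (emit_sem (eAnd (eEq (Var 0) (Num 0)) (eMem 12 (Var 1)))
    (eBool (choose_expr (eEq (Var 1) (Num 0)) (eEq (Var 1) (Num 0)) (eS (Var 1)))) n
  (emit_sem (eAnd (eMem 12 (Var 0)) (eMem 12 (Var 1))) (eBool (choose_expr (Num 0) (Num 0) (eE (Var 0) (Var 1)))) n
  (emit_sem (eAnd (eEq (Var 0) (Num 0)) (eEq (Var 1) (Num 0))) (eCount 2 (eMem 12 (Var 2))) n D)))"
  by (simp add: program_sem_def output_program_def)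

lemma concat_index:
  "concat (map G [0..<m * n]) = concat (map (\<lambda>u. concat (map (\<lambda>v. G (u * n + v)) [0..<n])) [0..<m])"
proof (induction m)
  case (Suc m)
  have "[0..<m * n + n] = [0..<m * n] @ [m * n..<m * n + n]" by (rule upt_add_eq_append) simp
  moreover have "[m * n..<m * n + n] = map (\<lambda>v. m * n + v) [0..<n]"
    using map_add_upt[of "m * n" n] by (simp add: add.commute)
  moreover have "Suc m * n = m * n + n" by simp
  ultimately have "[0..<Suc m * n] = [0..<m * n] @ map (\<lambda>v. m * n + v) [0..<n]" by metis
  then show ?case using Suc by (simp add: o_def)
qed simp

lemma emit_snd:
  "snd (emit_sem b e n D) = snd D @ concat (map (\<lambda>u. concat (map (\<lambda>v.
     if holds_at b n (env2 u v) (fst D) then [val e n (env2 u v) (fst D)] else []) [0..<n])) [0..<n])"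
  unfolding emit_sem_def snd_conv concat_index
  by (auto simp: env_index holds_at_def intro!: arg_cong[of _ _ concat] map_cong)

lemma emit_fst [simp]: "fst (emit_sem b e n D) = fst D" by (simp add: emit_sem_def)

lemma concat_filter:
  "concat (map (\<lambda>v. if P v then f v else []) xs) = concat (map f (filter P xs))"
  by (induction xs) auto

lemma concat_at_zero:
  assumes "0 < n" "\<And>u. 0 < u \<Longrightarrow> f u = []" shows "concat (map f [0..<n]) = f 0"
proof -
  have "[0..<n] = 0 # [Suc 0..<n]" using assms(1) by (simp add: upt_conv_Cons)
  moreover have "concat (map f [Suc 0..<n]) = []" using assms(2) by auto
  ultimately show ?thesis by simp
qed

text \<open>Links the increasing order of the output loops to the numbering chosen in
  \<open>sub_instance\<close>.\<close>

lemma sorted_list_filter: "X \<subseteq> {..<n} \<Longrightarrow> sorted_list_of_set X = filter (\<lambda>v. v \<in> X) [0..<n]"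
proof -
  assume X: "X \<subseteq> {..<n}"
  have "sorted_list_of_set (set (filter (\<lambda>v. v \<in> X) [0..<n])) = filter (\<lambda>v. v \<in> X) [0..<n]"
    by (rule sorted_list_of_set.idem_if_sorted_distinct) (auto intro: sorted_wrt_filter)
  moreover have "set (filter (\<lambda>v. v \<in> X) [0..<n]) = X" using X by auto
  ultimately show ?thesis by simp
qed

context ts_input
begin

abbreviation "n \<equiv> card V"

lemma V_eq: "V = {..<n}" using valid unfolding ts_valid_def by blast

lemma V_iff: "v \<in> V \<longleftrightarrow> v < n" using V_eq by (metis lessThan_iff)

definition input :: "(nat \<Rightarrow> nat \<Rightarrow> nat) \<Rightarrow> bool" where
  "input A \<longleftrightarrow> offsets n A \<and> (\<forall>u<n. \<forall>v<n. A 0 (1 + (u * n + v)) = of_bool (E u v)) \<and>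
     (\<forall>v<n. A 0 (1 + (n * n + v)) = of_bool (v \<in> S)) \<and> (\<forall>v<n. A 0 (1 + (n * n + (n + v))) = of_bool (v \<in> T))"

lemma input_offsets: "input A \<Longrightarrow> offsets n A" by (simp add: input_def)

lemma input_cong: "A 0 = B 0 \<Longrightarrow> A 2 = B 2 \<Longrightarrow> input A \<longleftrightarrow> input B"
  by (simp add: input_def offsets_def)

lemma holds_at_input [simp]:
  assumes "input A"
  shows "val u n \<sigma> A < n \<Longrightarrow> val v n \<sigma> A < n \<Longrightarrow> holds_at (eE u v) n \<sigma> A \<longleftrightarrow> E (val u n \<sigma> A) (val v n \<sigma> A)"
    "val v n \<sigma> A < n \<Longrightarrow> holds_at (eS v) n \<sigma> A \<longleftrightarrow> val v n \<sigma> A \<in> S"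
    "val v n \<sigma> A < n \<Longrightarrow> holds_at (eT v) n \<sigma> A \<longleftrightarrow> val v n \<sigma> A \<in> T"
  using assms by (simp_all add: holds_at_def eE_def eS_def eT_def input_def offsets_def)

lemma S_lt: "v \<in> S \<Longrightarrow> v < n" and T_lt: "v \<in> T \<Longrightarrow> v < n"
  using indepS(2) indepT(2) V_iff by auto

lemma card_V: "card S \<le> n" "card T \<le> n" "1 \<le> n"
  using card_mono[OF fin indepS(2)] card_mono[OF fin indepT(2)] cards by auto

lemma times_k_val: "input A \<Longrightarrow> val ((times_k ^^ m) (Num c)) n \<sigma> A = k ^ m * c"
proof (induction m arbitrary: \<sigma>)
  case (Suc m)
  have c: "{v. v < n \<and> v \<in> S} = S" using S_lt by auto
  have k: "val (eCount 4 (eS (Var 4))) n \<sigma> A = k" for \<sigma>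
    using Suc.prems by (simp add: c cards cong: conj_cong)
  \<comment> \<open>The sum ranges over numbers below \<open>n\<close> only; it has \<open>k\<close>
    nonzero summands at most because of tokens, and no index below \<open>k\<close> is missing since
    \<open>k\<close> is at most \<open>n\<close>.\<close>
  have "{..<n} \<inter> {v. v < k} = {..<k}" using card_V cards by auto
  then show ?case using Suc
    by (simp add: times_k_def[of "(times_k ^^ m) (Num c)"] k sum.If_cases del: val_eCount)
qed simp

lemma shrink_row:
  assumes "input A" "0 < n"
  shows "{v. v < n \<and> holds_at (shrink_expr a) n (env2 0 v) A} = shrink E V (row n A a 0)"
proof -
  have r: "row n A a 0 \<subseteq> {..<n}" by (auto simp: row_def)
  have "holds_at (shrink_expr a) n (env2 0 v) A \<longleftrightarrow> v \<in> row n A a 0 \<and>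
      (\<forall>w<n. E v w \<longrightarrow> (\<exists>u<n. u \<in> row n A a 0 \<and> u \<noteq> v \<and> E w u))" if "v < n" for v
    unfolding shrink_expr_def using that assms by (simp cong: conj_cong; blast)
  then have "{v. v < n \<and> holds_at (shrink_expr a) n (env2 0 v) A} = {v. v < n \<and> v \<in> row n A a 0 \<and>
      (\<forall>w<n. E v w \<longrightarrow> (\<exists>u<n. u \<in> row n A a 0 \<and> u \<noteq> v \<and> E w u))}" by blast
  also have "\<dots> = shrink E V (row n A a 0)"
    unfolding shrink_def using r V_iff by blast
  finally show ?thesis .
qed

lemma holds_at_leaf:
  assumes "input A" "row n A 6 0 = U" "\<sigma> i < n" "\<sigma> 2 < n" "i \<noteq> 4"
  shows "holds_at (leaf_expr (Var i)) n \<sigma> A \<longleftrightarrow> leaf E U (\<sigma> i) (\<sigma> 2)"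
proof -
  have "U \<subseteq> {..<n}" using assms(2) by (auto simp: row_def)
  moreover have "holds_at (leaf_expr (Var i)) n \<sigma> A \<longleftrightarrow> \<sigma> i \<in> U \<and> \<sigma> 2 \<in> U \<and> E (\<sigma> i) (\<sigma> 2) \<and>
      (\<forall>w<n. w \<in> U \<and> E (\<sigma> i) w \<longrightarrow> w = \<sigma> 2)"
    unfolding leaf_expr_def using assms by (simp cong: conj_cong; blast)
  ultimately show ?thesis unfolding leaf_def by blast
qed

lemma input_def_sem [simp]: "a \<noteq> 0 \<Longrightarrow> a \<noteq> 2 \<Longrightarrow> input (fst (def_sem a e n D)) \<longleftrightarrow> input (fst D)"
  by (rule input_cong) (simp_all add: def_sem_other)

lemma input_iter_sem [simp]: "a \<noteq> 0 \<Longrightarrow> a \<noteq> 2 \<Longrightarrow> input (fst (iter_sem a e n D)) \<longleftrightarrow> input (fst D)"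
  by (rule input_cong) (simp_all add: iter_sem_other)

lemma row_other [simp]:
  "b \<noteq> a \<Longrightarrow> row m (fst (def_sem a e n D)) b u = row m (fst D) b u"
  "b \<noteq> a \<Longrightarrow> b \<noteq> 4 \<Longrightarrow> row m (fst (iter_sem a e n D)) b u = row m (fst D) b u"
  by (rule row_cong; simp add: def_sem_other iter_sem_other)+

lemma row_shrink:
  assumes "input (fst D)" "row n (fst D) a 0 = R" "R \<subseteq> V" "a \<notin> {0, 2, 4}"
  shows "row n (fst (iter_sem a (shrink_expr a) n D)) a 0 = rigid_core E V R"
proof -
  have "row n (fst (iter_sem a (shrink_expr a) n D)) a 0 = (shrink E V ^^ n) (row n (fst D) a 0)"
  proof (rule row_iter_sem)
    fix A assume "\<And>b. b \<noteq> a \<Longrightarrow> b \<noteq> 4 \<Longrightarrow> A b = fst D b"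
    then have "input A" using input_cong[of A "fst D"] assms(1,4) by simp
    then show "{v. v < n \<and> holds_at (shrink_expr a) n (env2 0 v) A} = shrink E V (row n A a 0)"
      by (rule shrink_row) (use card_V in simp)
  qed (use assms card_V input_offsets in auto)
  also have "\<dots> = rigid_core E V R"
    unfolding assms(2) by (rule shrink_rigid_core) (use fin assms(3) finite_subset card_mono in auto)
  finally show ?thesis .
qed

lemma removed_V: "ts_removed P \<subseteq> V" "rigid_core E V T \<subseteq> V"
  using rigid_core_subset[of E V S] rigid_core_subset[of E V T] indepS(2) indepT(2) unfolding ts_removed_def by blast+

lemma trimmed_unblocked: "ts_trimmed P \<subseteq> ts_unblocked P" "ts_unblocked P \<subseteq> V"
  unfolding ts_trimmed_def trim_def ts_unblocked_def by auto

lemma ts_component_trimmed: "ts_component P v \<subseteq> ts_trimmed P"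
  unfolding ts_component_def component_of_def by blast

lemma row_unblocked:
  assumes "input (fst D)" "row n (fst D) 3 0 = ts_removed P"
  shows "row n (fst (def_sem 6 unblocked_expr n D)) 6 0 = ts_unblocked P"
proof -
  have n: "0 < n" using card_V by simp
  have "holds_at unblocked_expr n (env2 0 v) (fst D) \<longleftrightarrow> v \<notin> ts_removed P \<and> \<not> (\<exists>u<n. u \<in> ts_removed P \<and> E u v)"
    if "v < n" for v
    unfolding unblocked_expr_def using that assms by (simp cong: conj_cong)
  then have "row n (fst (def_sem 6 unblocked_expr n D)) 6 0 =
      {v. v < n \<and> v \<notin> ts_removed P \<and> \<not> (\<exists>u<n. u \<in> ts_removed P \<and> E u v)}"
    unfolding row_def_sem[OF n] by blast
  also have "\<dots> = ts_unblocked P" unfolding ts_unblocked_def using removed_V(1) V_iff by blast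
  finally show ?thesis .
qed

lemma row_trimmed:
  assumes "input (fst D)" "row n (fst D) 6 0 = ts_unblocked P"
  shows "row n (fst (def_sem 7 trimmed_expr n D)) 7 0 = ts_trimmed P"
proof -
  have n: "0 < n" using card_V by simp
  have l: "leaf E (ts_unblocked P) v c \<Longrightarrow> v < n \<and> c < n" for v c
    using trimmed_unblocked(2) V_iff unfolding leaf_def by blast
  have u: "v \<in> ts_unblocked P \<Longrightarrow> v < n" for v using trimmed_unblocked(2) V_iff by blast
  have "holds_at trimmed_expr n (env2 0 v) (fst D) \<longleftrightarrow> v \<in> ts_unblocked P \<and> ((v \<in> S \<or> v \<in> T) \<or>
      \<not> (\<exists>c<n. leaf E (ts_unblocked P) v c \<and> (\<exists>w<n. w < v \<and> leaf E (ts_unblocked P) w c)))" if "v < n" for v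
    unfolding trimmed_expr_def using that assms by (simp add: holds_at_leaf[OF assms] cong: conj_cong)
  moreover have "v \<in> ts_trimmed P \<longleftrightarrow> v \<in> ts_unblocked P \<and> ((v \<in> S \<or> v \<in> T) \<or>
      \<not> (\<exists>c<n. leaf E (ts_unblocked P) v c \<and> (\<exists>w<n. w < v \<and> leaf E (ts_unblocked P) w c)))" for v
    unfolding ts_trimmed_def trim_def using l by blast
  ultimately have "holds_at trimmed_expr n (env2 0 v) (fst D) \<longleftrightarrow> v \<in> ts_trimmed P" if "v < n" for v
    using that by blast
  then show ?thesis unfolding row_def_sem[OF n] using trimmed_unblocked(1) u by blast
qed

text \<open>Row \<open>u\<close> starts with \<open>u\<close> alone and grows for \<open>n\<close>
  rounds. For a deleted \<open>u\<close> it starts empty and stays empty.\<close>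

lemma row_components:
  assumes inp: "input (fst D)" and t: "row n (fst D) 7 0 = ts_trimmed P" and u: "u < n"
  shows "row n (fst (iter_sem 8 grow_expr n (def_sem 8 (eAnd (eMem 7 (Var 1)) (eEq (Var 0) (Var 1))) n D))) 8 u =
    (if u \<in> ts_trimmed P then ts_component P u else {})"
proof -
  let ?D = "def_sem 8 (eAnd (eMem 7 (Var 1)) (eEq (Var 0) (Var 1))) n D"
  let ?g = "grow E (ts_trimmed P)"
  have init: "row n (fst ?D) 8 u = (if u \<in> ts_trimmed P then {u} else {})"
    unfolding row_def_sem[OF u] using u t by (auto cong: conj_cong)
  have "row n (fst (iter_sem 8 grow_expr n ?D)) 8 u = (?g ^^ n) (row n (fst ?D) 8 u)"
  proof (rule row_iter_sem)
    fix A assume A: "\<And>b. b \<noteq> 8 \<Longrightarrow> b \<noteq> 4 \<Longrightarrow> A b = fst ?D b"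
    then have i: "input A" using input_cong[of A "fst ?D"] inp by simp
    have tA: "row n A 7 0 = ts_trimmed P" using row_cong[of A 7 "fst ?D" n 0] A t by simp
    have r: "row n A 8 u \<subseteq> {..<n}" by (auto simp: row_def)
    have W: "ts_trimmed P \<subseteq> {..<n}" using trimmed_unblocked V_iff by blast
    show "{v. v < n \<and> holds_at grow_expr n (env2 u v) A} = ?g (row n A 8 u)"
    proof -
      have "holds_at grow_expr n (env2 u v) A \<longleftrightarrow> v \<in> row n A 8 u \<or>
          v \<in> ts_trimmed P \<and> (\<exists>w<n. w \<in> row n A 8 u \<and> E w v)" if "v < n" for v
        unfolding grow_expr_def using that i tA u input_offsets[OF i] by (simp cong: conj_cong)
      then have "{v. v < n \<and> holds_at grow_expr n (env2 u v) A} = {v. v < n \<and> (v \<in> row n A 8 u \<or>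
          v \<in> ts_trimmed P \<and> (\<exists>w<n. w \<in> row n A 8 u \<and> E w v))}" by blast
      also have "\<dots> = ?g (row n A 8 u)" unfolding grow_def using r W by blast
      finally show ?thesis .
    qed
  qed (use inp u input_offsets[of "fst ?D"] in auto)
  also have "\<dots> = (if u \<in> ts_trimmed P then ts_component P u else {})"
  proof (cases "u \<in> ts_trimmed P")
    case True
    have W: "ts_trimmed P \<subseteq> V" using trimmed_unblocked by blast
    have "(?g ^^ n) {u} = ts_component P u" unfolding ts_component_def
      by (rule grow_component[OF finite_subset[OF W fin] card_mono[OF fin W] True])
    then show ?thesis using True init by simp
  next
    case False
    have "(?g ^^ i) {} = {}" for i by (induction i) (auto simp: grow_def)
    then show ?thesis using False init by simp
  qed
  finally show ?thesis .
qed

lemma row_refuted: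
  assumes inp: "input (fst D)" and "row n (fst D) 3 0 = ts_removed P" "row n (fst D) 5 0 = rigid_core E V T"
    "row n (fst D) 7 0 = ts_trimmed P" "\<And>u. u < n \<Longrightarrow> row n (fst D) 8 u = (if u \<in> ts_trimmed P then ts_component P u else {})"
  shows "row n (fst (def_sem 9 refuted_expr n D)) 9 0 = (if ts_refuted P then {..<n} else {})"
proof -
  have n: "0 < n" using card_V by simp
  have W: "ts_trimmed P \<subseteq> {..<n}" using trimmed_unblocked V_iff by blast
  have s: "{v. v < n \<and> v \<in> H \<and> v \<in> ts_component P u} = H \<inter> ts_component P u" for H u
    using ts_component_trimmed[of u] W by auto
  have neq: "rigid_core E V T \<noteq> ts_removed P \<longleftrightarrow> (\<exists>v<n. (v \<in> ts_removed P) \<noteq> (v \<in> rigid_core E V T))"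
    using removed_V V_iff by blast
  have t: "(\<exists>v\<in>ts_trimmed P. Q v) \<longleftrightarrow> (\<exists>v<n. v \<in> ts_trimmed P \<and> Q v)" for Q using W by blast
  have "holds_at refuted_expr n (env2 0 v) (fst D) \<longleftrightarrow> ts_refuted P" if "v < n" for v
    unfolding refuted_expr_def ts_refuted_def neq t using assms input_offsets[OF inp]
    by (simp add: s of_bool_eq_iff cong: conj_cong)
  then show ?thesis unfolding row_def_sem[OF n] by auto
qed

lemma row_kept:
  assumes inp: "input (fst D)" and "row n (fst D) 7 0 = ts_trimmed P"
    "\<And>u. u < n \<Longrightarrow> row n (fst D) 8 u = (if u \<in> ts_trimmed P then ts_component P u else {})"
  shows "row n (fst (def_sem 10 kept_expr n D)) 10 0 = ts_kept P"
proof -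
  have n: "0 < n" using card_V by simp
  have W: "ts_trimmed P \<subseteq> {..<n}" using trimmed_unblocked V_iff by blast
  have s: "{v. v < n \<and> v \<in> ts_component P u} = ts_component P u" for u
    using ts_component_trimmed[of u] W by auto
  have b: "val ((times_k ^^ 9) (Num 2560)) n \<sigma> (fst D) = size_bound k" for \<sigma>
    unfolding times_k_val[OF inp] size_bound_def by simp
  have ne: "S \<inter> ts_component P v \<noteq> {} \<longleftrightarrow> (\<exists>w<n. w \<in> S \<and> w \<in> ts_component P v)" for v
    using S_lt by blast
  have "holds_at kept_expr n (env2 0 v) (fst D) \<longleftrightarrow> v \<in> ts_kept P" if "v < n" for v
    unfolding kept_expr_def ts_kept_def ne mem_Collect_eq using assms input_offsets[OF inp] that
    by (simp add: s b not_less cong: conj_cong)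
  then show ?thesis unfolding row_def_sem[OF n] using W unfolding ts_kept_def by auto
qed

lemma prepare_rows:
  assumes inp: "input (fst D)"
  defines "A \<equiv> fst (prepare_sem n D)"
  shows "input A" "row n A 9 0 = (if ts_refuted P then {..<n} else {})"
    "row n A 11 0 = (if S \<inter> ts_kept P = {} then {..<n} else {})"
    "row n A 12 0 = (if ts_refuted P then {v. v < n \<and> v < 2} else if S \<inter> ts_kept P = {} then {0} else ts_kept P)"
    "snd (prepare_sem n D) = snd D"
proof -
  have n: "0 < n" using card_V by simp
  define D1 where "D1 = def_sem 3 (eS (Var 1)) n D"
  define D2 where "D2 = iter_sem 3 (shrink_expr 3) n D1"
  define D3 where "D3 = def_sem 5 (eT (Var 1)) n D2"
  define D4 where "D4 = iter_sem 5 (shrink_expr 5) n D3"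
  define D5 where "D5 = def_sem 6 unblocked_expr n D4"
  define D6 where "D6 = def_sem 7 trimmed_expr n D5"
  define D7 where "D7 = iter_sem 8 grow_expr n (def_sem 8 (eAnd (eMem 7 (Var 1)) (eEq (Var 0) (Var 1))) n D6)"
  define D8 where "D8 = def_sem 9 refuted_expr n D7"
  define D9 where "D9 = def_sem 10 kept_expr n D8"
  define D10 where "D10 = def_sem 11 trivial_expr n D9"
  define D11 where "D11 = def_sem 12 (choose_expr (Lt (Var 1) (Num 2)) (Lt (Var 1) (Num 1)) (eMem 10 (Var 1))) n D10"
  have D: "prepare_sem n D = D11"
    by (simp add: program_sem_def prepare_program_def D1_def D2_def D3_def D4_def D5_def D6_def D7_def D8_def D9_def D10_def D11_def)
  have i: "input (fst D1)" "input (fst D2)" "input (fst D3)" "input (fst D4)" "input (fst D5)" "input (fst D6)"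
    "input (fst D7)" "input (fst D8)" "input (fst D9)" "input (fst D10)" "input (fst D11)"
    using inp by (simp_all add: D1_def D2_def D3_def D4_def D5_def D6_def D7_def D8_def D9_def D10_def D11_def)
  have "row n (fst D1) 3 0 = S" unfolding D1_def row_def_sem[OF n] using inp S_lt by (auto cong: conj_cong)
  then have r3: "row n (fst D2) 3 0 = ts_removed P"
    unfolding D2_def ts_removed_def by (rule row_shrink[OF i(1)]) (use indepS(2) in auto)
  have "row n (fst D3) 5 0 = T" unfolding D3_def row_def_sem[OF n] using i(2) T_lt by (auto cong: conj_cong)
  then have r5: "row n (fst D4) 5 0 = rigid_core E V T"
    unfolding D4_def by (rule row_shrink[OF i(3)]) (use indepT(2) in auto)
  have r34: "row n (fst D4) 3 0 = ts_removed P" using r3 by (simp add: D4_def D3_def)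
  have r6: "row n (fst D5) 6 0 = ts_unblocked P" unfolding D5_def by (rule row_unblocked[OF i(4) r34])
  have r7: "row n (fst D6) 7 0 = ts_trimmed P" unfolding D6_def by (rule row_trimmed[OF i(5) r6])
  have r8: "row n (fst D7) 8 u = (if u \<in> ts_trimmed P then ts_component P u else {})" if "u < n" for u
    unfolding D7_def by (rule row_components[OF i(6) r7 that])
  have r7': "row n (fst D7) 3 0 = ts_removed P" "row n (fst D7) 5 0 = rigid_core E V T" "row n (fst D7) 7 0 = ts_trimmed P"
    using r34 r5 r7 by (simp_all add: D7_def D6_def D5_def)
  have r9: "row n (fst D8) 9 0 = (if ts_refuted P then {..<n} else {})"
    unfolding D8_def by (rule row_refuted[OF i(7) r7' r8])
  have r8': "row n (fst D8) 7 0 = ts_trimmed P" "\<And>u. u < n \<Longrightarrow> row n (fst D8) 8 u = (if u \<in> ts_trimmed P then ts_component P u else {})"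
    using r7'(3) r8 by (simp_all add: D8_def)
  have r10: "row n (fst D9) 10 0 = ts_kept P" unfolding D9_def by (rule row_kept[OF i(8) r8'])
  have r11: "row n (fst D10) 11 0 = (if S \<inter> ts_kept P = {} then {..<n} else {})"
  proof -
    have "(\<exists>v<n. v \<in> S \<and> v \<in> ts_kept P) \<longleftrightarrow> S \<inter> ts_kept P \<noteq> {}" using S_lt by blast
    then show ?thesis unfolding D10_def row_def_sem[OF n] trivial_expr_def using i(9) r10
      by (auto cong: conj_cong)
  qed
  have r9': "row n (fst D10) 9 0 = (if ts_refuted P then {..<n} else {})" "row n (fst D10) 10 0 = ts_kept P"
    using r9 r10 by (simp_all add: D10_def D9_def)
  have kn: "ts_kept P \<subseteq> {..<n}" using trimmed_unblocked V_iff unfolding ts_kept_def by blast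
  have r12: "row n (fst D11) 12 0 = (if ts_refuted P then {v. v < n \<and> v < 2} else if S \<inter> ts_kept P = {} then {0} else ts_kept P)"
    unfolding D11_def row_def_sem[OF n] choose_expr_def using r11 r9' kn n by (auto cong: conj_cong)
  show "input A" "row n A 12 0 = (if ts_refuted P then {v. v < n \<and> v < 2} else if S \<inter> ts_kept P = {} then {0} else ts_kept P)"
    unfolding A_def D using i(11) r12 by auto
  show "row n A 9 0 = (if ts_refuted P then {..<n} else {})" "row n A 11 0 = (if S \<inter> ts_kept P = {} then {..<n} else {})"
    unfolding A_def D using r9' r11 by (simp_all add: D11_def)
  show "snd (prepare_sem n D) = snd D"
    by (simp add: program_sem_def prepare_program_def def_sem_other(2) iter_sem_other(2)[where b = 0])
qed

text \<open>The program can only output vertices below \<open>n\<close>, but the trivial no-instance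
  uses the vertex 1. With a single vertex, source and target coincide and nothing can be
  refuted.\<close>

lemma refuted_size: "ts_refuted P \<Longrightarrow> 2 \<le> n"
proof (rule ccontr)
  assume r: "ts_refuted P" and "\<not> 2 \<le> n"
  have V: "V \<subseteq> {0}"
  proof
    fix v assume "v \<in> V"
    then have "v < n" using V_iff by blast
    then show "v \<in> {0}" using \<open>\<not> 2 \<le> n\<close> by simp
  qed
  have zero: "H = {0}" if "H \<subseteq> V" "card H \<ge> 1" for H
  proof -
    have "H \<noteq> {}" using that(2) by auto
    then show ?thesis using that(1) V by blast
  qed
  have "1 \<le> card S" "1 \<le> card T" using cards by simp_all
  then have "S = {0}" "T = {0}" using zero indepS(2) indepT(2) by blast+
  then show False using r unfolding ts_refuted_def ts_removed_def by simp
qed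

lemma kernel_output:
  assumes inp: "input (fst D)" and "snd D = []"
  shows "snd (kernel_sem n D) = ts_encode (ts_kernel P)"
proof -
  define A where "A = fst (prepare_sem n D)"
  note rows = prepare_rows[OF inp, folded A_def]
  have n: "0 < n" using card_V by simp
  define X where "X = row n A 12 0"
  \<comment> \<open>\<open>E'\<close>, \<open>S'\<close> and \<open>T'\<close> merge the three cases
    of \<open>ts_kernel\<close> into one \<open>sub_instance\<close> on the contents
    \<open>X\<close> of array 12, so that the output is compared with a single encoding.\<close>
  define E' where "E' u v \<longleftrightarrow> \<not> ts_refuted P \<and> S \<inter> ts_kept P \<noteq> {} \<and> E u v" for u v
  define S' where "S' = (if ts_refuted P \<or> S \<inter> ts_kept P = {} then {0} else S)"
  define T' where "T' = (if ts_refuted P then {1} else if S \<inter> ts_kept P = {} then {0} else T)"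
  have Xn: "X \<subseteq> {..<n}" by (auto simp: X_def row_def)
  define xs where "xs = sorted_list_of_set X"
  have xs: "xs = filter (\<lambda>v. v \<in> X) [0..<n]" unfolding xs_def by (rule sorted_list_filter[OF Xn])
  have "{v. v < n \<and> v < 2} = {0, 1}" if "ts_refuted P" using refuted_size[OF that] by auto
  then have "ts_kernel P = sub_instance X E' S' T'"
    unfolding ts_kernel_def X_def rows(4) E'_def S'_def T'_def by simp
  then have enc: "ts_encode (ts_kernel P) = card X # concat (map (\<lambda>u. map (\<lambda>v. of_bool (E' u v)) xs) xs)
      @ map (\<lambda>v. of_bool (v \<in> S')) xs @ map (\<lambda>v. of_bool (v \<in> T')) xs"
    unfolding xs_def using sub_instance_encode[OF finite_subset[OF Xn finite_lessThan]] by simp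
  have c: "{v. v < n \<and> v \<in> X} = X" using Xn by auto
  have ch: "holds_at (choose_expr e1 e2 e3) n (env2 u v) A \<longleftrightarrow> (if ts_refuted P then holds_at e1 n (env2 u v) A
      else if S \<inter> ts_kept P = {} then holds_at e2 n (env2 u v) A else holds_at e3 n (env2 u v) A)"
    if "v < n" for e1 e2 e3 u v
    unfolding choose_expr_def using that rows(2,3) by auto
  have z: "\<not> holds_at (Num 0) n \<sigma> A" for \<sigma> by (simp add: holds_at_def)
  have L1: "concat (map (\<lambda>u. concat (map (\<lambda>v. if holds_at (eAnd (eEq (Var 0) (Num 0)) (eEq (Var 1) (Num 0))) n (env2 u v) A
      then [val (eCount 2 (eMem 12 (Var 2))) n (env2 u v) A] else []) [0..<n])) [0..<n]) = [card X]"
    (is "concat (map ?f _) = _")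
  proof -
    have "concat (map ?f [0..<n]) = ?f 0" by (rule concat_at_zero[OF n]) simp
    also have "\<dots> = [card X]" by (subst concat_at_zero[OF n]) (simp_all add: c flip: X_def cong: conj_cong)
    finally show ?thesis .
  qed
  have L2: "concat (map (\<lambda>u. concat (map (\<lambda>v. if holds_at (eAnd (eMem 12 (Var 0)) (eMem 12 (Var 1))) n (env2 u v) A
      then [val (eBool (choose_expr (Num 0) (Num 0) (eE (Var 0) (Var 1)))) n (env2 u v) A] else []) [0..<n])) [0..<n]) =
      concat (map (\<lambda>u. map (\<lambda>v. of_bool (E' u v)) xs) xs)"
    (is "concat (map ?f _) = _")
  proof -
    have "?f u = (if u \<in> X then map (\<lambda>v. of_bool (E' u v)) xs else [])" if "u < n" for u
    proof -
      have "?f u = concat (map (\<lambda>v. if v \<in> X then (if u \<in> X then [of_bool (E' u v)] else []) else []) [0..<n])"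
        by (rule arg_cong[of _ _ concat], rule map_cong)
          (use that rows(1) in \<open>auto simp: ch z E'_def simp flip: X_def\<close>)
      then show ?thesis by (simp add: concat_filter flip: xs)
    qed
    then have "concat (map ?f [0..<n]) = concat (map (\<lambda>u. if u \<in> X then map (\<lambda>v. of_bool (E' u v)) xs else []) [0..<n])"
      by (intro arg_cong[of _ _ concat] map_cong) auto
    then show ?thesis by (simp add: concat_filter flip: xs)
  qed
  have L3: "concat (map (\<lambda>u. concat (map (\<lambda>v. if holds_at (eAnd (eEq (Var 0) (Num 0)) (eMem 12 (Var 1))) n (env2 u v) A
      then [val (eBool e) n (env2 u v) A] else []) [0..<n])) [0..<n]) = map (\<lambda>v. of_bool (v \<in> H)) xs"
    (is "concat (map ?f _) = _") if H: "\<And>v. v < n \<Longrightarrow> holds_at e n (env2 0 v) A \<longleftrightarrow> v \<in> H" for e H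
  proof -
    have "concat (map ?f [0..<n]) = ?f 0" by (rule concat_at_zero[OF n]) simp
    also have "\<dots> = concat (map (\<lambda>v. if v \<in> X then [of_bool (v \<in> H)] else []) [0..<n])"
      by (rule arg_cong[of _ _ concat], rule map_cong) (use H in \<open>auto simp flip: X_def\<close>)
    also have "\<dots> = map (\<lambda>v. of_bool (v \<in> H)) xs" by (simp add: concat_filter flip: xs)
    finally show ?thesis .
  qed
  have "snd (kernel_sem n D) = [card X] @ concat (map (\<lambda>u. map (\<lambda>v. of_bool (E' u v)) xs) xs)
      @ map (\<lambda>v. of_bool (v \<in> S')) xs @ map (\<lambda>v. of_bool (v \<in> T')) xs"
    unfolding kernel_sem_eq output_sem_eq emit_snd emit_fst A_def[symmetric] rows(5) assms(2) L1 L2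
    by (subst L3[of _ S'], use rows(1) in \<open>simp add: ch S'_def\<close>, subst L3[of _ T'], use rows(1) in \<open>simp add: ch T'_def\<close>) simp
  then show ?thesis unfolding enc by simp
qed

lemma input_init: "input (init_arrays n (ts_encode P))"
proof -
  let ?e = "\<lambda>i. of_bool (E (i div n) (i mod n)) :: nat"
  have "concat (map (\<lambda>u. map (\<lambda>v. of_bool (E u v)) [0..<n]) [0..<n]) = concat (map (\<lambda>i. [?e i]) [0..<n * n])"
    unfolding concat_index by (rule arg_cong[of _ _ concat], rule map_cong) (auto intro!: map_cong)
  also have "\<dots> = map ?e [0..<n * n]" by simp
  finally have enc: "ts_encode P = n # map ?e [0..<n * n] @ map (\<lambda>v. of_bool (v \<in> S)) [0..<n] @ map (\<lambda>v. of_bool (v \<in> T)) [0..<n]"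
    by (simp add: ts_encode_def Let_def)
  have i: "u * n + v < n * n" if "u < n" "v < n" for u v using index_less that by blast
  show ?thesis
    unfolding input_def offsets_def
    by (auto simp: init_arrays_def enc nth_append i dest: i)
qed

end

theorem theorem20:
  shows "\<exists>f :: nat \<Rightarrow> nat.
    (\<lambda>k. real (f k)) \<in> O(\<lambda>k. real k ^ 12) \<and>
    ts_kernel_on (\<lambda>G. bipartite G \<and> C4_free G) f"
proof -
  let ?f = "\<lambda>k. k * size_bound k + 2"
  let ?C = "\<lambda>G. bipartite G \<and> C4_free G"
  \<comment> \<open>\<open>?f k\<close> equals \<open>2560 * k ^ 10 + 2\<close>.\<close>
  have O: "(\<lambda>k. real (?f k)) \<in> O(\<lambda>k. real k ^ 12)"
    unfolding size_bound_def by real_asymp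
  have inst: "ts_input P" if "P \<in> ts_instances_on ?C" for P
    using that unfolding ts_instances_on_def ts_input_def by blast
  have "polytime_on (ts_instances_on ?C) ts_encode ts_kernel"
  proof (rule polytime_on_implements[OF implements_program[OF kernel_program_ok]])
    fix P assume "P \<in> ts_instances_on ?C"
    then interpret ts_input P by (rule inst)
    have 0: "ts_encode P ! 0 = n" by (simp add: ts_encode_def Let_def)
    then show "ts_encode P \<noteq> [] \<and> ts_encode P ! 0 \<le> length (ts_encode P)"
      by (simp add: ts_encode_def Let_def)
    show "snd (kernel_sem (ts_encode P ! 0) (init_arrays (ts_encode P ! 0) (ts_encode P), [])) = ts_encode (ts_kernel P)"
      unfolding 0 by (rule kernel_output) (simp_all add: input_init)
  qed
  moreover have "ts_kernel P \<in> ts_instances_on ?C \<and> (ts_yes (ts_kernel P) \<longleftrightarrow> ts_yes P) \<and>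
      card (pverts (ts_graph (ts_kernel P))) \<le> ?f (ts_param P)" if "P \<in> ts_instances_on ?C" for P
    using ts_input.ts_kernel_correct[OF inst[OF that]] by blast
  ultimately have "ts_kernel_on ?C ?f"
    unfolding ts_kernel_on_def by (intro exI[of _ ts_kernel]) simp
  with O show ?thesis by (intro exI[of _ ?f] conjI)
qed

end
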